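(* Let $0<\alpha\leqslant 1$, $0<T<\infty$, $0<\theta_0\leqslant 1$, let $\mathcal R_{\theta_0}:Z\to[X^*,Y]_{\theta_0}$ be a bounded linear operator, $y_d\in Y$ and $\nu>0$. The problem $$\min_{u\in U_{\mathrm{ad}}} J_\alpha(u):=\tfrac12\,\|(\mathcal S_\alpha\mathcal R_{\theta_0}u)(T)-y_d\|_Y^2+\tfrac{\nu}{2}\,\|u\|_{L^2(0,T;Z)}^2$$ admits a unique solution $u\in U_{\mathrm{ad}}$, and the following first-order optimality condition holds: $$y=\mathcal S_\alpha\mathcal R_{\theta_0}u,\qquad p=\mathcal S_\alpha^*\big((y(T)-y_d)\delta_T\big),$$ $$\int_0^T\big(\mathcal R_{\theta_0}^*p(t)+\nu u(t),\,v(t)-u(t)\big)_Z\,\mathrm dt\geqslant 0\quad\text{for all } v\in U_{\mathrm{ad}}.$$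
   Context: The field of scalars of every vector space is $\mathbb C$; $(\cdot,\cdot)_{H}$ is the inner product of a Hilbert space $H$; $\mathcal L(B_1,B_2)$ is the space of bounded linear operators from $B_1$ to $B_2$, and $\mathcal L(B)=\mathcal L(B,B)$. $X,Y$ are separable Hilbert spaces, with $X$ continuously embedded and dense in $Y$. $X^*$ is the dual of $X$, with duality pairing $\langle\cdot,\cdot\rangle_X$, and $Y$ is regarded as a subspace of $X^*$ via $\langle v,w\rangle_X:=(v,w)_Y$ for $v\in Y$, $w\in X$. For $0<\theta<\pi$, $\Sigma_\theta:=\{re^{i\gamma}:r>0,\,-\theta<\gamma<\theta\}$. $\rho(B)$ is the resolvent set of a linear operator $B$, and $R(z,B)$ is the inverse of $z-B$ for $z\in\rho(B)$. $\mathcal A,\mathcal A^*:X\to Y$ are bounded linear operators for which there are constants $\pi/2<\omega_0<\pi$ and $c_0,c_1,\mathcal M_0>0$ such that: $\rho(\mathcal A)\supset\Sigma_{\omega_0}\cup\{0\}$ and $\rho(\mathcal A^* )\supset\Sigma_{\omega_0}\cup\{0\}$; $\|R(z,\mathcal A)\|_{\mathcal L(Y)}\leqslant\mathcal M_0/(1+|z|)$ and $\|R(z,\mathcal A^* )\|_{\mathcal L(Y)}\leqslant\mathcal M_0/(1+|z|)$ for all $z\in\Sigma_{\omega_0}$; $(\mathcal Av,w)_Y=(v,\mathcal A^*w)_Y$ for all $v,w\in X$; $c_0\|v\|_X\leqslant\|\mathcal Av\|_Y\leqslant c_1\|v\|_X$ and $c_0\|v\|_X\leqslant\|\mathcal A^*v\|_Y\leqslant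 c_1\|v\|_X$ for all $v\in X$; $(\mathcal Av,v)_Y\leqslant0$ for all $v\in X$. They are extended to bounded linear operators $Y\to X^*$ by $\langle\mathcal Av,w\rangle_X:=(v,\mathcal A^*w)_Y$ and $\langle\mathcal A^*v,w\rangle_X:=(v,\mathcal Aw)_Y$ ($v\in Y$, $w\in X$); correspondingly $R(z,\mathcal A)$ and $R(z,\mathcal A^* )$ act on $X^*$ as the inverses of the extended operators $z-\mathcal A$, $z-\mathcal A^*:Y\to X^*$. $[X^*,Y]_\theta$ and $[X,Y]_\theta$ ($0\leqslant\theta\leqslant1$) are the complex interpolation spaces ($\theta=0$ gives $X^*$, resp. $X$; $\theta=1$ gives $Y$); $[X^*,Y]_\theta$ is the dual of $[X,Y]_\theta$, with duality pairing $\langle\cdot,\cdot\rangle_{[X,Y]_\theta}$. Let $\Gamma_{\omega_0}:=\{re^{-i\omega_0}:r\geqslant0\}\cup\{re^{i\omega_0}:r>0\}$, oriented so that the negative real axis is to its left. For $t>0$, $$E_\alpha(t):=\frac1{2\pi i}\int_{\Gamma_{\omega_0}}e^{tz}R(z^\alpha,\mathcal A)\,\mathrm dz,\qquad E_\alpha^*(t):=-\frac1{2\pi i}\int_{\Gamma_{\omega_0}}e^{t\overline z}R(\overline{z^\alpha},\mathcal A^* )\,\overline{\mathrm dz}.$$ For $g\in L^1(0,T;[X^*,Y]_\theta)$ with $0\leqslant\theta\leqslant1$, $(\mathcal S_\alpha g)(t):=\int_0^tE_\alpha(t-s)g(s)\,\mathrm ds$ for a.e. $0<t\leqslant T$; if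 $0<\theta\leqslant 1$ and $g\in L^q(0,T;[X^*,Y]_{\theta})$ with $q>1/(\theta\alpha)$, then $\mathcal S_\alpha g\in C([0,T];Y)$, so that $(\mathcal S_\alpha g)(T)$ is meaningful. For $v\in[X^*,Y]_\theta$ with $0\leqslant\theta\leqslant1$, $(\mathcal S_\alpha^*(v\delta_T))(t):=E_\alpha^*(T-t)v$ for $0<t<T$, where $\delta_T$ denotes the Dirac measure in time concentrated at $t=T$. $Z$ is a Hilbert space, and $U_{\mathrm{ad}}\subset L^\infty(0,T;Z)$ is a convex, bounded and closed subset of $L^2(0,T;Z)$. $\mathcal R_{\theta_0}^*:[X,Y]_{\theta_0}\to Z$ is defined by $(\mathcal R_{\theta_0}^*v,w)_Z:=\overline{\langle\mathcal R_{\theta_0}w,v\rangle_{[X,Y]_{\theta_0}}}$ for all $v\in[X,Y]_{\theta_0}$, $w\in Z$.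
   Formalization: Since scalars are complex, the optimality inequality is stated for the real part of the integral (as a claim that the complex integral is ≥ 0 it fails, e.g. for R = 0 and U_ad the constants in a disc), and U_ad is assumed nonempty. *)

theory Defs
  imports "HOL-Analysis.Analysis"
begin

section \<open>Complex Hilbert spaces\<close>

class scaleC =
  fixes scaleC :: "complex \<Rightarrow> 'a \<Rightarrow> 'a" (infixr \<open>*\<^sub>C\<close> 75)

class complex_normed_vector = real_normed_vector + scaleC +
  assumes scaleC_add_right: "c *\<^sub>C (x + y) = c *\<^sub>C x + c *\<^sub>C y"
    and scaleC_add_left: "(c + d) *\<^sub>C x = c *\<^sub>C x + d *\<^sub>C x"
    and scaleC_scaleC: "c *\<^sub>C d *\<^sub>C x = (c * d) *\<^sub>C x"
    and scaleR_scaleC: "r *\<^sub>R x = complex_of_real r *\<^sub>C x"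
    and norm_scaleC: "norm (c *\<^sub>C x) = cmod c * norm x"

text \<open>Inner products are linear in the first argument and antilinear in the second; the
  underlying real inner product is the real part, so that both induce the same norm.\<close>

class complex_inner = complex_normed_vector + real_inner +
  fixes cinner :: "'a \<Rightarrow> 'a \<Rightarrow> complex"
  assumes cinner_add_left: "cinner (x + y) z = cinner x z + cinner y z"
    and cinner_scaleC_left: "cinner (c *\<^sub>C x) y = c * cinner x y"
    and cinner_commute: "cinner x y = cnj (cinner y x)"
    and inner_Re_cinner: "inner x y = Re (cinner x y)"

class complex_hilbert = complex_inner + complete_space

definition bounded_clinear :: "('a::complex_normed_vector \<Rightarrow> 'b::complex_normed_vector) \<Rightarrow> bool" where
  "bounded_clinear f \<longleftrightarrow> bounded_linear f \<and> (\<forall>c x. f (c *\<^sub>C x) = c *\<^sub>C f x)"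


section \<open>The dual space\<close>

text \<open>The pairing extends the inner product of \<open>Y\<close>, which is antilinear in its second
  argument, so the dual of \<open>X\<close> consists of the bounded antilinear functionals.  It carries
  the operator norm.\<close>

typedef (overloaded) 'a antidual =
  "{\<phi> :: 'a::complex_normed_vector \<Rightarrow>\<^sub>L complex. \<forall>c x. \<phi> (c *\<^sub>C x) = cnj c * \<phi> x}"
  by (rule exI[of _ 0]) simp

setup_lifting type_definition_antidual

lift_definition pairing :: "'a::complex_normed_vector antidual \<Rightarrow> 'a \<Rightarrow> complex"
  is blinfun_apply .

instantiation antidual :: (complex_normed_vector) complex_normed_vector
begin

lift_definition zero_antidual :: "'a antidual" is 0 by simp
lift_definition plus_antidual :: "'a antidual \<Rightarrow> 'a antidual \<Rightarrow> 'a antidual" is "(+)"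
  by (simp add: blinfun.add_left algebra_simps)
lift_definition minus_antidual :: "'a antidual \<Rightarrow> 'a antidual \<Rightarrow> 'a antidual" is "(-)"
  by (simp add: blinfun.diff_left algebra_simps)
lift_definition uminus_antidual :: "'a antidual \<Rightarrow> 'a antidual" is uminus
  by (simp add: blinfun.minus_left)
lift_definition scaleR_antidual :: "real \<Rightarrow> 'a antidual \<Rightarrow> 'a antidual" is scaleR
  by (simp add: blinfun.scaleR_left)
lift_definition norm_antidual :: "'a antidual \<Rightarrow> real" is norm .
lift_definition scaleC_antidual :: "complex \<Rightarrow> 'a antidual \<Rightarrow> 'a antidual"
  is "\<lambda>c \<phi>. blinfun_compose (blinfun_mult_right c) \<phi>"
  by simp

definition dist_antidual :: "'a antidual \<Rightarrow> 'a antidual \<Rightarrow> real"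
  where "dist_antidual \<phi> \<psi> = norm (\<phi> - \<psi>)"
definition sgn_antidual :: "'a antidual \<Rightarrow> 'a antidual"
  where "sgn_antidual \<phi> = inverse (norm \<phi>) *\<^sub>R \<phi>"
definition [code del]:
  "(uniformity :: ('a antidual \<times> 'a antidual) filter) =
     (INF e\<in>{0<..}. principal {(\<phi>, \<psi>). dist \<phi> \<psi> < e})"
definition open_antidual :: "'a antidual set \<Rightarrow> bool"
  where "open_antidual S = (\<forall>\<phi>\<in>S. \<forall>\<^sub>F (\<phi>', \<psi>) in uniformity. \<phi>' = \<phi> \<longrightarrow> \<psi> \<in> S)"

instance
proof
  fix a b :: "'a antidual" and c d :: complex and r s :: real
  show "dist a b = norm (a - b)"
    by (rule dist_antidual_def)
  show "sgn a = inverse (norm a) *\<^sub>R a"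
    by (rule sgn_antidual_def)
  show "(uniformity :: ('a antidual \<times> 'a antidual) filter) =
      (INF e\<in>{0<..}. principal {(\<phi>, \<psi>). dist \<phi> \<psi> < e})"
    by (rule uniformity_antidual_def)
  show "open U \<longleftrightarrow> (\<forall>\<phi>\<in>U. \<forall>\<^sub>F (\<phi>', \<psi>) in uniformity. \<phi>' = \<phi> \<longrightarrow> \<psi> \<in> U)"
    for U :: "'a antidual set"
    by (rule open_antidual_def)
  show "norm (c *\<^sub>C a) = cmod c * norm a"
  proof transfer
    fix c :: complex and \<phi> :: "'a \<Rightarrow>\<^sub>L complex"
    show "norm (blinfun_mult_right c o\<^sub>L \<phi>) = cmod c * norm \<phi>"
    proof (cases "c = 0")
      case True
      then have "blinfun_mult_right c o\<^sub>L \<phi> = 0"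
        by (intro blinfun_eqI) simp
      then show ?thesis using True by simp
    next
      case False
      show ?thesis
      proof (rule antisym)
        show "norm (blinfun_mult_right c o\<^sub>L \<phi>) \<le> cmod c * norm \<phi>"
          by (rule norm_blinfun_bound)
             (auto simp: norm_mult mult.assoc intro!: mult_left_mono norm_blinfun)
        have "norm \<phi> \<le> norm (blinfun_mult_right c o\<^sub>L \<phi>) / cmod c"
        proof (rule norm_blinfun_bound)
          fix x
          have "cmod c * cmod (\<phi> x) \<le> norm (blinfun_mult_right c o\<^sub>L \<phi>) * norm x"
            using norm_blinfun[of "blinfun_mult_right c o\<^sub>L \<phi>" x] by (simp add: norm_mult)
          then show "cmod (\<phi> x) \<le> norm (blinfun_mult_right c o\<^sub>L \<phi>) / cmod c * norm x"
            using False by (simp add: field_simps)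
        qed simp
        then show "cmod c * norm \<phi> \<le> norm (blinfun_mult_right c o\<^sub>L \<phi>)"
          using False by (simp add: field_simps)
      qed
    qed
  qed
qed (transfer; auto intro!: blinfun_eqI norm_triangle_ineq
      simp: blinfun.add_left blinfun.add_right blinfun.scaleR_left algebra_simps scaleR_conv_of_real)+

end


section \<open>Complex interpolation\<close>

text \<open>A couple of complex normed spaces \<open>B\<^sub>0\<close>, \<open>B\<^sub>1\<close> is given by its continuous linear
  embeddings \<open>e0\<close>, \<open>e1\<close> into a normed space that equals \<open>B\<^sub>0 + B\<^sub>1\<close>.  Below, one of the two
  spaces always contains the other one and is itself the ambient space, so the ambient norm is
  equivalent to that of the sum.\<close>

definition calderon_space ::
  "('a::complex_normed_vector \<Rightarrow> 'v::complex_normed_vector) \<Rightarrow> ('b::complex_normed_vector \<Rightarrow> 'v)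
    \<Rightarrow> (complex \<Rightarrow> 'v) set" where
  "calderon_space e0 e1 = {f.
     continuous_on {z. 0 \<le> Re z \<and> Re z \<le> 1} f \<and>
     bounded (f ` {z. 0 \<le> Re z \<and> Re z \<le> 1}) \<and>
     (\<forall>z. 0 < Re z \<and> Re z < 1 \<longrightarrow>
        (\<exists>D. ((\<lambda>h. inverse h *\<^sub>C (f (z + h) - f z)) \<longlongrightarrow> D) (at 0))) \<and>
     (\<forall>t. f (Complex 0 t) \<in> range e0) \<and>
     continuous_on UNIV (\<lambda>t. inv e0 (f (Complex 0 t))) \<and>
     bounded (range (\<lambda>t. inv e0 (f (Complex 0 t)))) \<and>
     (\<forall>t. f (Complex 1 t) \<in> range e1) \<and>
     continuous_on UNIV (\<lambda>t. inv e1 (f (Complex 1 t))) \<and>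
     bounded (range (\<lambda>t. inv e1 (f (Complex 1 t))))}"

definition calderon_norm ::
  "('a::complex_normed_vector \<Rightarrow> 'v::complex_normed_vector) \<Rightarrow> ('b::complex_normed_vector \<Rightarrow> 'v)
    \<Rightarrow> (complex \<Rightarrow> 'v) \<Rightarrow> real" where
  "calderon_norm e0 e1 f =
     max (SUP t. norm (inv e0 (f (Complex 0 t)))) (SUP t. norm (inv e1 (f (Complex 1 t))))"

definition interp_space ::
  "('a::complex_normed_vector \<Rightarrow> 'v::complex_normed_vector) \<Rightarrow> ('b::complex_normed_vector \<Rightarrow> 'v)
    \<Rightarrow> real \<Rightarrow> 'v set" where
  "interp_space e0 e1 \<theta> =
     (if \<theta> = 0 then range e0
      else if \<theta> = 1 then range e1
      else {f (complex_of_real \<theta>) | f. f \<in> calderon_space e0 e1})"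

definition interp_norm ::
  "('a::complex_normed_vector \<Rightarrow> 'v::complex_normed_vector) \<Rightarrow> ('b::complex_normed_vector \<Rightarrow> 'v)
    \<Rightarrow> real \<Rightarrow> 'v \<Rightarrow> real" where
  "interp_norm e0 e1 \<theta> v =
     (if \<theta> = 0 then norm (inv e0 v)
      else if \<theta> = 1 then norm (inv e1 v)
      else Inf {calderon_norm e0 e1 f | f. f \<in> calderon_space e0 e1 \<and> f (complex_of_real \<theta>) = v})"


section \<open>Operators on the Gelfand triple\<close>

definition sector :: "real \<Rightarrow> complex set" where
  "sector \<theta> = {rcis r \<gamma> | r \<gamma>. 0 < r \<and> - \<theta> < \<gamma> \<and> \<gamma> < \<theta>}"

text \<open>The embedding of \<open>X\<close> into \<open>Y\<close> is a map \<open>\<iota>\<close>; a map \<open>B\<close> from \<open>X\<close> to \<open>Y\<close> is viewed as an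
  operator in \<open>Y\<close> with domain \<open>range \<iota>\<close>.\<close>

definition resolvent ::
  "('x \<Rightarrow> 'y::complex_normed_vector) \<Rightarrow> ('x \<Rightarrow> 'y) \<Rightarrow> complex \<Rightarrow> 'y \<Rightarrow> 'y" where
  "resolvent \<iota> B z = (\<lambda>y. \<iota> (inv (\<lambda>x. z *\<^sub>C \<iota> x - B x) y))"

definition resolvent_set ::
  "('x \<Rightarrow> 'y::complex_normed_vector) \<Rightarrow> ('x \<Rightarrow> 'y) \<Rightarrow> complex set" where
  "resolvent_set \<iota> B = {z. bij (\<lambda>x. z *\<^sub>C \<iota> x - B x) \<and> bounded_linear (resolvent \<iota> B z)}"

text \<open>Since the field of scalars is complex, the dissipativity condition is imposed on the real
  part of the inner product.\<close>

locale sectorial_pair =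
  fixes \<iota> :: "'x::{complex_hilbert, second_countable_topology} \<Rightarrow>
      'y::{complex_hilbert, second_countable_topology}"
    and A Astar :: "'x \<Rightarrow> 'y"
    and \<omega>\<^sub>0 c\<^sub>0 c\<^sub>1 M\<^sub>0 :: real
  assumes embedding: "bounded_clinear \<iota>" "inj \<iota>" "closure (range \<iota>) = UNIV"
    and bounded_A: "bounded_clinear A"
    and bounded_Astar: "bounded_clinear Astar"
    and constants: "pi / 2 < \<omega>\<^sub>0" "\<omega>\<^sub>0 < pi" "0 < c\<^sub>0" "0 < c\<^sub>1" "0 < M\<^sub>0"
    and resolvent_set_A: "sector \<omega>\<^sub>0 \<union> {0} \<subseteq> resolvent_set \<iota> A"
    and resolvent_set_Astar: "sector \<omega>\<^sub>0 \<union> {0} \<subseteq> resolvent_set \<iota> Astar"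
    and resolvent_A: "z \<in> sector \<omega>\<^sub>0 \<Longrightarrow> onorm (resolvent \<iota> A z) \<le> M\<^sub>0 / (1 + cmod z)"
    and resolvent_Astar: "z \<in> sector \<omega>\<^sub>0 \<Longrightarrow> onorm (resolvent \<iota> Astar z) \<le> M\<^sub>0 / (1 + cmod z)"
    and adjoint: "cinner (A v) (\<iota> w) = cinner (\<iota> v) (Astar w)"
    and norm_A: "c\<^sub>0 * norm v \<le> norm (A v)" "norm (A v) \<le> c\<^sub>1 * norm v"
    and norm_Astar: "c\<^sub>0 * norm v \<le> norm (Astar v)" "norm (Astar v) \<le> c\<^sub>1 * norm v"
    and dissipative: "Re (cinner (A v) (\<iota> v)) \<le> 0"

text \<open>\<open>dual_op B\<close> maps \<open>v\<close> in \<open>Y\<close> to the functional taking \<open>w\<close> in \<open>X\<close> to the inner product of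
  \<open>v\<close> and \<open>B w\<close>.  Thus \<open>dual_op \<iota>\<close> is the inclusion of \<open>Y\<close> into the dual of \<open>X\<close>, and
  \<open>dual_op Astar\<close>, \<open>dual_op A\<close> are the extensions of \<open>A\<close>, \<open>Astar\<close>, respectively.\<close>

definition dual_op :: "('x::complex_inner \<Rightarrow> 'y::complex_inner) \<Rightarrow> 'y \<Rightarrow> 'x antidual" where
  "dual_op B v = Abs_antidual (Blinfun (\<lambda>w. cinner v (B w)))"

lemma pairing_dual_op:
  assumes "bounded_clinear B"
  shows "pairing (dual_op B v) w = cinner v (B w)"
proof -
  interpret B: bounded_linear B
    using assms by (simp add: bounded_clinear_def)
  have right: "cinner v (x + y) = cinner v x + cinner v y" "cinner v (c *\<^sub>C x) = cnj c * cinner v x"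
    for x y c
    by (metis cinner_commute cinner_add_left complex_cnj_add)
       (metis cinner_commute cinner_scaleC_left complex_cnj_mult)
  have cinner_inner: "cinner v x = Complex (v \<bullet> x) (v \<bullet> (\<i> *\<^sub>C x))" for x
    by (simp add: complex_eq_iff inner_Re_cinner right)
  have norm_i: "norm (\<i> *\<^sub>C x) = norm x" for x :: 'b
    by (simp add: norm_scaleC)
  have bound: "cmod (cinner v x) \<le> norm x * (2 * norm v)" for x
  proof -
    have "cmod (cinner v x) \<le> \<bar>v \<bullet> x\<bar> + \<bar>v \<bullet> (\<i> *\<^sub>C x)\<bar>"
      using cmod_le[of "cinner v x"] by (simp add: cinner_inner)
    also have "\<dots> \<le> norm v * norm x + norm v * norm x"
      using Cauchy_Schwarz_ineq2[of v x] Cauchy_Schwarz_ineq2[of v "\<i> *\<^sub>C x"]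
      by (simp add: norm_i)
    finally show ?thesis by (simp add: mult.commute mult.left_commute)
  qed
  have "bounded_linear (cinner v)"
    by (rule bounded_linear_intro[where K = "2 * norm v"])
       (simp_all add: right bound scaleR_scaleC scaleR_conv_of_real)
  then have lin: "bounded_linear (\<lambda>w. cinner v (B w))"
    using B.bounded_linear_axioms by (rule bounded_linear_compose)
  have "B (c *\<^sub>C x) = c *\<^sub>C B x" for c x
    using assms by (simp add: bounded_clinear_def)
  then show ?thesis
    unfolding dual_op_def pairing.rep_eq
    by (subst Abs_antidual_inverse) (simp_all add: bounded_linear_Blinfun_apply[OF lin] right)
qed

text \<open>The inverse of \<open>z - C\<close> for an operator \<open>C\<close> from \<open>Y\<close> to the dual of \<open>X\<close>.\<close>

definition resolvent_dual ::
  "('x::complex_inner \<Rightarrow> 'y::complex_inner) \<Rightarrow> ('y \<Rightarrow> 'x antidual) \<Rightarrow> complex \<Rightarrow> 'x antidual \<Rightarrow> 'y" where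
  "resolvent_dual \<iota> C z = inv (\<lambda>v. z *\<^sub>C dual_op \<iota> v - C v)"

abbreviation dual_interp_space ::
  "('x::complex_inner \<Rightarrow> 'y::complex_inner) \<Rightarrow> real \<Rightarrow> 'x antidual set" where
  "dual_interp_space \<iota> \<equiv> interp_space (id :: 'x antidual \<Rightarrow> _) (dual_op \<iota>)"

abbreviation dual_interp_norm ::
  "('x::complex_inner \<Rightarrow> 'y::complex_inner) \<Rightarrow> real \<Rightarrow> 'x antidual \<Rightarrow> real" where
  "dual_interp_norm \<iota> \<equiv> interp_norm (id :: 'x antidual \<Rightarrow> _) (dual_op \<iota>)"

text \<open>An element of the interpolation space between the dual of \<open>X\<close> and \<open>Y\<close> is a functional
  on \<open>X\<close>; as an element of the dual of the interpolation space between \<open>X\<close> and \<open>Y\<close>, it acts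
  by continuous extension from the dense subspace \<open>X\<close>.\<close>

definition interp_pairing ::
  "('x::complex_inner \<Rightarrow> 'y::complex_inner) \<Rightarrow> real \<Rightarrow> 'x antidual \<Rightarrow> 'y \<Rightarrow> complex" where
  "interp_pairing \<iota> \<theta> \<phi> v = (THE c. \<exists>s :: nat \<Rightarrow> 'x.
     (\<lambda>n. interp_norm \<iota> (id :: 'y \<Rightarrow> 'y) \<theta> (\<iota> (s n) - v)) \<longlonglongrightarrow> 0 \<and>
     (\<lambda>n. pairing \<phi> (s n)) \<longlonglongrightarrow> c)"

definition bounded_control_op ::
  "('x::complex_inner \<Rightarrow> 'y::complex_inner) \<Rightarrow> real \<Rightarrow> ('z::complex_inner \<Rightarrow> 'x antidual) \<Rightarrow> bool" where
  "bounded_control_op \<iota> \<theta> R \<longleftrightarrow>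
     (\<forall>w w'. R (w + w') = R w + R w') \<and> (\<forall>c w. R (c *\<^sub>C w) = c *\<^sub>C R w) \<and>
     (\<forall>w. R w \<in> dual_interp_space \<iota> \<theta>) \<and>
     (\<exists>K. \<forall>w. dual_interp_norm \<iota> \<theta> (R w) \<le> K * norm w)"

definition control_adjoint ::
  "('x::complex_inner \<Rightarrow> 'y::complex_inner) \<Rightarrow> real \<Rightarrow> ('z::complex_inner \<Rightarrow> 'x antidual) \<Rightarrow> 'y \<Rightarrow> 'z" where
  "control_adjoint \<iota> \<theta> R v = (THE z. \<forall>w. cinner z w = cnj (interp_pairing \<iota> \<theta> (R w) v))"


section \<open>Solution operators\<close>

text \<open>Integrals with respect to \<open>dz\<close> and to its complex conjugate along the boundary of the
  sector of half-angle \<open>\<omega>\<close>, traversed from the lower to the upper ray, i.e. with the negative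
  real axis on the left.\<close>

definition contour_dz ::
  "real \<Rightarrow> (complex \<Rightarrow> 'y::{complex_hilbert, second_countable_topology}) \<Rightarrow> 'y" where
  "contour_dz \<omega> F =
     (LINT r:{0<..}|lebesgue. cis \<omega> *\<^sub>C F (rcis r \<omega>)) -
     (LINT r:{0<..}|lebesgue. cis (- \<omega>) *\<^sub>C F (rcis r (- \<omega>)))"

definition contour_cnj_dz ::
  "real \<Rightarrow> (complex \<Rightarrow> 'y::{complex_hilbert, second_countable_topology}) \<Rightarrow> 'y" where
  "contour_cnj_dz \<omega> F =
     (LINT r:{0<..}|lebesgue. cnj (cis \<omega>) *\<^sub>C F (rcis r \<omega>)) -
     (LINT r:{0<..}|lebesgue. cnj (cis (- \<omega>)) *\<^sub>C F (rcis r (- \<omega>)))"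

text \<open>The operator-valued integrals are evaluated pointwise on the dual of \<open>X\<close>; the values lie
  in \<open>Y\<close>.  The resolvents are those of the extended operators, so \<open>E_op\<close>, which belongs to \<open>A\<close>,
  refers to \<open>Astar\<close> and vice versa.\<close>

definition E_op ::
  "('x::complex_inner \<Rightarrow> 'y::{complex_hilbert, second_countable_topology}) \<Rightarrow> ('x \<Rightarrow> 'y)
    \<Rightarrow> real \<Rightarrow> real \<Rightarrow> real \<Rightarrow> 'x antidual \<Rightarrow> 'y" where
  "E_op \<iota> Astar \<omega> \<alpha> t \<phi> = (1 / (2 * complex_of_real pi * \<i>)) *\<^sub>C
     contour_dz \<omega> (\<lambda>z. exp (complex_of_real t * z) *\<^sub>C
       resolvent_dual \<iota> (dual_op Astar) (z powr complex_of_real \<alpha>) \<phi>)"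

definition E_star ::
  "('x::complex_inner \<Rightarrow> 'y::{complex_hilbert, second_countable_topology}) \<Rightarrow> ('x \<Rightarrow> 'y)
    \<Rightarrow> real \<Rightarrow> real \<Rightarrow> real \<Rightarrow> 'x antidual \<Rightarrow> 'y" where
  "E_star \<iota> A \<omega> \<alpha> t \<phi> = (- 1 / (2 * complex_of_real pi * \<i>)) *\<^sub>C
     contour_cnj_dz \<omega> (\<lambda>z. exp (complex_of_real t * cnj z) *\<^sub>C
       resolvent_dual \<iota> (dual_op A) (cnj (z powr complex_of_real \<alpha>)) \<phi>)"

text \<open>For the functions \<open>g\<close> considered here the integral converges in \<open>Y\<close> for every \<open>t\<close>, and
  the resulting function is the continuous representative, so it may be evaluated pointwise.\<close>

definition S_op ::
  "('x::complex_inner \<Rightarrow> 'y::{complex_hilbert, second_countable_topology}) \<Rightarrow> ('x \<Rightarrow> 'y)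
    \<Rightarrow> real \<Rightarrow> real \<Rightarrow> (real \<Rightarrow> 'x antidual) \<Rightarrow> real \<Rightarrow> 'y" where
  "S_op \<iota> Astar \<omega> \<alpha> g t = (LINT s:{0<..<t}|lebesgue. E_op \<iota> Astar \<omega> \<alpha> (t - s) (g s))"

definition S_star_delta ::
  "('x::complex_inner \<Rightarrow> 'y::{complex_hilbert, second_countable_topology}) \<Rightarrow> ('x \<Rightarrow> 'y)
    \<Rightarrow> real \<Rightarrow> real \<Rightarrow> real \<Rightarrow> 'x antidual \<Rightarrow> real \<Rightarrow> 'y" where
  "S_star_delta \<iota> A \<omega> \<alpha> T \<phi> t = E_star \<iota> A \<omega> \<alpha> (T - t) \<phi>"


section \<open>Admissible controls\<close>

text \<open>\<open>Z\<close> need not be separable, hence measurability is strong measurability.  Elements of the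
  Lebesgue spaces are represented by functions.\<close>

definition strongly_measurable :: "'a measure \<Rightarrow> ('a \<Rightarrow> 'b::topological_space) \<Rightarrow> bool" where
  "strongly_measurable M f \<longleftrightarrow>
     (\<exists>s. (\<forall>n::nat. simple_function M (s n)) \<and> (AE t in M. (\<lambda>n. s n t) \<longlonglongrightarrow> f t))"

definition L2_space :: "real \<Rightarrow> (real \<Rightarrow> 'z::real_normed_vector) set" where
  "L2_space T = {u. strongly_measurable (lebesgue_on {0<..<T}) u \<and>
     integrable (lebesgue_on {0<..<T}) (\<lambda>t. (norm (u t))\<^sup>2)}"

definition L2_norm :: "real \<Rightarrow> (real \<Rightarrow> 'z::real_normed_vector) \<Rightarrow> real" where
  "L2_norm T u = sqrt (LINT t|lebesgue_on {0<..<T}. (norm (u t))\<^sup>2)"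

definition Linf_space :: "real \<Rightarrow> (real \<Rightarrow> 'z::real_normed_vector) set" where
  "Linf_space T = {u. strongly_measurable (lebesgue_on {0<..<T}) u \<and>
     (\<exists>K. AE t in lebesgue_on {0<..<T}. norm (u t) \<le> K)}"

text \<open>A set of controls is a set of representatives; closedness makes it invariant under
  changes on null sets.\<close>

definition admissible_set :: "real \<Rightarrow> (real \<Rightarrow> 'z::real_normed_vector) set \<Rightarrow> bool" where
  "admissible_set T U \<longleftrightarrow>
     U \<noteq> {} \<and> U \<subseteq> L2_space T \<and> U \<subseteq> Linf_space T \<and>
     (\<forall>u\<in>U. \<forall>v\<in>U. \<forall>r\<in>{0..1}. (\<lambda>t. (1 - r) *\<^sub>R u t + r *\<^sub>R v t) \<in> U) \<and>
     (\<exists>K. \<forall>u\<in>U. L2_norm T u \<le> K) \<and>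
     (\<forall>s u. (\<forall>n::nat. s n \<in> U) \<and> u \<in> L2_space T \<and>
        (\<lambda>n. L2_norm T (\<lambda>t. s n t - u t)) \<longlonglongrightarrow> 0 \<longrightarrow> u \<in> U)"

definition cost ::
  "('x::complex_inner \<Rightarrow> 'y::{complex_hilbert, second_countable_topology}) \<Rightarrow> ('x \<Rightarrow> 'y)
    \<Rightarrow> real \<Rightarrow> real \<Rightarrow> real \<Rightarrow> ('z::real_normed_vector \<Rightarrow> 'x antidual) \<Rightarrow> 'y \<Rightarrow> real
    \<Rightarrow> (real \<Rightarrow> 'z) \<Rightarrow> real" where
  "cost \<iota> Astar \<omega> \<alpha> T R y\<^sub>d \<nu> u =
     1 / 2 * (norm (S_op \<iota> Astar \<omega> \<alpha> (\<lambda>t. R (u t)) T - y\<^sub>d))\<^sup>2 + \<nu> / 2 * (L2_norm T u)\<^sup>2"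

definition minimizer :: "('u \<Rightarrow> real) \<Rightarrow> 'u set \<Rightarrow> 'u \<Rightarrow> bool" where
  "minimizer J U u \<longleftrightarrow> u \<in> U \<and> (\<forall>v\<in>U. J u \<le> J v)"

end

theory Submission
  imports Defs "HOL-Complex_Analysis.Conformal_Mappings"
begin

text \<open>
  Put \<open>K(t) = E\<^sub>\<alpha>(T - t) \<circ> R\<close>, a bounded linear operator from \<open>Z\<close> to \<open>Y\<close>.  The final state is
  \<open>S u = \<integral> K(t) u(t) dt\<close> over the time interval, so the cost is a quadratic functional of \<open>u\<close>, and
  the term with \<open>\<nu>\<close> makes it strongly convex in \<open>L\<^sup>2\<close>.  Three facts carry the proof.

  \<^bold>\<open>The kernel is integrable in time.\<close>  The resolvent of the extended operator is bounded from the
  dual of \<open>X\<close> to \<open>Y\<close> and decays like \<open>1 / (1 + |z|)\<close> on \<open>Y\<close>.  The maximum principle in a strip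
  (\<open>strip_maximum_principle\<close>) interpolates between the two and yields the decay
  \<open>(1 + |z|)\<^sup>-\<^sup>\<theta>\<close> on the interpolation space (\<open>norm_resolvent_dual_interp\<close>).  Inserted
  in the contour integral this gives \<open>\<parallel>K(t)\<parallel> \<le> C (T - t)\<^bsup>\<beta> - 1\<^esup>\<close> with some \<open>\<beta> > 0\<close>
  (\<open>norm_E_op_le\<close>), hence \<open>S\<close> is defined on essentially bounded controls.

  \<^bold>\<open>The admissible controls are uniformly bounded.\<close>  If \<open>\<alpha> \<theta>\<^sub>0 \<le> 1/2\<close> then
  \<open>S\<close> is in general not continuous with respect to the norm of \<open>L\<^sup>2\<close>, so that convergence of a
  minimizing sequence in \<open>L\<^sup>2\<close> does not suffice.  But a convex set that is closed and
  bounded in \<open>L\<^sup>2\<close> and consists of essentially bounded functions is bounded in \<open>L\<^sup>\<infinity>\<close>, by a Baire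
  argument and a homothety (\<open>admissible_set_uniformly_bounded\<close>).  Dominated convergence then yields
  \<open>S u\<^sub>n \<longlonglongrightarrow> S u\<close> along a minimizing sequence, which is a Cauchy sequence by strong convexity.

  \<^bold>\<open>The adjoint state represents the derivative.\<close>  On the segment from a minimizer \<open>u\<close> to \<open>v\<close> the
  cost is a quadratic polynomial, whose linear coefficient must be nonnegative.  This coefficient
  contains \<open>(S u - y\<^sub>d, K(t) w)\<close>, and it remains to identify the Riesz representative of this functional
  of \<open>w\<close> as \<open>R\<^sup>* p(t)\<close>.  Conjugating the contour integrals gives
  \<open>(E\<^sub>\<alpha>(t) \<phi>, y) = \<langle>\<phi>, x\<rangle>\<close> for the element \<open>x\<close> of \<open>X\<close> that represents \<open>E\<^sub>\<alpha>\<^sup>*(t) y\<close>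
  (\<open>cinner_E_op\<close>, \<open>E_star_embedding\<close>).  The pairing between the two interpolation spaces, through which
  \<open>R\<^sup>*\<close> is defined, extends the pairing with \<open>X\<close> by the duality inequality
  \<open>cmod_pairing_le_interp_duality\<close>, another application of the maximum principle.
\<close>

section \<open>Complex Hilbert spaces and the Riesz representation\<close>

instance complex_hilbert \<subseteq> banach ..

lemma cinner_add_right: "cinner x (y + z) = cinner x y + cinner x z"
  by (metis cinner_commute cinner_add_left complex_cnj_add)

lemma cinner_scaleC_right: "cinner x (c *\<^sub>C y) = cnj c * cinner x y"
  by (metis cinner_commute cinner_scaleC_left complex_cnj_mult)

lemma cinner_scaleR_left: "cinner (r *\<^sub>R x) y = complex_of_real r * cinner x y"
  by (simp add: scaleR_scaleC cinner_scaleC_left)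

lemma cinner_scaleR_right: "cinner x (r *\<^sub>R y) = complex_of_real r * cinner x y"
  by (simp add: scaleR_scaleC cinner_scaleC_right)

lemma cinner_norm_le: "cmod (cinner x y) \<le> norm x * norm (y :: 'a::complex_inner)"
proof (cases "cinner x y = 0")
  case False
  \<comment> \<open>Multiplying \<open>x\<close> by the phase \<open>c\<close> makes the inner product real.\<close>
  define c where "c = cnj (cinner x y) / of_real (cmod (cinner x y))"
  have "cmod c = 1"
    using False by (simp add: c_def norm_divide)
  have "c * cinner x y = of_real (cmod (cinner x y))"
    using False complex_norm_square[of "cinner x y"]
    by (simp add: c_def power2_eq_square mult.commute nonzero_divide_eq_eq)
  then have "cmod (cinner x y) = Re (c * cinner x y)"
    by simp
  also have "\<dots> = inner (c *\<^sub>C x) y"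
    by (simp add: inner_Re_cinner cinner_scaleC_left)
  also have "\<dots> \<le> norm (c *\<^sub>C x) * norm y"
    by (rule norm_cauchy_schwarz)
  finally show ?thesis
    using \<open>cmod c = 1\<close> by (simp add: norm_scaleC)
qed simp

lemma bounded_bilinear_cinner: "bounded_bilinear (cinner :: 'a::complex_inner \<Rightarrow> 'a \<Rightarrow> complex)"
proof
  show "\<exists>K. \<forall>a b. norm (cinner a b :: complex) \<le> norm (a :: 'a) * norm b * K"
    by (rule exI[of _ 1]) (simp add: cinner_norm_le)
qed (simp_all add: cinner_add_left cinner_add_right cinner_scaleR_left cinner_scaleR_right
    scaleR_conv_of_real)

interpretation cinner: bounded_bilinear "cinner :: 'a::complex_inner \<Rightarrow> 'a \<Rightarrow> complex"
  by (rule bounded_bilinear_cinner)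

lemma cinner_self: "cinner x x = complex_of_real ((norm x)\<^sup>2)"
proof (rule complex_eqI)
  have "Im (cinner x x) = - Im (cinner x x)"
    by (subst (1) cinner_commute) simp
  then show "Im (cinner x x) = Im (complex_of_real ((norm x)\<^sup>2))"
    by simp
qed (simp add: power2_norm_eq_inner flip: inner_Re_cinner)

lemma cinner_eqI: "(\<And>w. cinner x w = cinner y w) \<Longrightarrow> x = y"
  using cinner_self[of "x - y"] by (simp add: cinner.diff_left)

lemma norm_le_cinnerI:
  assumes "\<And>w. cmod (cinner x w) \<le> C * norm w" "0 \<le> C"
  shows "norm x \<le> C"
proof (cases "x = 0")
  case False
  have "(norm x)\<^sup>2 \<le> C * norm x"
    using assms(1)[of x] by (simp add: cinner_self norm_power)
  then show ?thesis
    using False by (simp add: power2_eq_square)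
qed (simp add: assms)

lemma bounded_bilinear_scaleC:
  "bounded_bilinear (scaleC :: complex \<Rightarrow> 'a::complex_normed_vector \<Rightarrow> 'a)"
proof
  show "(r *\<^sub>R a) *\<^sub>C b = r *\<^sub>R a *\<^sub>C b" for r :: real and a :: complex and b :: 'a
    by (simp add: scaleR_scaleC scaleC_scaleC scaleR_conv_of_real)
  show "a *\<^sub>C (r *\<^sub>R b) = r *\<^sub>R a *\<^sub>C b" for r :: real and a :: complex and b :: 'a
    by (simp add: scaleR_scaleC scaleC_scaleC mult.commute)
  show "\<exists>K. \<forall>a b. norm (a *\<^sub>C (b :: 'a)) \<le> norm a * norm b * K"
    by (rule exI[of _ 1]) (simp add: norm_scaleC)
qed (simp_all add: scaleC_add_left scaleC_add_right)

interpretation scaleC: bounded_bilinear "scaleC :: complex \<Rightarrow> 'a::complex_normed_vector \<Rightarrow> 'a"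
  by (rule bounded_bilinear_scaleC)

lemma scaleC_one [simp]: "1 *\<^sub>C (x :: 'a::complex_normed_vector) = x"
  by (metis of_real_1 scaleR_one scaleR_scaleC)

text \<open>Divide by \<open>t\<close> and let \<open>t\<close> tend to zero.\<close>

lemma first_order_nonneg:
  fixes a b :: real
  assumes "\<And>t. 0 < t \<Longrightarrow> t \<le> 1 \<Longrightarrow> 0 \<le> t * a + t\<^sup>2 * b"
  shows "0 \<le> a"
proof (rule tendsto_lowerbound)
  show "((\<lambda>t. a + t * b) \<longlongrightarrow> a) (at_right 0)"
    by (auto intro!: tendsto_eq_intros)
  have "0 \<le> a + t * b" if "0 < t" "t \<le> 1" for t
  proof -
    have "0 \<le> t * (a + t * b)"
      using assms[OF that] by (simp add: algebra_simps power2_eq_square)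
    then show ?thesis
      using that by (simp add: zero_le_mult_iff)
  qed
  then show "\<forall>\<^sub>F t in at_right 0. 0 \<le> a + t * b"
    unfolding eventually_at_right_field by (intro exI[of _ 1]) auto
qed simp

text \<open>The representing vector minimizes \<open>\<parallel>v\<parallel>\<^sup>2 / 2 - f v\<close>; minimizing sequences of this functional
  are Cauchy by the parallelogram identity.\<close>

lemma riesz_real:
  fixes f :: "'a::{real_inner, complete_space} \<Rightarrow> real"
  assumes "bounded_linear f"
  shows "\<exists>z. \<forall>w. f w = inner z w"
proof -
  interpret f: bounded_linear f by fact
  obtain K where K: "\<And>x. \<bar>f x\<bar> \<le> norm x * K" "0 \<le> K"
    using f.nonneg_bounded by auto
  define J where "J v = (norm v)\<^sup>2 / 2 - f v" for v
  have par: "(norm (a - b))\<^sup>2 / 4 = J a + J b - 2 * J ((1 / 2) *\<^sub>R (a + b))" for a b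
    unfolding J_def f.scaleR f.add power2_norm_eq_inner
    by (simp add: inner_add_left inner_add_right inner_diff_left inner_diff_right inner_commute
        field_simps)
  have lower: "- K\<^sup>2 / 2 \<le> J v" for v
  proof -
    have "0 \<le> (norm v - K)\<^sup>2" by simp
    then show ?thesis
      using K(1)[of v] unfolding J_def power2_diff by (simp add: algebra_simps)
  qed
  define m where "m = Inf (range J)"
  have bdd: "bdd_below (range J)"
    using lower by (auto intro!: bdd_belowI)
  have m_le: "m \<le> J v" for v
    unfolding m_def using bdd by (auto intro: cInf_lower)
  have "\<exists>v. J v < m + inverse (real (Suc n))" for n
    using cInf_lessD[of "range J" "m + inverse (real (Suc n))"] unfolding m_def by auto
  then obtain v where v: "\<And>n. J (v n) < m + inverse (real (Suc n))"
    by metis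
  have lim0: "(\<lambda>n. inverse (real (Suc n))) \<longlonglongrightarrow> 0"
    by (rule LIMSEQ_inverse_real_of_nat)
  have "Cauchy v"
  proof (rule metric_CauchyI)
    fix e :: real assume "0 < e"
    then have "\<forall>\<^sub>F n in sequentially. inverse (real (Suc n)) < e\<^sup>2 / 8"
      using lim0 by (intro order_tendstoD(2)) auto
    then obtain N where N: "\<And>n. n \<ge> N \<Longrightarrow> inverse (real (Suc n)) < e\<^sup>2 / 8"
      unfolding eventually_sequentially by auto
    show "\<exists>M. \<forall>m\<ge>M. \<forall>n\<ge>M. dist (v m) (v n) < e"
    proof (intro exI allI impI)
      fix p q assume "N \<le> p" "N \<le> q"
      then have "(norm (v p - v q))\<^sup>2 / 4 < e\<^sup>2 / 4"
        unfolding par using v[of p] v[of q] N[of p] N[of q] m_le[of "(1 / 2) *\<^sub>R (v p + v q)"]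
        by simp
      then show "dist (v p) (v q) < e"
        using \<open>0 < e\<close> by (simp add: dist_norm power_less_imp_less_base)
    qed
  qed
  then obtain z where z: "v \<longlonglongrightarrow> z"
    using Cauchy_convergent convergent_def by blast
  have "J z \<le> m + 0"
  proof (rule LIMSEQ_le)
    show "(\<lambda>n. J (v n)) \<longlonglongrightarrow> J z"
      unfolding J_def by (intro tendsto_intros f.tendsto z) simp
    show "(\<lambda>n. m + inverse (real (Suc n))) \<longlonglongrightarrow> m + 0"
      by (intro tendsto_add tendsto_const lim0)
    show "\<exists>N. \<forall>n\<ge>N. J (v n) \<le> m + inverse (real (Suc n))"
      using v less_imp_le by blast
  qed
  then have min: "J z \<le> J w" for w
    using m_le[of w] by simp
  have nonneg: "0 \<le> inner z w - f w" for w
  proof (rule first_order_nonneg)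
    fix t :: real
    have "J (z + t *\<^sub>R w) - J z = t * (inner z w - f w) + t\<^sup>2 * ((norm w)\<^sup>2 / 2)"
      unfolding J_def f.scaleR f.add power2_norm_eq_inner
      by (simp add: inner_add_left inner_add_right inner_commute field_simps power2_eq_square)
    then show "0 \<le> t * (inner z w - f w) + t\<^sup>2 * ((norm w)\<^sup>2 / 2)"
      using min[of "z + t *\<^sub>R w"] by simp
  qed
  have "f w = inner z w" for w
    using nonneg[of w] nonneg[of "- w"] by (simp add: f.neg)
  then show ?thesis by blast
qed

text \<open>An antilinear functional is determined by its real part, to which the real theorem applies.\<close>

lemma riesz_antilinear:
  fixes f :: "'a::complex_hilbert \<Rightarrow> complex"
  assumes "bounded_linear f" "\<And>c w. f (c *\<^sub>C w) = cnj c * f w"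
  shows "\<exists>!z. \<forall>w. cinner z w = f w"
proof -
  have "bounded_linear (\<lambda>w. Re (f w))"
    using bounded_linear_Re assms(1) by (rule bounded_linear_compose)
  then obtain z where z: "\<And>w. Re (f w) = inner z w"
    using riesz_real by blast
  have "cinner z w = f w" for w
  proof (rule complex_eqI)
    show "Re (cinner z w) = Re (f w)"
      by (simp add: z inner_Re_cinner)
    have "Re (cinner z (\<i> *\<^sub>C w)) = Re (f (\<i> *\<^sub>C w))"
      by (simp add: z inner_Re_cinner)
    then show "Im (cinner z w) = Im (f w)"
      by (simp add: assms(2) cinner_scaleC_right)
  qed
  then show ?thesis
    by (intro ex1I[of _ z]) (auto intro: cinner_eqI)
qed

lemma bounded_bilinear_pairing:
  "bounded_bilinear (pairing :: 'a::complex_normed_vector antidual \<Rightarrow> 'a \<Rightarrow> complex)"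
proof
  show "\<exists>K. \<forall>\<phi> b. norm (pairing \<phi> (b :: 'a)) \<le> norm \<phi> * norm b * K"
    by (rule exI[of _ 1]) (transfer, auto intro: norm_blinfun)
qed (transfer; simp add: blinfun.add_left blinfun.add_right blinfun.scaleR_left blinfun.scaleR_right)+

interpretation pairing: bounded_bilinear
  "pairing :: 'a::complex_normed_vector antidual \<Rightarrow> 'a \<Rightarrow> complex"
  by (rule bounded_bilinear_pairing)

lemma pairing_norm_le: "cmod (pairing \<phi> x) \<le> norm \<phi> * norm x"
  by transfer (rule norm_blinfun)

lemma pairing_scaleC_right: "pairing \<phi> (c *\<^sub>C x) = cnj c * pairing \<phi> x"
  by transfer simp

lemma pairing_scaleC_left: "pairing (c *\<^sub>C \<phi>) x = c * pairing \<phi> x"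
  by transfer simp

lemma antidual_eqI: "(\<And>x. pairing \<phi> x = pairing \<psi> x) \<Longrightarrow> \<phi> = \<psi>"
  by transfer (auto intro: blinfun_eqI)

section \<open>The maximum principle in a strip\<close>

text \<open>A strip is unbounded, so the maximum modulus principle is applied on long rectangles to the
  product with \<open>exp (e z\<^sup>2)\<close>, and \<open>e\<close> tends to zero afterwards.\<close>

lemma strip_maximum_principle:
  fixes h :: "complex \<Rightarrow> complex"
  assumes cont: "continuous_on {z. 0 \<le> Re z \<and> Re z \<le> 1} h"
    and hol: "h holomorphic_on {z. 0 < Re z \<and> Re z < 1}"
    and bdd: "bounded (h ` {z. 0 \<le> Re z \<and> Re z \<le> 1})"
    and left: "\<And>t. cmod (h (Complex 0 t)) \<le> M"
    and right: "\<And>t. cmod (h (Complex 1 t)) \<le> M"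
    and z: "0 \<le> Re z" "Re z \<le> 1"
  shows "cmod (h z) \<le> M"
proof -
  have "0 \<le> M"
    using left[of 0] norm_ge_zero order_trans by blast
  obtain B where B: "\<And>w. 0 \<le> Re w \<Longrightarrow> Re w \<le> 1 \<Longrightarrow> cmod (h w) \<le> B"
    using bdd unfolding bounded_iff by auto
  have "0 \<le> B"
    using order_trans[OF norm_ge_zero B[of 0]] by simp
  have exp_le: "cmod (exp (of_real e * w\<^sup>2)) \<le> exp (e * (1 - (Im w)\<^sup>2))"
    if "0 \<le> Re w" "Re w \<le> 1" "0 < e" for e w
  proof -
    have "(Re w)\<^sup>2 \<le> 1"
      using that by (simp add: power_le_one)
    then show ?thesis
      using that by (simp add: Re_power2)
  qed
  have approx: "cmod (exp (of_real e * z\<^sup>2) * h z) \<le> exp e * M'" if e: "0 < e" and "M < M'" for e M'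
  proof -
    have "0 < M'" using \<open>0 \<le> M\<close> \<open>M < M'\<close> by simp
    define L where "L = max \<bar>Im z\<bar> (sqrt (B / (e * M')))"
    define S where "S = cbox (Complex 0 (- L)) (Complex 1 L)"
    define g where "g w = exp (of_real e * w\<^sup>2) * h w" for w
    \<comment> \<open>The factor \<open>exp (e w\<^sup>2)\<close> decays along the strip, so on the horizontal sides of a long
      rectangle it beats the bound \<open>B\<close>.\<close>
    have "B \<le> M' * exp (e * L\<^sup>2)"
    proof -
      have "sqrt (B / (e * M')) \<le> L" by (simp add: L_def)
      then have "B / (e * M') \<le> L\<^sup>2"
        using sqrt_le_D by blast
      then have "B \<le> M' * (e * L\<^sup>2)"
        using e \<open>0 < M'\<close> by (simp add: field_simps)
      also have "\<dots> \<le> M' * exp (e * L\<^sup>2)"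
        using exp_ge_add_one_self[of "e * L\<^sup>2"] \<open>0 < M'\<close> by (intro mult_left_mono) linarith+
      finally show ?thesis .
    qed
    then have side: "exp (e * (1 - L\<^sup>2)) * B \<le> exp e * M'"
      by (simp add: right_diff_distrib exp_diff field_simps)
    have "cmod (g z) \<le> exp e * M'"
    proof (rule maximum_modulus_frontier[of g S])
      show "g holomorphic_on interior S"
        unfolding g_def S_def interior_cbox
        by (intro holomorphic_intros holomorphic_on_subset[OF hol])
           (auto simp: in_box_complex_iff)
      show "continuous_on (closure S) g"
        unfolding g_def S_def closure_cbox
        by (intro continuous_intros continuous_on_subset[OF cont])
           (auto simp: in_cbox_complex_iff)
      show "bounded S" by (simp add: S_def)
      show "z \<in> S"
        using z by (auto simp: S_def L_def in_cbox_complex_iff)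
      fix w assume "w \<in> frontier S"
      then have w: "0 \<le> Re w" "Re w \<le> 1"
        and cases: "Re w = 0 \<or> Re w = 1 \<or> \<bar>Im w\<bar> = L"
        unfolding frontier_def closure_cbox interior_cbox S_def
        by (auto simp: in_cbox_complex_iff in_box_complex_iff)
      have "cmod (g w) \<le> exp (e * (1 - (Im w)\<^sup>2)) * cmod (h w)"
        unfolding g_def norm_mult using exp_le[OF w e] by (intro mult_right_mono) auto
      also have "\<dots> \<le> exp e * M'"
      proof (cases "\<bar>Im w\<bar> = L")
        case True
        then have "(Im w)\<^sup>2 = L\<^sup>2" by (metis power2_abs)
        then have "exp (e * (1 - (Im w)\<^sup>2)) * cmod (h w) \<le> exp (e * (1 - L\<^sup>2)) * B"
          using B[OF w] by simp
        then show ?thesis using side by linarith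
      next
        case False
        then have "w = Complex 0 (Im w) \<or> w = Complex 1 (Im w)"
          using cases by (auto simp: complex_eq_iff)
        then have "cmod (h w) \<le> M'"
          using left[of "Im w"] right[of "Im w"] \<open>M < M'\<close> by auto
        then show ?thesis
          using e by (intro mult_mono) (auto simp: mult_le_cancel_left1)
      qed
      finally show "cmod (g w) \<le> exp e * M'" .
    qed
    then show ?thesis by (simp add: g_def)
  qed
  show ?thesis
  proof (rule dense_ge)
    fix M' assume "M < M'"
    show "cmod (h z) \<le> M'"
    proof (rule tendsto_le)
      show "((\<lambda>e. exp e * M') \<longlongrightarrow> M') (at_right (0::real))"
        by (auto intro!: tendsto_eq_intros)
      show "((\<lambda>e. cmod (exp (of_real e * z\<^sup>2) * h z)) \<longlongrightarrow> cmod (h z)) (at_right (0::real))"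
        by (auto intro!: tendsto_eq_intros)
      show "\<forall>\<^sub>F e in at_right 0. cmod (exp (of_real e * z\<^sup>2) * h z) \<le> exp e * M'"
        using approx \<open>M < M'\<close> unfolding eventually_at_right_field by (intro exI[of _ 1]) auto
    qed simp
  qed
qed

section \<open>Strongly measurable functions\<close>

lemma complete_measure_lebesgue_on:
  assumes "S \<in> sets lebesgue"
  shows "complete_measure (lebesgue_on S)"
proof
  fix A B assume "B \<subseteq> A" "A \<in> null_sets (lebesgue_on S)"
  then have "A \<in> null_sets lebesgue" "A \<subseteq> S"
    using assms by (auto simp: null_sets_restrict_space)
  then have "B \<in> sets lebesgue" "B \<subseteq> S"
    using \<open>B \<subseteq> A\<close> completion.complete by blast+
  then show "B \<in> sets (lebesgue_on S)"
    using assms by (auto simp: sets_restrict_space_iff)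
qed

lemma (in complete_measure) borel_measurable_AE:
  assumes f: "f \<in> borel_measurable M" and eq: "AE x in M. f x = g x"
  shows "g \<in> borel_measurable M"
proof (rule measurableI)
  fix A :: "'b set" assume "A \<in> sets borel"
  show "g -` A \<inter> space M \<in> sets M"
  proof (rule in_sets_AE)
    show "f -` A \<inter> space M \<in> sets M"
      using f \<open>A \<in> sets borel\<close> by (rule measurable_sets)
    show "AE x in M. (x \<in> f -` A \<inter> space M) = (x \<in> g -` A \<inter> space M)"
      using eq by eventually_elim auto
  qed auto
qed auto

text \<open>The range of \<open>u\<close> need not be separable, so composition with a Borel function is of no use here.
  Instead \<open>u\<close> is replaced by simple functions, which take finitely many values, and completeness of
  the measure absorbs the null set on which they fail to converge.\<close>

lemma (in complete_measure) borel_measurable_caratheodory: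
  fixes g :: "'a \<Rightarrow> 'b::topological_space \<Rightarrow> 'c::{real_normed_vector, second_countable_topology}"
  assumes u: "strongly_measurable M u"
    and meas: "\<And>z. (\<lambda>t. g t z) \<in> borel_measurable M"
    and cont: "\<And>t. t \<in> space M \<Longrightarrow> continuous_on UNIV (g t)"
  shows "(\<lambda>t. g t (u t)) \<in> borel_measurable M"
proof -
  obtain s where s: "\<And>n::nat. simple_function M (s n)"
    and lim: "AE t in M. (\<lambda>n. s n t) \<longlonglongrightarrow> u t"
    using u unfolding strongly_measurable_def by blast
  from lim obtain N where N: "N \<in> null_sets M" "{t \<in> space M. \<not> (\<lambda>n. s n t) \<longlonglongrightarrow> u t} \<subseteq> N"
    unfolding eventually_ae_filter by auto
  have simple: "(\<lambda>t. g t (s n t)) \<in> borel_measurable M" for n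
  proof (rule measurable_compose_countable'[where I = "s n ` space M"])
    show "s n \<in> measurable M (count_space (s n ` space M))"
      using s[of n] unfolding simple_function_def
      by (auto intro!: measurable_count_space_eq2[THEN iffD2])
    show "countable (s n ` space M)"
      using s[of n] by (simp add: simple_functionD countable_finite)
  qed (rule meas)
  have "(\<lambda>t. indicator (space M - N) t *\<^sub>R g t (u t)) \<in> borel_measurable M"
  proof (rule borel_measurable_LIMSEQ_metric)
    show "(\<lambda>t. indicator (space M - N) t *\<^sub>R g t (s n t)) \<in> borel_measurable M" for n
      using simple N by (intro borel_measurable_scaleR borel_measurable_indicator) auto
    fix t assume "t \<in> space M"
    show "(\<lambda>n. indicator (space M - N) t *\<^sub>R g t (s n t)) \<longlonglongrightarrow> indicator (space M - N) t *\<^sub>R g t (u t)"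
    proof (cases "t \<in> N")
      case False
      then have "(\<lambda>n. s n t) \<longlonglongrightarrow> u t"
        using N \<open>t \<in> space M\<close> by auto
      then have "(\<lambda>n. g t (s n t)) \<longlonglongrightarrow> g t (u t)"
        using cont[OF \<open>t \<in> space M\<close>] by (auto intro: continuous_on_tendsto_compose)
      then show ?thesis
        by (intro tendsto_intros)
    qed simp
  qed
  moreover have "AE t in M. indicator (space M - N) t *\<^sub>R g t (u t) = g t (u t)"
    using AE_not_in[OF N(1)] AE_space by eventually_elim simp
  ultimately show ?thesis
    by (rule borel_measurable_AE)
qed

lemma strongly_measurable_compose2:
  assumes "strongly_measurable M u" "strongly_measurable M v"
    and h: "continuous_on UNIV (\<lambda>p. h (fst p) (snd p))"
  shows "strongly_measurable M (\<lambda>t. h (u t) (v t))"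
proof -
  obtain s r where s: "\<And>n::nat. simple_function M (s n)" "AE t in M. (\<lambda>n. s n t) \<longlonglongrightarrow> u t"
    and r: "\<And>n::nat. simple_function M (r n)" "AE t in M. (\<lambda>n. r n t) \<longlonglongrightarrow> v t"
    using assms unfolding strongly_measurable_def by blast
  have "AE t in M. (\<lambda>n. h (s n t) (r n t)) \<longlonglongrightarrow> h (u t) (v t)"
    using s(2) r(2)
  proof eventually_elim
    case (elim t)
    show ?case
      using continuous_on_tendsto_compose[OF h tendsto_Pair[OF elim]] by simp
  qed
  then show ?thesis
    using s(1) r(1) unfolding strongly_measurable_def
    by (intro exI[of _ "\<lambda>n t. h (s n t) (r n t)"]) (auto intro: simple_function_compose2)
qed

lemma strongly_measurable_add:
  fixes u v :: "'a \<Rightarrow> 'b::real_normed_vector"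
  shows "strongly_measurable M u \<Longrightarrow> strongly_measurable M v \<Longrightarrow> strongly_measurable M (\<lambda>t. u t + v t)"
  by (rule strongly_measurable_compose2[where h = "(+)"]) (auto intro!: continuous_intros)

lemma strongly_measurable_diff:
  fixes u v :: "'a \<Rightarrow> 'b::real_normed_vector"
  shows "strongly_measurable M u \<Longrightarrow> strongly_measurable M v \<Longrightarrow> strongly_measurable M (\<lambda>t. u t - v t)"
  by (rule strongly_measurable_compose2[where h = "(-)"]) (auto intro!: continuous_intros)

lemma strongly_measurable_scaleR:
  fixes u :: "'a \<Rightarrow> 'b::real_normed_vector"
  assumes "strongly_measurable M u"
  shows "strongly_measurable M (\<lambda>t. c *\<^sub>R u t)"
  by (rule strongly_measurable_compose2[where h = "\<lambda>x y. c *\<^sub>R x", OF assms assms])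
     (intro continuous_intros)

lemma strongly_measurable_Pair:
  "strongly_measurable M u \<Longrightarrow> strongly_measurable M v \<Longrightarrow> strongly_measurable M (\<lambda>t. (u t, v t))"
  by (rule strongly_measurable_compose2[where h = Pair]) (auto intro!: continuous_intros)

section \<open>The space of square integrable controls\<close>

abbreviation (input) time_measure :: "real \<Rightarrow> real measure" where
  "time_measure T \<equiv> lebesgue_on {0<..<T}"

interpretation time: complete_measure "time_measure T" for T
  by (rule complete_measure_lebesgue_on) simp

interpretation time: finite_measure "time_measure T" for T
  by (rule finite_measure_lebesgue_on) simp

lemma borel_measurable_norm_L2:
  "strongly_measurable (time_measure T) u \<Longrightarrow> (\<lambda>t. norm (u t)) \<in> borel_measurable (time_measure T)"
  by (rule time.borel_measurable_caratheodory[where g = "\<lambda>t z. norm z"])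
     (auto intro!: continuous_intros)

lemma L2_space_dominated:
  fixes u :: "real \<Rightarrow> 'z::real_normed_vector"
  assumes "strongly_measurable (time_measure T) u"
    and "integrable (time_measure T) f" "AE t in time_measure T. (norm (u t))\<^sup>2 \<le> f t"
  shows "u \<in> L2_space T"
proof -
  have "integrable (time_measure T) (\<lambda>t. (norm (u t))\<^sup>2)"
  proof (rule Bochner_Integration.integrable_bound[OF assms(2)])
    show "(\<lambda>t. (norm (u t))\<^sup>2) \<in> borel_measurable (time_measure T)"
      by (intro borel_measurable_power borel_measurable_norm_L2 assms)
    show "AE t in time_measure T. norm ((norm (u t))\<^sup>2) \<le> norm (f t)"
      using assms(3) by eventually_elim simp
  qed
  with assms(1) show ?thesis by (simp add: L2_space_def)
qed

lemma norm_add_square_le: "(norm (x + y))\<^sup>2 \<le> 2 * (norm x)\<^sup>2 + 2 * (norm (y::'a::real_normed_vector))\<^sup>2"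
proof -
  have "(norm (x + y))\<^sup>2 \<le> (norm x + norm y)\<^sup>2"
    by (intro power_mono norm_triangle_ineq) auto
  also have "\<dots> \<le> 2 * (norm x)\<^sup>2 + 2 * (norm y)\<^sup>2"
    using sum_squares_bound[of "norm x" "norm y"] by (simp add: power2_sum)
  finally show ?thesis .
qed

lemma L2_space_add:
  assumes "u \<in> L2_space T" "v \<in> L2_space T"
  shows "(\<lambda>t. u t + v t) \<in> L2_space T"
  by (rule L2_space_dominated[where f = "\<lambda>t. 2 * (norm (u t))\<^sup>2 + 2 * (norm (v t))\<^sup>2"])
     (use assms in \<open>auto simp: L2_space_def norm_add_square_le intro!: strongly_measurable_add\<close>)

lemma L2_space_scaleR:
  assumes "u \<in> L2_space T"
  shows "(\<lambda>t. c *\<^sub>R u t) \<in> L2_space T"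
  using assms by (auto simp: L2_space_def power_mult_distrib intro!: strongly_measurable_scaleR)

lemma L2_space_diff:
  assumes "u \<in> L2_space T" "v \<in> L2_space T"
  shows "(\<lambda>t. u t - v t) \<in> L2_space T"
  using L2_space_add[OF assms(1) L2_space_scaleR[OF assms(2), of "-1"]] by simp

lemma L2_norm_nonneg: "0 \<le> L2_norm T u"
  by (simp add: L2_norm_def)

lemma L2_norm_square: "(L2_norm T u)\<^sup>2 = (LINT t|time_measure T. (norm (u t))\<^sup>2)"
  by (simp add: L2_norm_def)

lemma L2_norm_scaleR: "L2_norm T (\<lambda>t. c *\<^sub>R u t) = \<bar>c\<bar> * L2_norm T u"
  by (simp add: L2_norm_def power_mult_distrib real_sqrt_mult)

text \<open>Minkowski's inequality, from the pointwise bound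
  \<open>\<parallel>x + y\<parallel>\<^sup>2 \<le> (1 + c) \<parallel>x\<parallel>\<^sup>2 + (1 + 1/c) \<parallel>y\<parallel>\<^sup>2\<close> with the optimal \<open>c\<close>.\<close>

lemma L2_norm_triangle_real:
  fixes f g :: "real \<Rightarrow> real"
  assumes int: "integrable M (\<lambda>t. (f t)\<^sup>2)" "integrable M (\<lambda>t. (g t)\<^sup>2)" "integrable M (\<lambda>t. (h t)\<^sup>2)"
    and le: "\<And>t. 0 \<le> f t" "\<And>t. 0 \<le> g t" "\<And>t. 0 \<le> h t" "\<And>t. h t \<le> f t + g t"
  shows "sqrt (LINT t|M. (h t)\<^sup>2) \<le> sqrt (LINT t|M. (f t)\<^sup>2) + sqrt (LINT t|M. (g t)\<^sup>2)"
proof (rule field_le_epsilon)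
  fix e :: real assume "0 < e"
  define F where "F = sqrt (LINT t|M. (f t)\<^sup>2) + e / 2"
  define G where "G = sqrt (LINT t|M. (g t)\<^sup>2) + e / 2"
  have pos: "0 < F" "0 < G"
    using \<open>0 < e\<close> by (auto simp: F_def G_def intro: add_nonneg_pos)
  have sq: "(LINT t|M. (f t)\<^sup>2) \<le> F\<^sup>2" "(LINT t|M. (g t)\<^sup>2) \<le> G\<^sup>2"
    using pos \<open>0 < e\<close> unfolding F_def G_def by (auto intro!: sqrt_le_D)
  have "(LINT t|M. (h t)\<^sup>2) \<le> (LINT t|M. (1 + G / F) * (f t)\<^sup>2 + (1 + F / G) * (g t)\<^sup>2)"
  proof (rule integral_mono)
    fix t
    have "(h t)\<^sup>2 \<le> (f t + g t)\<^sup>2"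
      using le by (intro power_mono) auto
    also have "\<dots> = (f t)\<^sup>2 + (g t)\<^sup>2 + 2 * (f t * g t)"
      by (simp add: power2_sum)
    also have "2 * (f t * g t) \<le> G / F * (f t)\<^sup>2 + F / G * (g t)\<^sup>2"
    proof -
      have "0 \<le> (G * f t - F * g t)\<^sup>2 / (F * G)" using pos by simp
      then show ?thesis
        using pos by (simp add: power2_diff field_simps power2_eq_square)
    qed
    finally show "(h t)\<^sup>2 \<le> (1 + G / F) * (f t)\<^sup>2 + (1 + F / G) * (g t)\<^sup>2"
      by (simp add: algebra_simps)
  qed (use int in auto)
  also have "\<dots> = (1 + G / F) * (LINT t|M. (f t)\<^sup>2) + (1 + F / G) * (LINT t|M. (g t)\<^sup>2)"
    using int by simp
  also have "\<dots> \<le> (1 + G / F) * F\<^sup>2 + (1 + F / G) * G\<^sup>2"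
    using pos sq by (intro add_mono mult_left_mono) auto
  also have "\<dots> = (F + G)\<^sup>2"
    using pos by (simp add: field_simps power2_eq_square)
  finally have "sqrt (LINT t|M. (h t)\<^sup>2) \<le> F + G"
    using pos by (intro real_le_lsqrt) auto
  then show "sqrt (LINT t|M. (h t)\<^sup>2)
      \<le> sqrt (LINT t|M. (f t)\<^sup>2) + sqrt (LINT t|M. (g t)\<^sup>2) + e"
    by (simp add: F_def G_def)
qed

lemma L2_norm_triangle:
  assumes "u \<in> L2_space T" "v \<in> L2_space T"
  shows "L2_norm T (\<lambda>t. u t + v t) \<le> L2_norm T u + L2_norm T v"
  unfolding L2_norm_def
  using assms L2_space_add[OF assms]
  by (intro L2_norm_triangle_real) (auto simp: L2_space_def norm_triangle_ineq)

lemma L2_norm_minus_commute: "L2_norm T (\<lambda>t. u t - v t) = L2_norm T (\<lambda>t. v t - u t)"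
  by (simp add: L2_norm_def norm_minus_commute)

lemma L2_norm_triangle_diff:
  assumes "u \<in> L2_space T" "v \<in> L2_space T" "w \<in> L2_space T"
  shows "L2_norm T (\<lambda>t. u t - w t) \<le> L2_norm T (\<lambda>t. u t - v t) + L2_norm T (\<lambda>t. v t - w t)"
  using L2_norm_triangle[OF L2_space_diff[OF assms(1,2)] L2_space_diff[OF assms(2,3)]] by simp

lemma L2_norm_eq_0_imp_AE:
  assumes "u \<in> L2_space T" "L2_norm T u = 0"
  shows "AE t in time_measure T. u t = 0"
proof -
  have "(LINT t|time_measure T. (norm (u t))\<^sup>2) = 0"
    using assms(2) by (simp add: L2_norm_def)
  then have "AE t in time_measure T. (norm (u t))\<^sup>2 = 0"
    using assms(1) by (subst (asm) integral_nonneg_eq_0_iff_AE) (auto simp: L2_space_def)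
  then show ?thesis by simp
qed

lemma integrable_inner_L2:
  fixes u v :: "real \<Rightarrow> 'z::real_inner"
  assumes "u \<in> L2_space T" "v \<in> L2_space T"
  shows "integrable (time_measure T) (\<lambda>t. inner (u t) (v t))"
proof (rule Bochner_Integration.integrable_bound)
  show "integrable (time_measure T) (\<lambda>t. (norm (u t))\<^sup>2 + (norm (v t))\<^sup>2)"
    using assms by (auto simp: L2_space_def)
  show "(\<lambda>t. inner (u t) (v t)) \<in> borel_measurable (time_measure T)"
    by (rule time.borel_measurable_caratheodory[OF strongly_measurable_Pair,
          where g = "\<lambda>t z. inner (fst z) (snd z)", simplified])
       (use assms in \<open>auto simp: L2_space_def intro!: continuous_intros\<close>)
  show "AE t in time_measure T. norm (inner (u t) (v t)) \<le> norm ((norm (u t))\<^sup>2 + (norm (v t))\<^sup>2)"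
  proof (rule AE_I2)
    fix t
    have "2 * norm (u t) * norm (v t) \<le> (norm (u t))\<^sup>2 + (norm (v t))\<^sup>2"
      by (rule sum_squares_bound)
    moreover have "0 \<le> norm (u t) * norm (v t)" by simp
    ultimately show "norm (inner (u t) (v t)) \<le> norm ((norm (u t))\<^sup>2 + (norm (v t))\<^sup>2)"
      using Cauchy_Schwarz_ineq2[of "u t" "v t"] by simp
  qed
qed

lemma simple_function_strongly_measurable: "simple_function M s \<Longrightarrow> strongly_measurable M s"
  unfolding strongly_measurable_def by (intro exI[of _ "\<lambda>_. s"]) auto

text \<open>Simple functions are dense in \<open>L\<^sup>2\<close>: cutting the approximants off where they exceed
  twice the limit keeps them simple and makes the convergence dominated.\<close>

lemma L2_simple_approx:
  fixes u :: "real \<Rightarrow> 'z::real_normed_vector"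
  assumes u: "u \<in> L2_space T" and "0 < e"
  shows "\<exists>s. simple_function (time_measure T) s \<and> s \<in> L2_space T \<and> L2_norm T (\<lambda>t. u t - s t) < e"
proof -
  let ?M = "time_measure T"
  have sm: "strongly_measurable ?M u" and int: "integrable ?M (\<lambda>t. (norm (u t))\<^sup>2)"
    using u by (auto simp: L2_space_def)
  obtain s where s: "\<And>n::nat. simple_function ?M (s n)" and lim: "AE t in ?M. (\<lambda>n. s n t) \<longlonglongrightarrow> u t"
    using sm unfolding strongly_measurable_def by blast
  define r where "r n t = (if norm (s n t) \<le> 2 * norm (u t) then s n t else 0)" for n t
  have simple: "simple_function ?M (r n)" for n
    unfolding r_def
  proof (rule simple_function_If[OF s simple_function_const])
    have "(\<lambda>t. norm (s n t)) \<in> borel_measurable ?M" "(\<lambda>t. 2 * norm (u t)) \<in> borel_measurable ?M"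
      using borel_measurable_norm_L2 sm simple_function_strongly_measurable[OF s]
      by (auto intro!: borel_measurable_times)
    then show "{t \<in> space ?M. norm (s n t) \<le> 2 * norm (u t)} \<in> sets ?M"
      by (rule borel_measurable_le)
  qed
  have le: "(norm (u t - r n t))\<^sup>2 \<le> 9 * (norm (u t))\<^sup>2" for n t
  proof -
    have "norm (u t - r n t) \<le> 3 * norm (u t)"
      using norm_triangle_ineq4[of "u t" "s n t"] by (auto simp: r_def)
    from power_mono[OF this, of 2] show ?thesis
      by (simp add: power_mult_distrib)
  qed
  have diff_sm: "strongly_measurable ?M (\<lambda>t. u t - r n t)" for n
    using sm simple simple_function_strongly_measurable strongly_measurable_diff by blast
  have conv: "(\<lambda>n. LINT t|?M. (norm (u t - r n t))\<^sup>2) \<longlonglongrightarrow> (LINT t|?M. 0)"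
  proof (rule integral_dominated_convergence[where w = "\<lambda>t. 9 * (norm (u t))\<^sup>2"])
    show "(\<lambda>t. (norm (u t - r n t))\<^sup>2) \<in> borel_measurable ?M" for n
      by (intro borel_measurable_power borel_measurable_norm_L2 diff_sm)
    show "AE t in ?M. (\<lambda>n. (norm (u t - r n t))\<^sup>2) \<longlonglongrightarrow> 0"
      using lim
    proof eventually_elim
      case (elim t)
      have "(\<lambda>n. r n t) \<longlonglongrightarrow> u t"
      proof (cases "u t = 0")
        case False
        then have "\<forall>\<^sub>F n in sequentially. norm (s n t) < 2 * norm (u t)"
          by (intro order_tendstoD(2)[OF tendsto_norm[OF elim]]) auto
        then have "\<forall>\<^sub>F n in sequentially. s n t = r n t"
          by eventually_elim (auto simp: r_def)
        with elim show ?thesis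
          using tendsto_cong by fast
      next
        case True
        then have "r n t = 0" for n by (auto simp: r_def)
        then show ?thesis using True by simp
      qed
      then have "(\<lambda>n. (norm (u t - r n t))\<^sup>2) \<longlonglongrightarrow> (norm (u t - u t))\<^sup>2"
        by (intro tendsto_intros)
      then show ?case by simp
    qed
  qed (use int le in auto)
  then have "(\<lambda>n. L2_norm T (\<lambda>t. u t - r n t)) \<longlonglongrightarrow> sqrt 0"
    unfolding L2_norm_def by (intro tendsto_real_sqrt) simp
  then have "\<forall>\<^sub>F n in sequentially. L2_norm T (\<lambda>t. u t - r n t) < e"
    using \<open>0 < e\<close> by (intro order_tendstoD(2)) auto
  then obtain n where "L2_norm T (\<lambda>t. u t - r n t) < e"
    by (auto simp: eventually_sequentially)
  moreover have "r n \<in> L2_space T"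
  proof (rule L2_space_dominated[where f = "\<lambda>t. 4 * (norm (u t))\<^sup>2"])
    show "strongly_measurable ?M (r n)"
      by (rule simple_function_strongly_measurable[OF simple])
    have "norm (r n t) \<le> 2 * norm (u t)" for t
      by (auto simp: r_def)
    from power_mono[OF this, of _ 2] show "AE t in ?M. (norm (r n t))\<^sup>2 \<le> 4 * (norm (u t))\<^sup>2"
      by (intro AE_I2) (simp add: power_mult_distrib)
  qed (use int in simp)
  ultimately show ?thesis
    using simple by blast
qed

text \<open>With the weights \<open>2\<^sup>n\<close> the sum of the squared norms is still integrable, hence finite almost
  everywhere, so the summands decay geometrically at almost every point.\<close>

lemma AE_summable_if_L2_norm_geometric:
  fixes w :: "nat \<Rightarrow> real \<Rightarrow> 'z::real_normed_vector"
  assumes w: "\<And>n. w n \<in> L2_space T" and le: "\<And>n. L2_norm T (w n) \<le> C * (1 / 2) ^ n"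
  shows "AE t in time_measure T. summable (\<lambda>n. norm (w n t))"
proof -
  let ?M = "time_measure T"
  define f where "f n t = 2 ^ n * (norm (w n t))\<^sup>2" for n t
  have meas: "(\<lambda>t. ennreal (f n t)) \<in> borel_measurable ?M" for n
    unfolding f_def using w[of n]
    by (auto simp: L2_space_def intro!: measurable_compose[OF _ measurable_ennreal]
        borel_measurable_times borel_measurable_power borel_measurable_norm_L2)
  have int: "integrable ?M (f n)" for n
    using w[of n] unfolding f_def by (auto simp: L2_space_def)
  have "integral\<^sup>N ?M (\<lambda>t. ennreal (f n t)) \<le> ennreal (C\<^sup>2 * (1 / 2) ^ n)" for n
  proof -
    have "integral\<^sup>N ?M (\<lambda>t. ennreal (f n t)) = ennreal (LINT t|?M. f n t)"
      by (rule nn_integral_eq_integral[OF int]) (simp add: f_def)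
    also have "(LINT t|?M. f n t) = 2 ^ n * (L2_norm T (w n))\<^sup>2"
      unfolding f_def L2_norm_square by simp
    also have "\<dots> \<le> 2 ^ n * (C * (1 / 2) ^ n)\<^sup>2"
      using le[of n] by (intro mult_left_mono power_mono) (auto simp: L2_norm_nonneg)
    also have "\<dots> = C\<^sup>2 * (1 / 2) ^ n"
      by (simp add: power_mult_distrib power2_eq_square field_simps)
    finally show ?thesis
      by (simp add: ennreal_leI)
  qed
  then have "(\<Sum>n. integral\<^sup>N ?M (\<lambda>t. ennreal (f n t))) \<le> (\<Sum>n. ennreal (C\<^sup>2 * (1 / 2) ^ n))"
    by (intro suminf_le) auto
  also have "\<dots> < top"
  proof -
    have "summable (\<lambda>n. C\<^sup>2 * (1 / 2 :: real) ^ n)"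
      by (intro summable_mult summable_geometric) simp
    then have "(\<Sum>n. ennreal (C\<^sup>2 * (1 / 2) ^ n)) \<noteq> top"
      by (rule ennreal_suminf_neq_top) simp
    then show ?thesis
      unfolding less_top .
  qed
  finally have "integral\<^sup>N ?M (\<lambda>t. \<Sum>n. ennreal (f n t)) \<noteq> \<infinity>"
    using meas by (subst nn_integral_suminf) auto
  then have "AE t in ?M. (\<Sum>n. ennreal (f n t)) \<noteq> \<infinity>"
    using meas by (intro nn_integral_PInf_AE borel_measurable_suminf_order)
  then show ?thesis
  proof eventually_elim
    case (elim t)
    have "summable (\<lambda>n. f n t)"
      using elim by (intro summable_suminf_not_top) (auto simp: f_def)
    then have "Bseq (\<lambda>n. f n t)"
      by (intro convergent_imp_Bseq) (auto dest: summable_LIMSEQ_zero simp: convergent_def)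
    then obtain B where B: "0 < B" "\<And>n. norm (f n t) \<le> B"
      by (auto elim: BseqE)
    have "norm (w n t) \<le> sqrt B * (1 / sqrt 2) ^ n" for n
    proof -
      have "(norm (w n t))\<^sup>2 \<le> B * (1 / 2) ^ n"
        using B(2)[of n] by (simp add: f_def field_simps)
      also have "(1 / 2) ^ n = ((1 / sqrt 2) ^ n)\<^sup>2"
        by (subst power_mult[symmetric], subst mult.commute, subst power_mult)
           (simp add: power_divide)
      also have "B * \<dots> = (sqrt B * (1 / sqrt 2) ^ n)\<^sup>2"
        using B(1) by (simp add: power_mult_distrib)
      finally show ?thesis
        by (rule power2_le_imp_le) (use B(1) in simp)
    qed
    then have le: "norm (norm (w n t)) \<le> sqrt B * (1 / sqrt 2) ^ n" for n
      by simp
    have "summable (\<lambda>n. sqrt B * (1 / sqrt 2) ^ n)"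
      by (intro summable_mult summable_geometric) auto
    then show ?case
      by (rule summable_comparison_test'[where N = 0]) (rule le)
  qed
qed

lemma L2_norm_geometric:
  fixes u :: "nat \<Rightarrow> real \<Rightarrow> 'z::real_normed_vector"
  assumes u: "\<And>n. u n \<in> L2_space T"
    and le: "\<And>n. L2_norm T (\<lambda>t. u (Suc n) t - u n t) \<le> C * (1 / 2) ^ n"
  shows "L2_norm T (\<lambda>t. u m t - u 0 t) \<le> 2 * C * (1 - (1 / 2) ^ m)"
proof (induction m)
  case (Suc m)
  have "L2_norm T (\<lambda>t. u (Suc m) t - u 0 t)
      \<le> L2_norm T (\<lambda>t. u (Suc m) t - u m t) + L2_norm T (\<lambda>t. u m t - u 0 t)"
    by (intro L2_norm_triangle_diff u)
  also have "\<dots> \<le> C * (1 / 2) ^ m + 2 * C * (1 - (1 / 2) ^ m)"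
    by (intro add_mono le Suc.IH)
  finally show ?case
    by (simp add: algebra_simps)
qed (simp add: L2_norm_def)

text \<open>The simple functions that witness the strong measurability of the limit come from one
  \<open>L\<^sup>2\<close>-approximant of each term of the sequence.\<close>

lemma L2_complete:
  fixes u :: "nat \<Rightarrow> real \<Rightarrow> 'z::banach"
  assumes u: "\<And>n. u n \<in> L2_space T"
    and le: "\<And>n. L2_norm T (\<lambda>t. u (Suc n) t - u n t) \<le> C * (1 / 2) ^ n"
  shows "\<exists>v\<in>L2_space T. (AE t in time_measure T. (\<lambda>n. u n t) \<longlonglongrightarrow> v t) \<and>
    (\<forall>n. L2_norm T (\<lambda>t. u n t - v t) \<le> 2 * C * (1 / 2) ^ n)"
proof -
  let ?M = "time_measure T"
  define v where "v t = lim (\<lambda>n. u n t)" for t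
  have diff: "(\<lambda>t. u m t - u n t) \<in> L2_space T" for m n
    by (intro L2_space_diff u)
  have conv: "AE t in ?M. (\<lambda>n. u n t) \<longlonglongrightarrow> v t"
    using AE_summable_if_L2_norm_geometric[OF diff le]
  proof eventually_elim
    case (elim t)
    then have "summable (\<lambda>n. u (Suc n) t - u n t)"
      by (rule summable_norm_cancel)
    then obtain l where "(\<lambda>n. \<Sum>i<n. u (Suc i) t - u i t) \<longlonglongrightarrow> l"
      unfolding summable_def sums_def by auto
    then have "(\<lambda>n. u n t - u 0 t) \<longlonglongrightarrow> l"
      by (simp add: sum_lessThan_telescope[of "\<lambda>i. u i t"])
    from tendsto_add[OF this tendsto_const[of "u 0 t"]] have "convergent (\<lambda>n. u n t)"
      by (auto simp: convergent_def)
    then show ?case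
      by (simp add: v_def convergent_LIMSEQ_iff)
  qed
  have "\<exists>s. simple_function ?M s \<and> s \<in> L2_space T \<and> L2_norm T (\<lambda>t. u n t - s t) < 1 * (1 / 2) ^ n" for n
    by (rule L2_simple_approx[OF u]) simp
  then obtain s where s: "\<And>n. simple_function ?M (s n)" "\<And>n. s n \<in> L2_space T"
    and s_le: "\<And>n. L2_norm T (\<lambda>t. u n t - s n t) \<le> 1 * (1 / 2) ^ n"
    by (metis less_imp_le)
  have "AE t in ?M. (\<lambda>n. s n t) \<longlonglongrightarrow> v t"
    using AE_summable_if_L2_norm_geometric[OF L2_space_diff[OF u s(2)] s_le] conv
  proof eventually_elim
    case (elim t)
    then have "(\<lambda>n. u n t - s n t) \<longlonglongrightarrow> 0"
      using summable_LIMSEQ_zero tendsto_norm_zero_iff by blast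
    from tendsto_diff[OF elim(2) this] show ?case by simp
  qed
  then have sm: "strongly_measurable ?M v"
    using s(1) unfolding strongly_measurable_def by blast
  have nn_eq: "(\<integral>\<^sup>+ t. ennreal ((norm (w t))\<^sup>2) \<partial>?M) = ennreal ((L2_norm T w)\<^sup>2)"
    if "w \<in> L2_space T" for w :: "real \<Rightarrow> 'z"
    unfolding L2_norm_square using that
    by (intro nn_integral_eq_integral) (auto simp: L2_space_def)
  have meas: "(\<lambda>t. (norm (w t))\<^sup>2) \<in> borel_measurable ?M"
    if "strongly_measurable ?M w" for w :: "real \<Rightarrow> 'z"
    using that by (intro borel_measurable_power borel_measurable_norm_L2)
  have "0 \<le> C"
    using order_trans[OF L2_norm_nonneg le[of 0]] by simp
  have fatou: "(\<integral>\<^sup>+ t. ennreal ((norm (u n t - v t))\<^sup>2) \<partial>?M) \<le> ennreal ((2 * C * (1 / 2) ^ n)\<^sup>2)" for n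
  proof -
    have tail: "L2_norm T (\<lambda>t. u n t - u (n + m) t) \<le> 2 * C * (1 / 2) ^ n" for m
    proof -
      have "L2_norm T (\<lambda>t. u (n + m) t - u (n + 0) t) \<le> 2 * (C * (1 / 2) ^ n) * (1 - (1 / 2) ^ m)"
        using le[of "n + _"]
        by (intro L2_norm_geometric[where u = "\<lambda>m. u (n + m)"] u) (simp add: power_add mult.assoc)
      also have "\<dots> \<le> 2 * (C * (1 / 2) ^ n) * 1"
        using \<open>0 \<le> C\<close> by (intro mult_left_mono) auto
      finally show ?thesis
        by (subst L2_norm_minus_commute) simp
    qed
    have "(\<integral>\<^sup>+ t. ennreal ((norm (u n t - v t))\<^sup>2) \<partial>?M)
        = (\<integral>\<^sup>+ t. liminf (\<lambda>m. ennreal ((norm (u n t - u (n + m) t))\<^sup>2)) \<partial>?M)"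
    proof (rule nn_integral_cong_AE)
      show "AE t in ?M. ennreal ((norm (u n t - v t))\<^sup>2)
          = liminf (\<lambda>m. ennreal ((norm (u n t - u (n + m) t))\<^sup>2))"
        using conv
      proof eventually_elim
        case (elim t)
        then have "(\<lambda>m. u (n + m) t) \<longlonglongrightarrow> v t"
          using LIMSEQ_ignore_initial_segment[of "\<lambda>n. u n t" "v t" n] by (simp add: add.commute)
        then have "(\<lambda>m. ennreal ((norm (u n t - u (n + m) t))\<^sup>2)) \<longlonglongrightarrow> ennreal ((norm (u n t - v t))\<^sup>2)"
          by (intro tendsto_ennrealI tendsto_intros)
        then show ?case
          by (rule lim_imp_Liminf[OF sequentially_bot, symmetric])
      qed
    qed
    also have "\<dots> \<le> liminf (\<lambda>m. \<integral>\<^sup>+ t. ennreal ((norm (u n t - u (n + m) t))\<^sup>2) \<partial>?M)"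
      using diff
      by (intro nn_integral_liminf measurable_compose[OF _ measurable_ennreal] meas)
         (auto simp: L2_space_def)
    also have "\<dots> \<le> ennreal ((2 * C * (1 / 2) ^ n)\<^sup>2)"
      unfolding nn_eq[OF diff]
      by (intro Liminf_le always_eventually allI ennreal_leI power_mono tail L2_norm_nonneg) simp
    finally show ?thesis .
  qed
  have sm': "strongly_measurable ?M (\<lambda>t. u n t - v t)" for n
    using u[of n] sm by (auto simp: L2_space_def intro: strongly_measurable_diff)
  have diff_L2: "(\<lambda>t. u n t - v t) \<in> L2_space T" for n
  proof -
    have "integrable ?M (\<lambda>t. (norm (u n t - v t))\<^sup>2)"
      unfolding integrable_iff_bounded
      using meas[OF sm'] le_less_trans[OF fatou] by auto
    then show ?thesis
      using sm' by (simp add: L2_space_def)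
  qed
  have "v \<in> L2_space T"
    using L2_space_diff[OF u[of 0] diff_L2[of 0]] by simp
  moreover have "L2_norm T (\<lambda>t. u n t - v t) \<le> 2 * C * (1 / 2) ^ n" for n
  proof (rule power2_le_imp_le)
    show "(L2_norm T (\<lambda>t. u n t - v t))\<^sup>2 \<le> (2 * C * (1 / 2) ^ n)\<^sup>2"
      using fatou[of n] unfolding nn_eq[OF diff_L2] by (subst (asm) ennreal_le_iff) auto
  qed (use \<open>0 \<le> C\<close> in simp)
  ultimately show ?thesis
    using conv by blast
qed

section \<open>Uniform boundedness of the admissible controls\<close>

text \<open>The \<open>L\<^sup>2\<close>-norm of the part of \<open>\<parallel>u\<parallel>\<close> above the level \<open>c\<close>: unlike the essential supremum it is
  continuous in \<open>L\<^sup>2\<close>, and it still detects whether \<open>c\<close> is an essential bound.\<close>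

definition excess :: "real \<Rightarrow> real \<Rightarrow> (real \<Rightarrow> 'z::real_normed_vector) \<Rightarrow> real" where
  "excess T c u = sqrt (LINT t|time_measure T. (max (norm (u t) - c) 0)\<^sup>2)"

lemma integrable_excess:
  assumes "u \<in> L2_space T" "0 \<le> c"
  shows "integrable (time_measure T) (\<lambda>t. (max (norm (u t) - c) 0)\<^sup>2)"
proof (rule Bochner_Integration.integrable_bound)
  show "integrable (time_measure T) (\<lambda>t. (norm (u t))\<^sup>2)"
    using assms by (simp add: L2_space_def)
  have "(\<lambda>t. norm (u t)) \<in> borel_measurable (time_measure T)"
    using assms by (auto simp: L2_space_def intro: borel_measurable_norm_L2)
  then show "(\<lambda>t. (max (norm (u t) - c) 0)\<^sup>2) \<in> borel_measurable (time_measure T)"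
    by measurable
  show "AE t in time_measure T. norm ((max (norm (u t) - c) 0)\<^sup>2) \<le> norm ((norm (u t))\<^sup>2)"
    using \<open>0 \<le> c\<close> by (intro AE_I2) (auto intro!: power_mono)
qed

lemma excess_le:
  assumes "u \<in> L2_space T" "v \<in> L2_space T" "0 \<le> c"
  shows "excess T c u \<le> excess T c v + L2_norm T (\<lambda>t. u t - v t)"
  unfolding excess_def L2_norm_def
proof (rule L2_norm_triangle_real)
  show "integrable (time_measure T) (\<lambda>t. (norm (u t - v t))\<^sup>2)"
    using L2_space_diff[OF assms(1,2)] by (simp add: L2_space_def)
  show "max (norm (u t) - c) 0 \<le> max (norm (v t) - c) 0 + norm (u t - v t)" for t
    using norm_triangle_ineq2[of "u t" "v t"] norm_ge_zero[of "u t - v t"] by linarith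
qed (use assms in \<open>auto intro: integrable_excess\<close>)

lemma excess_eq_0_iff:
  assumes "u \<in> L2_space T" "0 \<le> c"
  shows "excess T c u = 0 \<longleftrightarrow> (AE t in time_measure T. norm (u t) \<le> c)"
proof -
  have "excess T c u = 0 \<longleftrightarrow> (AE t in time_measure T. (max (norm (u t) - c) 0)\<^sup>2 = 0)"
    unfolding excess_def using integrable_excess[OF assms]
    by (simp add: integral_nonneg_eq_0_iff_AE)
  also have "\<dots> \<longleftrightarrow> (AE t in time_measure T. norm (u t) \<le> c)"
    by (intro AE_cong) (auto simp: max_def)
  finally show ?thesis .
qed

lemma excess_nonneg: "0 \<le> excess T c u"
  by (simp add: excess_def)

text \<open>Baire's argument in \<open>L\<^sup>2\<close>: if near every control there were controls with arbitrarily
  large essential supremum, a rapidly convergent sequence of such controls would have a limit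
  that is in the set but not essentially bounded.\<close>

lemma locally_bounded_somewhere:
  fixes U :: "(real \<Rightarrow> 'z::banach) set"
  assumes U: "admissible_set T U"
  shows "\<exists>u\<in>U. \<exists>r>0. \<exists>c\<ge>0. \<forall>w\<in>U. L2_norm T (\<lambda>t. w t - u t) \<le> r \<longrightarrow>
    (AE t in time_measure T. norm (w t) \<le> c)"
proof (rule ccontr)
  assume neg: "\<not> ?thesis"
  have L2: "u \<in> L2_space T" if "u \<in> U" for u
    using U that by (auto simp: admissible_set_def)
  have ex: "\<exists>w\<in>U. L2_norm T (\<lambda>t. w t - u t) \<le> r \<and> 0 < excess T (real n) w"
    if "u \<in> U" "0 < r" for u r n
  proof -
    have "\<not> (\<forall>w\<in>U. L2_norm T (\<lambda>t. w t - u t) \<le> r \<longrightarrow> (AE t in time_measure T. norm (w t) \<le> real n))"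
    proof
      assume *: "\<forall>w\<in>U. L2_norm T (\<lambda>t. w t - u t) \<le> r \<longrightarrow> (AE t in time_measure T. norm (w t) \<le> real n)"
      show False
        using neg
        by (rule notE) (intro bexI[of _ u] exI[of _ r] exI[of _ "real n"] conjI; use that * in simp)
    qed
    then obtain w where w: "w \<in> U" "L2_norm T (\<lambda>t. w t - u t) \<le> r"
      "\<not> (AE t in time_measure T. norm (w t) \<le> real n)"
      by blast
    then have "excess T (real n) w \<noteq> 0"
      using excess_eq_0_iff[OF L2[OF w(1)], of "real n"] by simp
    with w excess_nonneg[of T "real n" w] show ?thesis
      by (intro bexI[of _ w]) auto
  qed
  \<comment> \<open>A pair consists of a control and of a radius so small that all of its successors keep an
    excess over the level \<open>n\<close>.\<close>
  define P where "P n x \<longleftrightarrow> fst x \<in> U \<and> 0 < snd x \<and> 4 * snd x \<le> excess T (real n) (fst x)"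
    for n :: nat and x :: "(real \<Rightarrow> 'z) \<times> real"
  define Q where "Q x y \<longleftrightarrow> L2_norm T (\<lambda>t. fst y t - fst x t) \<le> snd x \<and> snd y \<le> snd x / 2"
    for x y :: "(real \<Rightarrow> 'z) \<times> real"
  have "\<exists>f. \<forall>n. P n (f n) \<and> Q (f n) (f (Suc n))"
  proof (rule dependent_nat_choice)
    obtain u where "u \<in> U"
      using U by (auto simp: admissible_set_def)
    from ex[OF this, of 1 0] obtain w where "w \<in> U" "0 < excess T (real 0) w" by auto
    then show "\<exists>x. P 0 x"
      by (intro exI[of _ "(w, excess T 0 w / 4)"]) (simp add: P_def)
    fix x n assume "P n x"
    then have "fst x \<in> U" "0 < snd x" by (auto simp: P_def)
    from ex[OF this, of "Suc n"] obtain w where w: "w \<in> U" "L2_norm T (\<lambda>t. w t - fst x t) \<le> snd x"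
      "0 < excess T (real (Suc n)) w" by auto
    then show "\<exists>y. P (Suc n) y \<and> Q x y"
      using \<open>0 < snd x\<close>
      by (intro exI[of _ "(w, min (snd x / 2) (excess T (real (Suc n)) w / 4))"])
         (auto simp: P_def Q_def)
  qed
  then obtain f where P: "\<And>n. P n (f n)" and Q: "\<And>n. Q (f n) (f (Suc n))"
    by blast
  define u where "u n = fst (f n)" for n
  define \<rho> where "\<rho> n = snd (f n)" for n
  have u: "u n \<in> U" and \<rho>: "0 < \<rho> n" "4 * \<rho> n \<le> excess T (real n) (u n)"
    and step: "L2_norm T (\<lambda>t. u (Suc n) t - u n t) \<le> \<rho> n" "\<rho> (Suc n) \<le> \<rho> n / 2" for n
    using P[of n] Q[of n] by (auto simp: u_def \<rho>_def P_def Q_def)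
  have decay: "\<rho> (k + n) \<le> \<rho> k * (1 / 2) ^ n" for k n
  proof (induction n)
    case (Suc n)
    then show ?case using step(2)[of "k + n"] by simp
  qed simp
  have shifted: "L2_norm T (\<lambda>t. u (k + Suc n) t - u (k + n) t) \<le> \<rho> k * (1 / 2) ^ n" for k n
    using step(1)[of "k + n"] decay[of k n] by simp
  obtain v where v: "v \<in> L2_space T"
    and dist: "\<And>n. L2_norm T (\<lambda>t. u n t - v t) \<le> 2 * \<rho> 0 * (1 / 2) ^ n"
    using L2_complete[of u T "\<rho> 0"] L2[OF u] shifted[of 0] by auto
  have "(\<lambda>n. 2 * \<rho> 0 * (1 / 2) ^ n) \<longlonglongrightarrow> 2 * \<rho> 0 * 0"
    by (intro tendsto_mult tendsto_const LIMSEQ_power_zero) simp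
  then have lim: "(\<lambda>n. 2 * \<rho> 0 * (1 / 2) ^ n) \<longlonglongrightarrow> 0"
    by simp
  have dist0: "(\<lambda>n. L2_norm T (\<lambda>t. u n t - v t)) \<longlonglongrightarrow> 0"
    by (rule tendsto_sandwich[OF _ _ tendsto_const lim]) (auto simp: L2_norm_nonneg dist)
  then have "v \<in> U"
    using U u v unfolding admissible_set_def by blast
  then obtain K where K: "AE t in time_measure T. norm (v t) \<le> K"
    using U unfolding admissible_set_def Linf_space_def by blast
  obtain k where "K \<le> real k"
    using real_arch_simple by blast
  have "AE t in time_measure T. norm (v t) \<le> real k"
    using K by eventually_elim (use \<open>K \<le> real k\<close> in linarith)
  then have "excess T (real k) v = 0"
    using excess_eq_0_iff[OF v] by simp
  then have "4 * \<rho> k \<le> L2_norm T (\<lambda>t. u k t - v t)"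
    using excess_le[OF L2[OF u] v, of "real k" k] \<rho>(2)[of k] by simp
  moreover have "L2_norm T (\<lambda>t. u k t - v t) \<le> 2 * \<rho> k + 0"
  proof (rule LIMSEQ_le_const)
    show "(\<lambda>m. 2 * \<rho> k + L2_norm T (\<lambda>t. u (k + m) t - v t)) \<longlonglongrightarrow> 2 * \<rho> k + 0"
      using LIMSEQ_ignore_initial_segment[OF dist0, of k]
      by (intro tendsto_add tendsto_const) (simp add: add.commute)
    have "L2_norm T (\<lambda>t. u k t - v t) \<le> 2 * \<rho> k + L2_norm T (\<lambda>t. u (k + m) t - v t)" for m
    proof -
      have "L2_norm T (\<lambda>t. u k t - v t)
          \<le> L2_norm T (\<lambda>t. u k t - u (k + m) t) + L2_norm T (\<lambda>t. u (k + m) t - v t)"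
        by (intro L2_norm_triangle_diff L2 u v)
      moreover have "L2_norm T (\<lambda>t. u (k + m) t - u (k + 0) t) \<le> 2 * \<rho> k * (1 - (1 / 2) ^ m)"
        using shifted by (intro L2_norm_geometric[where u = "\<lambda>m. u (k + m)"] L2 u) simp
      moreover have "2 * \<rho> k * (1 - (1 / 2) ^ m) \<le> 2 * \<rho> k * 1"
        using \<rho>(1)[of k] by (intro mult_left_mono) auto
      ultimately show ?thesis
        using L2_norm_minus_commute[of T "u k" "u (k + m)"] by simp
    qed
    then show "\<exists>N. \<forall>m\<ge>N. L2_norm T (\<lambda>t. u k t - v t) \<le> 2 * \<rho> k + L2_norm T (\<lambda>t. u (k + m) t - v t)"
      by blast
  qed
  ultimately show False
    using \<rho>(1)[of k] by simp
qed

text \<open>By convexity, a homothety shrinks the set into the neighbourhood in which the essential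
  suprema are bounded.\<close>

lemma admissible_set_uniformly_bounded:
  fixes U :: "(real \<Rightarrow> 'z::banach) set"
  assumes U: "admissible_set T U"
  shows "\<exists>K\<ge>0. \<forall>u\<in>U. AE t in time_measure T. norm (u t) \<le> K"
proof -
  obtain u0 r c where u0: "u0 \<in> U" and r: "0 < r" and c: "0 \<le> c"
    and bdd: "\<And>w. w \<in> U \<Longrightarrow> L2_norm T (\<lambda>t. w t - u0 t) \<le> r \<Longrightarrow> AE t in time_measure T. norm (w t) \<le> c"
    using locally_bounded_somewhere[OF U] by blast
  have L2: "u \<in> L2_space T" if "u \<in> U" for u
    using U that by (auto simp: admissible_set_def)
  obtain D where D: "\<And>u. u \<in> U \<Longrightarrow> L2_norm T u \<le> D"
    using U unfolding admissible_set_def by blast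
  have "0 \<le> D"
    using order_trans[OF L2_norm_nonneg D[OF u0]] .
  define l where "l = min 1 (r / (2 * D + 1))"
  have l: "0 < l" "l \<le> 1" "l * (2 * D) \<le> r"
  proof -
    show "0 < l" "l \<le> 1" using r \<open>0 \<le> D\<close> by (auto simp: l_def)
    have "l * (2 * D) \<le> r / (2 * D + 1) * (2 * D + 1)"
      using r \<open>0 \<le> D\<close> by (intro mult_mono) (auto simp: l_def)
    then show "l * (2 * D) \<le> r" using \<open>0 \<le> D\<close> by simp
  qed
  have "AE t in time_measure T. norm (v t) \<le> 2 * c / l" if v: "v \<in> U" for v
  proof -
    define w where "w t = (1 - l) *\<^sub>R u0 t + l *\<^sub>R v t" for t
    have "w \<in> U"
      using U u0 v l unfolding admissible_set_def w_def by auto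
    have "w t - u0 t = l *\<^sub>R (v t - u0 t)" for t
      by (simp add: w_def algebra_simps)
    then have "L2_norm T (\<lambda>t. w t - u0 t) = l * L2_norm T (\<lambda>t. v t - u0 t)"
      using l by (simp add: L2_norm_scaleR)
    also have "L2_norm T (\<lambda>t. v t - u0 t) \<le> 2 * D"
      using L2_norm_triangle[OF L2[OF v] L2_space_scaleR[OF L2[OF u0], of "-1"]]
        D[OF v] D[OF u0] L2_norm_scaleR[of T "-1" u0] by simp
    finally have "AE t in time_measure T. norm (w t) \<le> c"
      using l by (intro bdd[OF \<open>w \<in> U\<close>]) (simp add: mult_left_mono)
    moreover have "AE t in time_measure T. norm (u0 t) \<le> c"
      using r by (intro bdd[OF u0]) (simp add: L2_norm_def)
    ultimately show ?thesis
    proof eventually_elim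
      case (elim t)
      have "l * norm (v t) = norm (w t - (1 - l) *\<^sub>R u0 t)"
        using l by (simp add: w_def)
      also have "\<dots> \<le> norm (w t) + norm ((1 - l) *\<^sub>R u0 t)"
        by (rule norm_triangle_ineq4)
      also have "norm ((1 - l) *\<^sub>R u0 t) \<le> 1 * c"
        using l elim(2) unfolding norm_scaleR by (intro mult_mono) auto
      also have "norm (w t) + 1 * c \<le> c + 1 * c"
        using elim(1) by simp
      finally show ?case
        using l by (simp add: field_simps)
    qed
  qed
  then show ?thesis
    using c l by (intro exI[of _ "2 * c / l"]) auto
qed

section \<open>Strongly convex control problems\<close>

text \<open>The control problem with the contour integrals hidden in a kernel \<open>K\<close>, which enters through
  an integrable bound and its measurability in time.\<close>

locale control_problem =
  fixes T \<nu> :: real and U :: "(real \<Rightarrow> 'z::{real_inner, banach}) set"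
    and K :: "real \<Rightarrow> 'z \<Rightarrow> 'y::{real_inner, banach, second_countable_topology}"
    and k :: "real \<Rightarrow> real" and y\<^sub>d :: 'y
  assumes admissible: "admissible_set T U"
    and weight: "0 < \<nu>"
    and linear_K: "0 < t \<Longrightarrow> t < T \<Longrightarrow> linear (K t)"
    and norm_K: "0 < t \<Longrightarrow> t < T \<Longrightarrow> norm (K t z) \<le> k t * norm z"
    and integrable_k: "integrable (time_measure T) k"
    and measurable_K: "(\<lambda>t. K t z) \<in> borel_measurable (time_measure T)"
begin

definition S :: "(real \<Rightarrow> 'z) \<Rightarrow> 'y" where
  "S u = (LINT t|time_measure T. K t (u t))"

definition J :: "(real \<Rightarrow> 'z) \<Rightarrow> real" where
  "J u = 1 / 2 * (norm (S u - y\<^sub>d))\<^sup>2 + \<nu> / 2 * (L2_norm T u)\<^sup>2"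

lemma admissible_L2: "u \<in> U \<Longrightarrow> u \<in> L2_space T"
  using admissible by (auto simp: admissible_set_def)

lemma admissible_bounded: "u \<in> U \<Longrightarrow> \<exists>C. AE t in time_measure T. norm (u t) \<le> C"
  using admissible by (auto simp: admissible_set_def Linf_space_def)

lemma strongly_measurable_admissible: "u \<in> U \<Longrightarrow> strongly_measurable (time_measure T) u"
  using admissible_L2 by (auto simp: L2_space_def)

lemma measurable_K_compose:
  assumes "strongly_measurable (time_measure T) u"
  shows "(\<lambda>t. K t (u t)) \<in> borel_measurable (time_measure T)"
proof (rule time.borel_measurable_caratheodory[OF assms measurable_K])
  fix t assume t: "t \<in> space (time_measure T)"
  have "bounded_linear (K t)"
    using t linear_K[of t] norm_K[of t]
    by (intro bounded_linear_intro[where K = "k t"]) (auto simp: linear_iff mult.commute)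
  then show "continuous_on UNIV (K t)"
    by (rule linear_continuous_on)
qed

lemma norm_K_bounded_le:
  assumes "AE t in time_measure T. norm (u t) \<le> C"
  shows "AE t in time_measure T. norm (K t (u t)) \<le> \<bar>k t\<bar> * C"
  using assms AE_space
proof eventually_elim
  case (elim t)
  have "norm (K t (u t)) \<le> \<bar>k t\<bar> * norm (u t)"
    using norm_K[of t "u t"] elim(2) mult_right_mono[OF abs_ge_self[of "k t"] norm_ge_zero[of "u t"]]
    by simp
  also have "\<dots> \<le> \<bar>k t\<bar> * C"
    using elim by (intro mult_left_mono) auto
  finally show ?case .
qed

lemma integrable_K_compose:
  assumes "u \<in> U"
  shows "integrable (time_measure T) (\<lambda>t. K t (u t))"
proof -
  obtain C where C: "AE t in time_measure T. norm (u t) \<le> C"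
    using admissible_bounded[OF assms] by blast
  show ?thesis
  proof (rule Bochner_Integration.integrable_bound)
    show "integrable (time_measure T) (\<lambda>t. \<bar>k t\<bar> * C)"
      using integrable_k by auto
    show "AE t in time_measure T. norm (K t (u t)) \<le> norm (\<bar>k t\<bar> * C)"
      using norm_K_bounded_le[OF C] by eventually_elim simp
  qed (intro measurable_K_compose strongly_measurable_admissible assms)
qed

text \<open>The linear and the quadratic coefficient of \<open>J\<close> on the segment from \<open>u\<close> to \<open>v\<close>.\<close>

definition slope :: "(real \<Rightarrow> 'z) \<Rightarrow> (real \<Rightarrow> 'z) \<Rightarrow> real" where
  "slope u v = inner (S u - y\<^sub>d) (S v - S u) + \<nu> * (LINT t|time_measure T. inner (u t) (v t - u t))"

definition curvature :: "(real \<Rightarrow> 'z) \<Rightarrow> (real \<Rightarrow> 'z) \<Rightarrow> real" where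
  "curvature u v = 1 / 2 * (norm (S v - S u))\<^sup>2 + \<nu> / 2 * (L2_norm T (\<lambda>t. v t - u t))\<^sup>2"

lemma J_segment:
  assumes u: "u \<in> U" and v: "v \<in> U"
  shows "J (\<lambda>t. (1 - r) *\<^sub>R u t + r *\<^sub>R v t) = J u + r * slope u v + r\<^sup>2 * curvature u v"
proof -
  let ?w = "\<lambda>t. (1 - r) *\<^sub>R u t + r *\<^sub>R v t"
  have "S ?w = (LINT t|time_measure T. (1 - r) *\<^sub>R K t (u t) + r *\<^sub>R K t (v t))"
    unfolding S_def using linear_K
    by (intro Bochner_Integration.integral_cong) (auto simp: linear_iff)
  also have "\<dots> = (1 - r) *\<^sub>R S u + r *\<^sub>R S v"
    unfolding S_def using integrable_K_compose[OF u] integrable_K_compose[OF v] by simp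
  finally have S: "S ?w - y\<^sub>d = (S u - y\<^sub>d) + r *\<^sub>R (S v - S u)"
    by (simp add: algebra_simps)
  have diff: "(\<lambda>t. v t - u t) \<in> L2_space T"
    by (intro L2_space_diff admissible_L2 u v)
  have "(L2_norm T ?w)\<^sup>2 = (LINT t|time_measure T. (norm (u t))\<^sup>2
      + 2 * r * inner (u t) (v t - u t) + r\<^sup>2 * (norm (v t - u t))\<^sup>2)"
    unfolding L2_norm_square power2_norm_eq_inner
    by (intro Bochner_Integration.integral_cong refl)
       (simp add: algebra_simps inner_commute power2_eq_square)
  also have "\<dots> = (L2_norm T u)\<^sup>2 + 2 * r * (LINT t|time_measure T. inner (u t) (v t - u t))
      + r\<^sup>2 * (L2_norm T (\<lambda>t. v t - u t))\<^sup>2"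
    unfolding L2_norm_square
    using integrable_inner_L2[OF admissible_L2[OF u] diff] admissible_L2[OF u] diff
    by (simp add: L2_space_def)
  finally have L2: "(L2_norm T ?w)\<^sup>2 = (L2_norm T u)\<^sup>2
      + 2 * r * (LINT t|time_measure T. inner (u t) (v t - u t)) + r\<^sup>2 * (L2_norm T (\<lambda>t. v t - u t))\<^sup>2" .
  have "(norm ((S u - y\<^sub>d) + r *\<^sub>R (S v - S u)))\<^sup>2
      = (norm (S u - y\<^sub>d))\<^sup>2 + 2 * r * inner (S u - y\<^sub>d) (S v - S u) + r\<^sup>2 * (norm (S v - S u))\<^sup>2"
    unfolding power2_norm_eq_inner inner_add_left inner_add_right inner_scaleR_left inner_scaleR_right
    by (simp add: inner_commute[of "S v - S u" "S u - y\<^sub>d"] power2_eq_square distrib_left)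
  then show ?thesis
    unfolding J_def S L2 slope_def curvature_def by (simp add: algebra_simps)
qed

lemma admissible_segment:
  "u \<in> U \<Longrightarrow> v \<in> U \<Longrightarrow> 0 \<le> r \<Longrightarrow> r \<le> 1 \<Longrightarrow> (\<lambda>t. (1 - r) *\<^sub>R u t + r *\<^sub>R v t) \<in> U"
  using admissible by (auto simp: admissible_set_def)

text \<open>Strong convexity: the value at the midpoint is not below \<open>m\<close>, so the quadratic coefficient is
  controlled by how far the end points are from being minimal.\<close>

lemma curvature_le:
  assumes "u \<in> U" "v \<in> U" and m: "\<And>w. w \<in> U \<Longrightarrow> m \<le> J w"
  shows "curvature u v \<le> 2 * (J u - m) + 2 * (J v - m)"
proof -
  have "m \<le> J (\<lambda>t. (1 - 1 / 2) *\<^sub>R u t + (1 / 2) *\<^sub>R v t)"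
    using admissible_segment[OF assms(1,2), of "1 / 2"] by (intro m) simp
  also have "\<dots> = J u + 1 / 2 * slope u v + (1 / 2)\<^sup>2 * curvature u v"
    by (rule J_segment[OF assms(1,2)])
  finally have "m \<le> J u + slope u v / 2 + curvature u v / 4"
    by (simp add: power2_eq_square)
  moreover have "J v = J u + slope u v + curvature u v"
    using J_segment[OF assms(1,2), of 1] by simp
  ultimately show ?thesis
    by simp
qed

lemma L2_norm_le_curvature: "\<nu> / 2 * (L2_norm T (\<lambda>t. v t - u t))\<^sup>2 \<le> curvature u v"
  by (simp add: curvature_def)

lemma slope_nonneg:
  assumes u: "minimizer J U u" and "v \<in> U"
  shows "0 \<le> slope u v"
proof (rule first_order_nonneg)
  fix r :: real assume "0 < r" "r \<le> 1"
  moreover have "u \<in> U"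
    using u by (simp add: minimizer_def)
  ultimately have "J u \<le> J (\<lambda>t. (1 - r) *\<^sub>R u t + r *\<^sub>R v t)"
    using u admissible_segment[OF \<open>u \<in> U\<close> \<open>v \<in> U\<close>, of r] unfolding minimizer_def by simp
  then show "0 \<le> r * slope u v + r\<^sup>2 * curvature u v"
    using J_segment[OF \<open>u \<in> U\<close> \<open>v \<in> U\<close>, of r] by simp
qed

lemma minimizer_unique:
  assumes "minimizer J U u" "minimizer J U v"
  shows "AE t in time_measure T. u t = v t"
proof -
  have uv: "u \<in> U" "v \<in> U" "\<And>w. w \<in> U \<Longrightarrow> J u \<le> J w" "J v = J u"
    using assms by (auto simp: minimizer_def intro: antisym)
  have "\<nu> / 2 * (L2_norm T (\<lambda>t. v t - u t))\<^sup>2 \<le> 0"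
    using curvature_le[OF uv(1-3)] L2_norm_le_curvature[of v u] uv(4) by simp
  then have "L2_norm T (\<lambda>t. v t - u t) = 0"
    using weight by (simp add: mult_le_0_iff)
  then have "AE t in time_measure T. v t - u t = 0"
    by (intro L2_norm_eq_0_imp_AE L2_space_diff admissible_L2 uv)
  then show ?thesis
    by eventually_elim simp
qed

lemma J_nonneg: "0 \<le> J u"
  using weight by (simp add: J_def)

text \<open>\<open>S\<close> need not be continuous on \<open>L\<^sup>2\<close>; along a minimizing sequence the uniform bound of the
  admissible controls makes dominated convergence applicable.\<close>

lemma S_tendsto:
  assumes u: "\<And>n::nat. u n \<in> U" and v: "v \<in> U"
    and lim: "AE t in time_measure T. (\<lambda>n. u n t) \<longlonglongrightarrow> v t"
  shows "(\<lambda>n. S (u n)) \<longlonglongrightarrow> S v"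
proof -
  obtain C where C: "\<And>u. u \<in> U \<Longrightarrow> AE t in time_measure T. norm (u t) \<le> C"
    using admissible_set_uniformly_bounded[OF admissible] by blast
  show ?thesis
    unfolding S_def
  proof (rule integral_dominated_convergence[where w = "\<lambda>t. \<bar>k t\<bar> * C"])
    show "AE t in time_measure T. (\<lambda>n. K t (u n t)) \<longlonglongrightarrow> K t (v t)"
      using lim AE_space
    proof eventually_elim
      case (elim t)
      have "bounded_linear (K t)"
        using elim(2) linear_K[of t] norm_K[of t]
        by (intro bounded_linear_intro[where K = "k t"]) (auto simp: linear_iff mult.commute)
      then show ?case
        using elim(1) by (rule bounded_linear.tendsto)
    qed
    show "AE t in time_measure T. norm (K t (u n t)) \<le> \<bar>k t\<bar> * C" for n
      by (rule norm_K_bounded_le[OF C[OF u]])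
  qed (use integrable_k in \<open>auto intro!: measurable_K_compose strongly_measurable_admissible u v\<close>)
qed

text \<open>Strong convexity makes a minimizing sequence with geometrically small defects converge
  geometrically in \<open>L\<^sup>2\<close> and almost everywhere.\<close>

lemma minimizer_exists: "\<exists>u. minimizer J U u"
proof -
  define m where "m = Inf (J ` U)"
  have bdd: "bdd_below (J ` U)"
    using J_nonneg by (auto intro!: bdd_belowI)
  have m_le: "m \<le> J w" if "w \<in> U" for w
    unfolding m_def using bdd that by (auto intro: cInf_lower)
  have "J ` U \<noteq> {}"
    using admissible by (auto simp: admissible_set_def)
  have "\<exists>u\<in>U. J u < m + (1 / 4) ^ n" for n :: nat
    using cInf_lessD[OF \<open>J ` U \<noteq> {}\<close>, of "m + (1 / 4) ^ n"] unfolding m_def by auto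
  then obtain u where u: "\<And>n. u n \<in> U" and J_le: "\<And>n::nat. J (u n) < m + (1 / 4) ^ n"
    by metis
  have step: "L2_norm T (\<lambda>t. u (Suc n) t - u n t) \<le> sqrt (8 / \<nu>) * (1 / 2) ^ n" for n
  proof (rule power2_le_imp_le)
    have "\<nu> / 2 * (L2_norm T (\<lambda>t. u (Suc n) t - u n t))\<^sup>2 \<le> curvature (u n) (u (Suc n))"
      by (rule L2_norm_le_curvature)
    also have "\<dots> \<le> 2 * (J (u n) - m) + 2 * (J (u (Suc n)) - m)"
      by (rule curvature_le[OF u u m_le])
    also have "\<dots> \<le> 2 * (1 / 4) ^ n + 2 * ((1 / 4) ^ Suc n)"
      using J_le[of n] J_le[of "Suc n"] by (intro add_mono mult_left_mono) linarith+
    also have "\<dots> \<le> 4 * (1 / 4) ^ n"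
      by simp
    also have "(1 / 4 :: real) ^ n = ((1 / 2) ^ n)\<^sup>2"
      by (subst power_mult[symmetric], subst mult.commute, subst power_mult)
         (simp add: power2_eq_square)
    finally show "(L2_norm T (\<lambda>t. u (Suc n) t - u n t))\<^sup>2 \<le> (sqrt (8 / \<nu>) * (1 / 2) ^ n)\<^sup>2"
      using weight by (simp add: power_mult_distrib field_simps)
  qed (use weight in simp)
  obtain v where v: "v \<in> L2_space T" and lim: "AE t in time_measure T. (\<lambda>n. u n t) \<longlonglongrightarrow> v t"
    and dist: "\<And>n. L2_norm T (\<lambda>t. u n t - v t) \<le> 2 * sqrt (8 / \<nu>) * (1 / 2) ^ n"
    using L2_complete[of u T "sqrt (8 / \<nu>)", OF admissible_L2[OF u] step] by blast
  have "(\<lambda>n. 2 * sqrt (8 / \<nu>) * (1 / 2) ^ n) \<longlonglongrightarrow> 2 * sqrt (8 / \<nu>) * 0"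
    by (intro tendsto_mult tendsto_const LIMSEQ_power_zero) simp
  then have geometric: "(\<lambda>n. 2 * sqrt (8 / \<nu>) * (1 / 2) ^ n) \<longlonglongrightarrow> 0"
    by simp
  have dist0: "(\<lambda>n. L2_norm T (\<lambda>t. u n t - v t)) \<longlonglongrightarrow> 0"
    by (rule tendsto_sandwich[OF _ _ tendsto_const geometric]) (auto simp: L2_norm_nonneg dist)
  have "v \<in> U"
    using admissible u v dist0 unfolding admissible_set_def by blast
  have "(\<lambda>n. L2_norm T (u n)) \<longlonglongrightarrow> L2_norm T v"
  proof (rule LIM_zero_cancel, rule Lim_null_comparison[OF _ dist0], rule always_eventually, rule allI)
    fix n
    have "L2_norm T (u n) \<le> L2_norm T (\<lambda>t. u n t - v t) + L2_norm T v"
      using L2_norm_triangle[OF L2_space_diff[OF admissible_L2[OF u] v] v] by simp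
    moreover have "L2_norm T v \<le> L2_norm T (\<lambda>t. v t - u n t) + L2_norm T (u n)"
      using L2_norm_triangle[OF L2_space_diff[OF v admissible_L2[OF u]] admissible_L2[OF u], of n n] by simp
    ultimately show "norm (L2_norm T (u n) - L2_norm T v) \<le> L2_norm T (\<lambda>t. u n t - v t)"
      using L2_norm_minus_commute[of T v "u n"] by simp
  qed
  then have "(\<lambda>n. J (u n)) \<longlonglongrightarrow> J v"
    unfolding J_def by (intro tendsto_intros S_tendsto u \<open>v \<in> U\<close> lim)
  moreover have "(\<lambda>n. m + (1 / 4) ^ n) \<longlonglongrightarrow> m + 0"
    by (intro tendsto_add tendsto_const LIMSEQ_power_zero) simp
  moreover have "\<exists>N. \<forall>n\<ge>N. J (u n) \<le> m + (1 / 4) ^ n"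
    using J_le less_imp_le by blast
  ultimately have "J v \<le> m + 0"
    by (rule LIMSEQ_le)
  then show ?thesis
    using \<open>v \<in> U\<close> m_le by (force simp: minimizer_def)
qed

end

section \<open>Resolvents on the closed sector\<close>

lemma bounded_clinear_imp_bounded_linear: "bounded_clinear f \<Longrightarrow> bounded_linear f"
  by (simp add: bounded_clinear_def)

lemma bounded_clinear_scaleC: "bounded_clinear f \<Longrightarrow> f (c *\<^sub>C x) = c *\<^sub>C f x"
  by (simp add: bounded_clinear_def)

text \<open>The sector with its boundary rays: if \<open>\<alpha> = 1\<close> the contour is made of them, although the resolvent
  estimates are only assumed in the interior.\<close>

definition closed_sector :: "real \<Rightarrow> complex set" where
  "closed_sector \<omega> = {rcis r \<gamma> | r \<gamma>. 0 < r \<and> - \<omega> \<le> \<gamma> \<and> \<gamma> \<le> \<omega>}"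

lemma cnj_closed_sector: "z \<in> closed_sector \<omega> \<Longrightarrow> cnj z \<in> closed_sector \<omega>"
  unfolding closed_sector_def
proof clarify
  fix r \<gamma> :: real assume "0 < r" "- \<omega> \<le> \<gamma>" "\<gamma> \<le> \<omega>"
  then show "\<exists>r' \<gamma>'. cnj (rcis r \<gamma>) = rcis r' \<gamma>' \<and> 0 < r' \<and> - \<omega> \<le> \<gamma>' \<and> \<gamma>' \<le> \<omega>"
    by (intro exI[of _ r] exI[of _ "- \<gamma>"]) (simp add: complex_eq_iff rcis_def)
qed

lemma closed_sector_sequence:
  assumes "z \<in> closed_sector \<omega>" "0 < \<omega>"
  shows "\<exists>f :: nat \<Rightarrow> complex. (\<forall>n. f n \<in> sector \<omega>) \<and> f \<longlonglongrightarrow> z"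
proof -
  obtain r \<gamma> where z: "z = rcis r \<gamma>" "0 < r" "\<bar>\<gamma>\<bar> \<le> \<omega>"
    using assms(1) unfolding closed_sector_def by fastforce
  define q where "q n = 1 - inverse (real (Suc n))" for n
  have q: "0 \<le> q n" "q n < 1" for n
    unfolding q_def by (auto simp: field_simps)
  have lim: "q \<longlonglongrightarrow> 1 - 0"
    unfolding q_def by (intro tendsto_diff tendsto_const LIMSEQ_inverse_real_of_nat)
  show ?thesis
  proof (intro exI conjI allI)
    fix n
    have "\<bar>q n * \<gamma>\<bar> \<le> q n * \<omega>"
      using q[of n] z(3) by (simp add: abs_mult mult_left_mono)
    also have "\<dots> < 1 * \<omega>"
      using q[of n] \<open>0 < \<omega>\<close> by (intro mult_strict_right_mono) auto
    finally show "rcis r (q n * \<gamma>) \<in> sector \<omega>"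
      using z(2) unfolding sector_def by (intro CollectI exI[of _ r] exI[of _ "q n * \<gamma>"]) auto
  next
    have "(\<lambda>n. of_real r * exp (\<i> * of_real (q n * \<gamma>))) \<longlonglongrightarrow> of_real r * exp (\<i> * of_real ((1 - 0) * \<gamma>))"
      by (intro tendsto_intros lim)
    then show "(\<lambda>n. rcis r (q n * \<gamma>)) \<longlonglongrightarrow> z"
      by (simp add: z(1) rcis_def cis_conv_exp)
  qed
qed

lemma of_nat_in_sector: "0 < n \<Longrightarrow> 0 < \<omega> \<Longrightarrow> of_nat n \<in> sector \<omega>"
  unfolding sector_def by (intro CollectI exI[of _ "real n"] exI[of _ 0]) (auto simp: rcis_def)

text \<open>One half of a sectorial pair, so that what follows applies to \<open>A\<close> as well as to \<open>Astar\<close>.\<close>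

locale sectorial_operator =
  fixes \<iota> B :: "'x::complex_hilbert \<Rightarrow> 'y::complex_hilbert"
    and \<omega> c\<^sub>0 c\<^sub>1 M\<^sub>0 :: real
  assumes embedding: "bounded_clinear \<iota>" "inj \<iota>" "closure (range \<iota>) = UNIV"
    and bounded_B: "bounded_clinear B"
    and constants: "0 < \<omega>" "0 < c\<^sub>0" "0 < c\<^sub>1" "0 < M\<^sub>0"
    and resolvent_set_B: "sector \<omega> \<subseteq> resolvent_set \<iota> B"
    and resolvent_B: "z \<in> sector \<omega> \<Longrightarrow> onorm (resolvent \<iota> B z) \<le> M\<^sub>0 / (1 + cmod z)"
    and norm_B: "c\<^sub>0 * norm v \<le> norm (B v)" "norm (B v) \<le> c\<^sub>1 * norm v"
begin

sublocale emb: bounded_linear \<iota>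
  by (rule bounded_clinear_imp_bounded_linear[OF embedding(1)])

sublocale op: bounded_linear B
  by (rule bounded_clinear_imp_bounded_linear[OF bounded_B])

definition shift :: "complex \<Rightarrow> 'x \<Rightarrow> 'y" where
  "shift z x = z *\<^sub>C \<iota> x - B x"

lemma shift_add: "shift z (x + y) = shift z x + shift z y"
  by (simp add: shift_def emb.add op.add scaleC_add_right)

lemma shift_scaleC: "shift z (c *\<^sub>C x) = c *\<^sub>C shift z x"
  by (simp add: shift_def bounded_clinear_scaleC[OF embedding(1)] bounded_clinear_scaleC[OF bounded_B]
      scaleC.diff_right scaleC_scaleC mult.commute)

lemma shift_diff: "shift z (x - y) = shift z x - shift z y"
  by (simp add: shift_def emb.diff op.diff scaleC.diff_right)

lemma bij_shift_sector: "z \<in> sector \<omega> \<Longrightarrow> bij (shift z)"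
  using resolvent_set_B by (auto simp: resolvent_set_def shift_def[abs_def])

lemma bound_le_M0: "M\<^sub>0 / (1 + cmod z) \<le> M\<^sub>0"
proof -
  have "M\<^sub>0 / (1 + cmod z) \<le> M\<^sub>0 / 1"
    using constants by (intro divide_left_mono) (auto intro!: add_pos_nonneg)
  then show ?thesis by simp
qed

lemma norm_embedding_le_sector:
  assumes z: "z \<in> sector \<omega>"
  shows "norm (\<iota> x) \<le> M\<^sub>0 / (1 + cmod z) * norm (shift z x)"
proof -
  have "bounded_linear (resolvent \<iota> B z)"
    using resolvent_set_B z by (auto simp: resolvent_set_def)
  then have "norm (resolvent \<iota> B z (shift z x)) \<le> onorm (resolvent \<iota> B z) * norm (shift z x)"
    by (rule onorm)
  also have "\<dots> \<le> M\<^sub>0 / (1 + cmod z) * norm (shift z x)"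
    by (intro mult_right_mono resolvent_B z) simp
  also have "resolvent \<iota> B z (shift z x) = \<iota> x"
    using bij_shift_sector[OF z] unfolding resolvent_def shift_def[symmetric]
    by (simp add: inv_f_f bij_is_inj)
  finally show ?thesis .
qed

text \<open>The estimate of the resolvent in the sector, written as an a priori estimate, passes to the
  boundary by continuity.\<close>

lemma norm_embedding_le:
  assumes "z \<in> closed_sector \<omega>"
  shows "norm (\<iota> x) \<le> M\<^sub>0 / (1 + cmod z) * norm (shift z x)"
proof -
  obtain f where f: "\<And>n::nat. f n \<in> sector \<omega>" and lim: "f \<longlonglongrightarrow> z"
    using closed_sector_sequence[OF assms constants(1)] by blast
  have nz: "1 + cmod z \<noteq> 0"
    using norm_ge_zero[of z] by linarith
  have "(\<lambda>n. M\<^sub>0 / (1 + cmod (f n)) * norm (shift (f n) x)) \<longlonglongrightarrow> M\<^sub>0 / (1 + cmod z) * norm (shift z x)"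
    unfolding shift_def by (intro tendsto_intros scaleC.tendsto lim nz)
  then show ?thesis
    using norm_embedding_le_sector[OF f] by (intro LIMSEQ_le_const) auto
qed

text \<open>On the boundary rays of the sector solvability is inherited from the interior: the equation
  is a fixed point problem for a contraction if the interior point is close enough.\<close>

lemma bij_shift:
  assumes z: "z \<in> closed_sector \<omega>"
  shows "bij (shift z)"
proof (rule bijI)
  show "inj (shift z)"
  proof (rule injI)
    fix x y assume eq: "shift z x = shift z y"
    obtain f where f: "\<And>n::nat. f n \<in> sector \<omega>" and lim: "f \<longlonglongrightarrow> z"
      using closed_sector_sequence[OF z constants(1)] by blast
    have "\<iota> (x - y) = 0"
      using norm_embedding_le[OF z, of "x - y"] eq by (simp add: shift_diff)
    then have "shift (f 0) x = shift (f 0) y"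
      using eq by (simp add: shift_def emb.diff)
    then show "x = y"
      using bij_shift_sector[OF f] by (auto simp: bij_def inj_def)
  qed
  show "surj (shift z)"
  proof (rule surjI[of _ "\<lambda>y. SOME x. shift z x = y"])
    fix y
    obtain f where f: "\<And>n::nat. f n \<in> sector \<omega>" and lim: "f \<longlonglongrightarrow> z"
      using closed_sector_sequence[OF z constants(1)] by blast
    have "\<forall>\<^sub>F n in sequentially. dist (f n) z < 1 / (2 * M\<^sub>0)"
      using constants by (intro tendstoD[OF lim]) auto
    then obtain n where n: "dist (f n) z < 1 / (2 * M\<^sub>0)"
      by (auto simp: eventually_sequentially)
    define w where "w = f n"
    have w: "w \<in> sector \<omega>" and close: "cmod (z - w) * M\<^sub>0 \<le> 1 / 2"
      using n constants f[of n] by (auto simp: w_def dist_norm norm_minus_commute field_simps)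
    have bij: "bij (shift w)"
      by (rule bij_shift_sector[OF w])
    have inv: "shift w (inv (shift w) v) = v" for v
      using bij by (simp add: bij_is_surj surj_f_inv_f)
    define \<Phi> where "\<Phi> v = \<iota> (inv (shift w) (y - (z - w) *\<^sub>C v))" for v
    have "\<exists>!v. \<Phi> v = v"
    proof (rule banach_fix_type[of "1 / 2"], simp, simp, intro allI)
      fix v v' :: 'y
      let ?x = "inv (shift w) (y - (z - w) *\<^sub>C v)" and ?x' = "inv (shift w) (y - (z - w) *\<^sub>C v')"
      have "dist (\<Phi> v) (\<Phi> v') = norm (\<iota> (?x - ?x'))"
        by (simp add: \<Phi>_def dist_norm emb.diff)
      also have "\<dots> \<le> M\<^sub>0 / (1 + cmod w) * norm (shift w (?x - ?x'))"
        by (rule norm_embedding_le_sector[OF w])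
      also have "shift w (?x - ?x') = (z - w) *\<^sub>C (v' - v)"
        by (simp add: shift_diff inv scaleC.diff_right)
      also have "M\<^sub>0 / (1 + cmod w) * norm ((z - w) *\<^sub>C (v' - v)) \<le> M\<^sub>0 * norm ((z - w) *\<^sub>C (v' - v))"
        by (intro mult_right_mono bound_le_M0) simp
      also have "\<dots> = cmod (z - w) * M\<^sub>0 * norm (v' - v)"
        by (simp add: norm_scaleC)
      also have "\<dots> \<le> 1 / 2 * norm (v' - v)"
        by (intro mult_right_mono close) simp
      finally show "dist (\<Phi> v) (\<Phi> v') \<le> 1 / 2 * dist v v'"
        by (simp add: dist_norm norm_minus_commute)
    qed
    then obtain v where v: "\<Phi> v = v" by blast
    define x where "x = inv (shift w) (y - (z - w) *\<^sub>C v)"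
    have "\<iota> x = v" and "shift w x = y - (z - w) *\<^sub>C v"
      using v inv by (auto simp: \<Phi>_def x_def)
    then have "shift z x = y"
      by (auto simp: shift_def scaleC.diff_left algebra_simps)
    then show "shift z (SOME x. shift z x = y) = y"
      by (rule someI)
  qed
qed

text \<open>Unlike for \<open>resolvent\<close>, the value stays in \<open>X\<close>, whose norm is needed as well.\<close>

definition Res :: "complex \<Rightarrow> 'y \<Rightarrow> 'x" where
  "Res z y = inv (shift z) y"

context
  fixes z assumes z: "z \<in> closed_sector \<omega>"
begin

lemma shift_Res: "shift z (Res z y) = y"
  using bij_shift[OF z] by (simp add: Res_def bij_is_surj surj_f_inv_f)

lemma Res_shift: "Res z (shift z x) = x"
  using bij_shift[OF z] by (simp add: Res_def bij_is_inj)

lemma Res_eqI: "shift z x = y \<Longrightarrow> Res z y = x"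
  using Res_shift by auto

lemma Res_add: "Res z (x + y) = Res z x + Res z y"
  by (rule Res_eqI) (simp add: shift_add shift_Res)

lemma Res_scaleC: "Res z (c *\<^sub>C y) = c *\<^sub>C Res z y"
  by (rule Res_eqI) (simp add: shift_scaleC shift_Res)

lemma norm_embedding_Res: "norm (\<iota> (Res z y)) \<le> M\<^sub>0 / (1 + cmod z) * norm y"
  using norm_embedding_le[OF z, of "Res z y"] by (simp add: shift_Res)

text \<open>The norm of \<open>x\<close> in \<open>X\<close> is equivalent to that of \<open>B x\<close> in \<open>Y\<close>, and \<open>B R(z, B) = z R(z, B) - 1\<close> is bounded on \<open>Y\<close>
  uniformly in \<open>z\<close>.\<close>

lemma norm_Res: "norm (Res z y) \<le> (1 + M\<^sub>0) / c\<^sub>0 * norm y"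
proof -
  have "B (Res z y) = z *\<^sub>C \<iota> (Res z y) - y"
    using shift_Res[of y] by (simp add: shift_def algebra_simps)
  then have "c\<^sub>0 * norm (Res z y) \<le> norm (z *\<^sub>C \<iota> (Res z y)) + norm y"
    using norm_B(1)[of "Res z y"] norm_triangle_ineq4[of "z *\<^sub>C \<iota> (Res z y)" y] by simp
  also have "\<dots> \<le> cmod z * (M\<^sub>0 / (1 + cmod z) * norm y) + norm y"
    unfolding norm_scaleC by (intro add_mono mult_left_mono norm_embedding_Res) auto
  also have "\<dots> = cmod z / (1 + cmod z) * (M\<^sub>0 * norm y) + norm y"
    by simp
  also have "\<dots> \<le> 1 * (M\<^sub>0 * norm y) + norm y"
    using constants by (intro add_mono mult_right_mono) (auto simp: divide_le_eq_1 add_pos_nonneg)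
  finally show ?thesis
    using constants by (simp add: field_simps)
qed

lemma bounded_linear_Res: "bounded_linear (Res z)"
  using norm_Res
  by (intro bounded_linear_intro[where K = "(1 + M\<^sub>0) / c\<^sub>0"])
     (auto simp: Res_add Res_scaleC scaleR_scaleC mult.commute)

end

lemma dist_Res_le:
  assumes z: "z \<in> closed_sector \<omega>" and w: "w \<in> closed_sector \<omega>"
  shows "dist (Res z y) (Res w y) \<le> (1 + M\<^sub>0) / c\<^sub>0 * M\<^sub>0 * dist z w * norm y"
proof -
  have "shift z (Res w y) = shift w (Res w y) + (z - w) *\<^sub>C \<iota> (Res w y)"
    by (simp add: shift_def scaleC.diff_left)
  then have "shift z (Res z y - Res w y) = (w - z) *\<^sub>C \<iota> (Res w y)"
    by (simp add: shift_diff shift_Res z w scaleC.diff_left)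
  then have "Res z y - Res w y = Res z ((w - z) *\<^sub>C \<iota> (Res w y))"
    using Res_shift[OF z] by metis
  then have "dist (Res z y) (Res w y) \<le> (1 + M\<^sub>0) / c\<^sub>0 * (cmod (w - z) * norm (\<iota> (Res w y)))"
    using norm_Res[OF z] by (simp add: dist_norm norm_scaleC flip: norm_scaleC)
  also have "\<dots> \<le> (1 + M\<^sub>0) / c\<^sub>0 * (cmod (w - z) * (M\<^sub>0 * norm y))"
  proof (intro mult_left_mono)
    have "norm (\<iota> (Res w y)) \<le> M\<^sub>0 / (1 + cmod w) * norm y"
      by (rule norm_embedding_Res[OF w])
    also have "\<dots> \<le> M\<^sub>0 * norm y"
      by (intro mult_right_mono bound_le_M0) simp
    finally show "norm (\<iota> (Res w y)) \<le> M\<^sub>0 * norm y" .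
  qed (use constants in auto)
  finally show ?thesis
    by (simp add: dist_norm norm_minus_commute mult_ac)
qed

lemma continuous_on_Res: "continuous_on (closed_sector \<omega>) (\<lambda>z. Res z y)"
proof (rule lipschitz_on_continuous_on[OF lipschitz_onI])
  fix z w assume "z \<in> closed_sector \<omega>" "w \<in> closed_sector \<omega>"
  from dist_Res_le[OF this, of y]
  show "dist (Res z y) (Res w y) \<le> ((1 + M\<^sub>0) / c\<^sub>0 * M\<^sub>0 * norm y) * dist z w"
    by (simp add: mult_ac)
qed (use constants in auto)

lemma norm_scaled_embedding_Res:
  assumes "z \<in> closed_sector \<omega>"
  shows "norm (z *\<^sub>C \<iota> (Res z y)) \<le> M\<^sub>0 * norm y"
proof -
  have "norm (z *\<^sub>C \<iota> (Res z y)) \<le> cmod z * (M\<^sub>0 / (1 + cmod z) * norm y)"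
    unfolding norm_scaleC by (intro mult_left_mono norm_embedding_Res assms) auto
  also have "\<dots> = cmod z / (1 + cmod z) * (M\<^sub>0 * norm y)"
    by simp
  also have "\<dots> \<le> 1 * (M\<^sub>0 * norm y)"
    using constants by (intro mult_right_mono) (auto simp: divide_le_eq_1 add_pos_nonneg)
  finally show ?thesis by simp
qed

lemma scaled_Res_embedding:
  assumes "z \<in> closed_sector \<omega>"
  shows "z *\<^sub>C Res z (\<iota> x) = x + Res z (B x)"
proof -
  have "x + Res z (B x) = Res z (shift z x + B x)"
    by (simp add: Res_add Res_shift assms)
  also have "\<dots> = z *\<^sub>C Res z (\<iota> x)"
    by (simp add: shift_def Res_scaleC assms)
  finally show ?thesis ..
qed

lemma op_Res: "z \<in> closed_sector \<omega> \<Longrightarrow> B (Res z y) = z *\<^sub>C \<iota> (Res z y) - y"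
  using shift_Res[of z y] by (simp add: shift_def algebra_simps)

lemma norm_scaled_Res_embedding:
  assumes "z \<in> closed_sector \<omega>"
  shows "norm (z *\<^sub>C Res z (\<iota> x)) \<le> M\<^sub>0 * c\<^sub>1 / c\<^sub>0 * norm x"
proof -
  have "c\<^sub>0 * norm (z *\<^sub>C Res z (\<iota> x)) \<le> norm (B (z *\<^sub>C Res z (\<iota> x)))"
    by (rule norm_B)
  also have "B (z *\<^sub>C Res z (\<iota> x)) = z *\<^sub>C \<iota> (Res z (B x))"
    by (simp add: scaled_Res_embedding op_Res assms op.add)
  also have "norm \<dots> \<le> M\<^sub>0 * norm (B x)"
    by (rule norm_scaled_embedding_Res[OF assms])
  also have "\<dots> \<le> M\<^sub>0 * (c\<^sub>1 * norm x)"
    using constants by (intro mult_left_mono norm_B) auto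
  finally show ?thesis
    using constants by (simp add: field_simps)
qed

lemma sector_subset_closed: "sector \<omega> \<subseteq> closed_sector \<omega>"
  unfolding sector_def closed_sector_def by (auto intro: less_imp_le)

text \<open>The operators \<open>n R(n, B)\<close> are smoothing approximations of the identity, in both norms.
  The index is shifted because \<open>0\<close> is not in the sector.\<close>

definition regularize :: "nat \<Rightarrow> 'y \<Rightarrow> 'x" where
  "regularize n y = of_nat (Suc n) *\<^sub>C Res (of_nat (Suc n)) y"

lemma Suc_in_closed_sector: "of_nat (Suc n) \<in> closed_sector \<omega>"
  using of_nat_in_sector[of "Suc n" \<omega>] constants sector_subset_closed by blast

lemma norm_embedding_regularize: "norm (\<iota> (regularize n y)) \<le> M\<^sub>0 * norm y"
  using norm_scaled_embedding_Res[OF Suc_in_closed_sector[of n], of y]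
  by (simp add: regularize_def bounded_clinear_scaleC[OF embedding(1)])

lemma norm_regularize_embedding: "norm (regularize n (\<iota> x)) \<le> M\<^sub>0 * c\<^sub>1 / c\<^sub>0 * norm x"
  using norm_scaled_Res_embedding[OF Suc_in_closed_sector[of n], of x]
  by (simp add: regularize_def)

lemma bounded_linear_regularize: "bounded_linear (regularize n)"
  unfolding regularize_def
  by (rule bounded_linear_compose[OF scaleC.bounded_linear_right bounded_linear_Res])
     (rule Suc_in_closed_sector)

lemma regularize_scaleC: "regularize n (c *\<^sub>C y) = c *\<^sub>C regularize n y"
  by (simp add: regularize_def Res_scaleC Suc_in_closed_sector scaleC_scaleC mult.commute[of c] del: of_nat_Suc)

text \<open>On the range of \<open>\<iota>\<close> the error is \<open>R(n, B) B x\<close>, which is of order \<open>1 / n\<close>; the uniform bound and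
  density extend the convergence to \<open>Y\<close>.\<close>

lemma embedding_regularize_tendsto: "(\<lambda>n. \<iota> (regularize n y)) \<longlonglongrightarrow> y"
proof (rule metric_LIMSEQ_I)
  fix e :: real assume "0 < e"
  define d where "d = e / (2 * (M\<^sub>0 + 1))"
  have d: "0 < d" "(M\<^sub>0 + 1) * d = e / 2"
    using constants \<open>0 < e\<close> by (auto simp: d_def field_simps)
  have "y \<in> closure (range \<iota>)"
    by (simp add: embedding)
  then obtain x where "dist (\<iota> x) y < d"
    using d(1) unfolding closure_approachable by blast
  then have x: "norm (y - \<iota> x) < d"
    by (simp add: dist_norm norm_minus_commute)
  have "(\<lambda>n. M\<^sub>0 * norm (B x) * inverse (real (Suc n))) \<longlonglongrightarrow> M\<^sub>0 * norm (B x) * 0"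
    by (intro tendsto_mult tendsto_const LIMSEQ_inverse_real_of_nat)
  then have "\<forall>\<^sub>F n in sequentially. M\<^sub>0 * norm (B x) * inverse (real (Suc n)) < e / 2"
    using \<open>0 < e\<close> by (intro order_tendstoD(2)) auto
  then obtain N where N: "\<And>n. n \<ge> N \<Longrightarrow> M\<^sub>0 * norm (B x) * inverse (real (Suc n)) < e / 2"
    by (auto simp: eventually_sequentially)
  show "\<exists>N. \<forall>n\<ge>N. dist (\<iota> (regularize n y)) y < e"
  proof (intro exI allI impI)
    fix n assume "N \<le> n"
    interpret reg: bounded_linear "regularize n"
      by (rule bounded_linear_regularize)
    have "regularize n (\<iota> x) - x = Res (of_nat (Suc n)) (B x)"
      unfolding regularize_def by (subst scaled_Res_embedding) (simp_all add: Suc_in_closed_sector del: of_nat_Suc)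
    then have "norm (\<iota> (regularize n (\<iota> x) - x)) \<le> M\<^sub>0 / (1 + cmod (of_nat (Suc n))) * norm (B x)"
      using norm_embedding_Res[OF Suc_in_closed_sector] by simp
    also have "\<dots> \<le> M\<^sub>0 / real (Suc n) * norm (B x)"
      using constants by (intro mult_right_mono divide_left_mono) (auto simp del: of_nat_Suc)
    also have "\<dots> < e / 2"
      using N[OF \<open>N \<le> n\<close>] by (simp add: field_simps)
    finally have 1: "norm (\<iota> (regularize n (\<iota> x) - x)) < e / 2" .
    have 2: "norm (\<iota> (regularize n (y - \<iota> x))) \<le> M\<^sub>0 * d"
      using norm_embedding_regularize[of n "y - \<iota> x"] x constants
      by (smt (verit) mult_left_mono)
    have eq: "\<iota> (regularize n y) - y
        = \<iota> (regularize n (y - \<iota> x)) + \<iota> (regularize n (\<iota> x) - x) - (y - \<iota> x)"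
      by (simp add: reg.diff emb.diff)
    have "norm (\<iota> (regularize n y) - y)
        \<le> norm (\<iota> (regularize n (y - \<iota> x))) + norm (\<iota> (regularize n (\<iota> x) - x)) + norm (y - \<iota> x)"
      using norm_triangle_ineq4[of "\<iota> (regularize n (y - \<iota> x)) + \<iota> (regularize n (\<iota> x) - x)" "y - \<iota> x"]
        norm_triangle_ineq[of "\<iota> (regularize n (y - \<iota> x))" "\<iota> (regularize n (\<iota> x) - x)"]
      unfolding eq by linarith
    also have "\<dots> < M\<^sub>0 * d + e / 2 + d"
      using 1 2 x by simp
    finally show "dist (\<iota> (regularize n y)) y < e"
      using d(2) by (simp add: dist_norm algebra_simps)
  qed
qed

text \<open>\<open>B\<close> commutes with its resolvent, so the convergence in \<open>X\<close> reduces to that of the images under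
  \<open>B\<close> in \<open>Y\<close>.\<close>

lemma regularize_embedding_tendsto: "(\<lambda>n. regularize n (\<iota> x)) \<longlonglongrightarrow> x"
proof (rule LIM_zero_cancel, rule Lim_null_comparison[where g = "\<lambda>n. norm (\<iota> (regularize n (B x)) - B x) / c\<^sub>0"])
  have "norm (regularize n (\<iota> x) - x) \<le> norm (\<iota> (regularize n (B x)) - B x) / c\<^sub>0" for n
  proof -
    have "regularize n (\<iota> x) - x = Res (of_nat (Suc n)) (B x)"
      unfolding regularize_def by (subst scaled_Res_embedding) (simp_all add: Suc_in_closed_sector del: of_nat_Suc)
    then have "B (regularize n (\<iota> x) - x) = \<iota> (regularize n (B x)) - B x"
      by (simp add: op_Res Suc_in_closed_sector regularize_def bounded_clinear_scaleC[OF embedding(1)] del: of_nat_Suc)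
    then show ?thesis
      using norm_B(1)[of "regularize n (\<iota> x) - x"] constants by (simp add: pos_le_divide_eq mult.commute)
  qed
  then show "\<forall>\<^sub>F n in sequentially. norm (regularize n (\<iota> x) - x) \<le> norm (\<iota> (regularize n (B x)) - B x) / c\<^sub>0"
    by simp
  have "(\<lambda>n. norm (\<iota> (regularize n (B x)) - B x) / c\<^sub>0) \<longlonglongrightarrow> norm (B x - B x) / c\<^sub>0"
    using constants by (intro tendsto_intros embedding_regularize_tendsto) auto
  then show "(\<lambda>n. norm (\<iota> (regularize n (B x)) - B x) / c\<^sub>0) \<longlonglongrightarrow> 0"
    by simp
qed

end

section \<open>Estimates by complex interpolation\<close>

lemma calderon_norm_ge:
  assumes "f \<in> calderon_space e0 e1"
  shows "norm (inv e0 (f (Complex 0 t))) \<le> calderon_norm e0 e1 f"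
    and "norm (inv e1 (f (Complex 1 t))) \<le> calderon_norm e0 e1 f"
proof -
  have bdd: "bdd_above (range (\<lambda>t. norm (g t)))" if b: "bounded (range g)"
    for g :: "real \<Rightarrow> 'z::real_normed_vector"
  proof -
    obtain K where "\<And>t. norm (g t) \<le> K"
      using b by (auto simp: bounded_iff)
    then show ?thesis
      by (intro bdd_aboveI2[where M = K]) auto
  qed
  have "norm (inv e0 (f (Complex 0 t))) \<le> (SUP t. norm (inv e0 (f (Complex 0 t))))"
    using assms by (intro cSUP_upper bdd) (auto simp: calderon_space_def)
  then show "norm (inv e0 (f (Complex 0 t))) \<le> calderon_norm e0 e1 f"
    by (simp add: calderon_norm_def)
  have "norm (inv e1 (f (Complex 1 t))) \<le> (SUP t. norm (inv e1 (f (Complex 1 t))))"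
    using assms by (intro cSUP_upper bdd) (auto simp: calderon_space_def)
  then show "norm (inv e1 (f (Complex 1 t))) \<le> calderon_norm e0 e1 f"
    by (simp add: calderon_norm_def)
qed

lemma calderon_norm_nonneg: "f \<in> calderon_space e0 e1 \<Longrightarrow> 0 \<le> calderon_norm e0 e1 f"
  using calderon_norm_ge(1) norm_ge_zero order_trans by blast

lemma interp_norm_nonneg:
  assumes "v \<in> interp_space e0 e1 \<theta>"
  shows "0 \<le> interp_norm e0 e1 \<theta> v"
proof (cases "\<theta> = 0 \<or> \<theta> = 1")
  case False
  then have "{calderon_norm e0 e1 f |f. f \<in> calderon_space e0 e1 \<and> f (complex_of_real \<theta>) = v} \<noteq> {}"
    using assms by (auto simp: interp_space_def)
  then have "0 \<le> Inf {calderon_norm e0 e1 f |f. f \<in> calderon_space e0 e1 \<and> f (complex_of_real \<theta>) = v}"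
    by (intro cInf_greatest) (auto intro: calderon_norm_nonneg)
  then show ?thesis
    using False by (simp add: interp_norm_def)
qed (auto simp: interp_norm_def)

lemma le_interp_normI:
  assumes v: "v \<in> interp_space e0 e1 \<theta>" and \<theta>: "0 < \<theta>" "\<theta> < 1" and "0 \<le> C"
    and le: "\<And>f. f \<in> calderon_space e0 e1 \<Longrightarrow> f (complex_of_real \<theta>) = v \<Longrightarrow> L \<le> calderon_norm e0 e1 f * C"
  shows "L \<le> interp_norm e0 e1 \<theta> v * C"
proof (cases "C = 0")
  case True
  obtain f where "f \<in> calderon_space e0 e1" "f (complex_of_real \<theta>) = v"
    using v \<theta> by (auto simp: interp_space_def)
  from le[OF this] True show ?thesis by simp
next
  case False
  then have "0 < C" using \<open>0 \<le> C\<close> by simp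
  have "{calderon_norm e0 e1 f |f. f \<in> calderon_space e0 e1 \<and> f (complex_of_real \<theta>) = v} \<noteq> {}"
    using v \<theta> by (auto simp: interp_space_def)
  then have "L / C \<le> Inf {calderon_norm e0 e1 f |f. f \<in> calderon_space e0 e1 \<and> f (complex_of_real \<theta>) = v}"
    using le \<open>0 < C\<close> by (intro cInf_greatest) (auto simp: pos_divide_le_eq)
  then show ?thesis
    using \<theta> \<open>0 < C\<close> by (simp add: interp_norm_def pos_divide_le_eq)
qed

text \<open>The pairing is antilinear in its second argument, so it is holomorphic along a holomorphic
  curve of functionals and an antiholomorphic curve of vectors.\<close>

lemma pairing_has_field_derivative:
  assumes F: "((\<lambda>h. inverse h *\<^sub>C (F (z + h) - F z)) \<longlongrightarrow> D) (at 0)"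
    and H: "((\<lambda>h. inverse (cnj h) *\<^sub>C (H (z + h) - H z)) \<longlongrightarrow> D') (at 0)"
  shows "((\<lambda>z. pairing (F z) (H z)) has_field_derivative (pairing D (H z) + pairing (F z) D')) (at z)"
proof -
  have ne: "\<forall>\<^sub>F h in at (0::complex). h \<noteq> 0"
    by (simp add: eventually_at_filter)
  have "((\<lambda>h. H z + cnj h *\<^sub>C (inverse (cnj h) *\<^sub>C (H (z + h) - H z))) \<longlongrightarrow> H z + cnj 0 *\<^sub>C D') (at 0)"
    by (intro tendsto_intros scaleC.tendsto H)
  moreover have "\<forall>\<^sub>F h in at 0. H z + cnj h *\<^sub>C (inverse (cnj h) *\<^sub>C (H (z + h) - H z)) = H (z + h)"
    using ne by eventually_elim (simp add: scaleC_scaleC)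
  ultimately have "((\<lambda>h. H (z + h)) \<longlongrightarrow> H z) (at 0)"
    using tendsto_cong by (force simp: scaleC.zero_left)
  then have "((\<lambda>h. pairing (inverse h *\<^sub>C (F (z + h) - F z)) (H (z + h))
      + pairing (F z) (inverse (cnj h) *\<^sub>C (H (z + h) - H z))) \<longlongrightarrow>
      pairing D (H z) + pairing (F z) D') (at 0)"
    by (intro tendsto_add pairing.tendsto F H tendsto_const)
  moreover have "pairing (inverse h *\<^sub>C (F (z + h) - F z)) (H (z + h))
      + pairing (F z) (inverse (cnj h) *\<^sub>C (H (z + h) - H z))
      = (pairing (F (z + h)) (H (z + h)) - pairing (F z) (H z)) / h" for h
    by (simp add: pairing_scaleC_left pairing_scaleC_right pairing.diff_left pairing.diff_right
        divide_inverse algebra_simps)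
  ultimately show ?thesis
    by (simp add: DERIV_def)
qed

context sectorial_operator
begin

lemma dual_curve_holomorphic:
  assumes F: "F \<in> calderon_space id (dual_op \<iota>)"
    and H: "\<And>z. 0 < Re z \<Longrightarrow> Re z < 1 \<Longrightarrow>
      \<exists>D'. ((\<lambda>h. inverse (cnj h) *\<^sub>C (H (z + h) - H z)) \<longlongrightarrow> D') (at 0)"
  shows "(\<lambda>z. pairing (F z) (H z)) holomorphic_on {z. 0 < Re z \<and> Re z < 1}"
  unfolding holomorphic_on_def
proof
  fix z :: complex assume "z \<in> {z. 0 < Re z \<and> Re z < 1}"
  then obtain D D' where "((\<lambda>h. inverse h *\<^sub>C (F (z + h) - F z)) \<longlongrightarrow> D) (at 0)"
    "((\<lambda>h. inverse (cnj h) *\<^sub>C (H (z + h) - H z)) \<longlongrightarrow> D') (at 0)"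
    using F H[of z] unfolding calderon_space_def by blast
  from pairing_has_field_derivative[OF this]
  show "(\<lambda>z. pairing (F z) (H z)) field_differentiable at z within {z. 0 < Re z \<and> Re z < 1}"
    unfolding field_differentiable_def using has_field_derivative_at_within by blast
qed

text \<open>The weight \<open>a\<^sup>z\<close> balances the two endpoint norms of the vector.\<close>

lemma cmod_pairing_le_interp:
  assumes \<phi>: "\<phi> \<in> dual_interp_space \<iota> \<theta>" and \<theta>: "0 < \<theta>" "\<theta> \<le> 1" and a: "0 < a"
  shows "a powr \<theta> * cmod (pairing \<phi> x) \<le> dual_interp_norm \<iota> \<theta> \<phi> * max (norm x) (a * norm (\<iota> x))"
proof (cases "\<theta> = 1")
  case True
  then obtain f where f: "\<phi> = dual_op \<iota> f" "norm f = dual_interp_norm \<iota> \<theta> \<phi>"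
    using \<phi> by (auto simp: interp_space_def interp_norm_def f_inv_into_f intro: that[of "inv (dual_op \<iota>) \<phi>"])
  have "a powr \<theta> * cmod (pairing \<phi> x) = a * cmod (cinner f (\<iota> x))"
    using True a by (simp add: f(1) pairing_dual_op[OF embedding(1)])
  also have "\<dots> \<le> a * (norm f * norm (\<iota> x))"
    using a by (intro mult_left_mono cinner_norm_le) auto
  also have "\<dots> = norm f * (a * norm (\<iota> x))"
    by simp
  also have "\<dots> \<le> norm f * max (norm x) (a * norm (\<iota> x))"
    by (intro mult_left_mono) auto
  finally show ?thesis
    by (simp add: f(2))
next
  case False
  then have "\<theta> < 1" using \<theta> by simp
  show ?thesis
  proof (rule le_interp_normI[OF \<phi> \<theta>(1) \<open>\<theta> < 1\<close>])
    fix F assume F: "F \<in> calderon_space id (dual_op \<iota>)" and F\<theta>: "F (complex_of_real \<theta>) = \<phi>"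
    let ?N = "calderon_norm id (dual_op \<iota>) F" and ?m = "max (norm x) (a * norm (\<iota> x))"
    define h where "h z = exp (of_real (ln a) * z) * pairing (F z) x" for z
    have "cmod (h (complex_of_real \<theta>)) \<le> ?N * ?m"
    proof (rule strip_maximum_principle[of h])
      show "continuous_on {z. 0 \<le> Re z \<and> Re z \<le> 1} h"
        unfolding h_def using F
        by (auto simp: calderon_space_def intro!: continuous_intros pairing.continuous_on)
      have "\<exists>D'. ((\<lambda>h. inverse (cnj h) *\<^sub>C (x - x)) \<longlongrightarrow> D') (at 0)"
        by (intro exI[of _ 0]) (simp add: scaleC.zero_right)
      then show "h holomorphic_on {z. 0 < Re z \<and> Re z < 1}"
        unfolding h_def by (intro holomorphic_intros dual_curve_holomorphic[OF F]) blast
      obtain b where b: "\<And>z. 0 \<le> Re z \<Longrightarrow> Re z \<le> 1 \<Longrightarrow> norm (F z) \<le> b"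
        using F unfolding calderon_space_def bounded_iff by auto
      have "cmod (h z) \<le> exp \<bar>ln a\<bar> * (b * norm x)" if z: "0 \<le> Re z" "Re z \<le> 1" for z
      proof -
        have "ln a * Re z \<le> \<bar>ln a\<bar> * Re z"
          using z by (intro mult_right_mono) auto
        also have "\<dots> \<le> \<bar>ln a\<bar> * 1"
          using z by (intro mult_left_mono) auto
        finally have "ln a * Re z \<le> \<bar>ln a\<bar> * 1" .
        moreover have "cmod (pairing (F z) x) \<le> b * norm x"
          using pairing_norm_le[of "F z" x] b[OF z] by (smt (verit) mult_right_mono norm_ge_zero)
        ultimately show ?thesis
          unfolding h_def norm_mult by (intro mult_mono) auto
      qed
      then show "bounded (h ` {z. 0 \<le> Re z \<and> Re z \<le> 1})"
        unfolding bounded_iff by blast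
      show "cmod (h (Complex 0 t)) \<le> ?N * ?m" for t
      proof -
        have "cmod (h (Complex 0 t)) \<le> norm (F (Complex 0 t)) * norm x"
          unfolding h_def norm_mult using pairing_norm_le by simp
        also have "\<dots> \<le> ?N * ?m"
          using calderon_norm_ge(1)[OF F, of t]
          by (intro mult_mono) (auto intro: calderon_norm_nonneg[OF F])
        finally show ?thesis .
      qed
      show "cmod (h (Complex 1 t)) \<le> ?N * ?m" for t
      proof -
        define f where "f = inv (dual_op \<iota>) (F (Complex 1 t))"
        have "F (Complex 1 t) = dual_op \<iota> f"
          using F unfolding f_def calderon_space_def by (auto simp: f_inv_into_f)
        then have "cmod (h (Complex 1 t)) = a * cmod (cinner f (\<iota> x))"
          using a by (simp add: h_def norm_mult pairing_dual_op[OF embedding(1)])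
        also have "\<dots> \<le> a * (norm f * norm (\<iota> x))"
          using a by (intro mult_left_mono cinner_norm_le) auto
        also have "\<dots> = norm f * (a * norm (\<iota> x))"
          by simp
        also have "\<dots> \<le> ?N * ?m"
          using calderon_norm_ge(2)[OF F, of t] a unfolding f_def
          by (intro mult_mono) (auto intro: calderon_norm_nonneg[OF F])
        finally show ?thesis .
      qed
    qed (use \<theta> in auto)
    then show "a powr \<theta> * cmod (pairing \<phi> x) \<le> ?N * ?m"
      using a by (simp add: h_def F\<theta> norm_mult powr_def mult.commute)
  qed (simp add: le_max_iff_disj)
qed

lemma embedding_in_interp_space:
  assumes "0 < \<theta>" "\<theta> \<le> 1"
  shows "\<iota> x \<in> interp_space \<iota> id \<theta>"
proof -
  have "(\<lambda>_. \<iota> x) \<in> calderon_space \<iota> id"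
    by (auto simp: calderon_space_def scaleC.zero_right image_constant_conv intro: tendsto_const)
  then show ?thesis
    using assms by (auto simp: interp_space_def)
qed

definition duality_const :: real where
  "duality_const = 1 + M\<^sub>0 + M\<^sub>0 * c\<^sub>1 / c\<^sub>0"

lemma duality_const: "1 \<le> duality_const" "M\<^sub>0 \<le> duality_const" "M\<^sub>0 * c\<^sub>1 / c\<^sub>0 \<le> duality_const"
  using constants by (auto simp: duality_const_def)

text \<open>The pairing makes no sense between the interior values of a curve of functionals on \<open>X\<close>
  and those of a curve in \<open>Y\<close>.  Regularizing the second curve moves it into \<open>X\<close> with
  uniform bounds in both endpoint norms.\<close>

lemma cmod_pairing_le_interp_duality:
  assumes \<phi>: "\<phi> \<in> dual_interp_space \<iota> \<theta>" and \<theta>: "0 < \<theta>" "\<theta> \<le> 1"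
  shows "cmod (pairing \<phi> x) \<le> interp_norm \<iota> id \<theta> (\<iota> x) * (dual_interp_norm \<iota> \<theta> \<phi> * duality_const)"
proof (cases "\<theta> = 1")
  case True
  have "cmod (pairing \<phi> x) \<le> dual_interp_norm \<iota> \<theta> \<phi> * norm (\<iota> x)"
  proof -
    obtain f where f: "\<phi> = dual_op \<iota> f" "norm f = dual_interp_norm \<iota> \<theta> \<phi>"
      using \<phi> True by (auto simp: interp_space_def interp_norm_def f_inv_into_f intro: that[of "inv (dual_op \<iota>) \<phi>"])
    show ?thesis
      unfolding f(2)[symmetric] by (simp add: f(1) pairing_dual_op[OF embedding(1)] cinner_norm_le)
  qed
  also have "\<dots> \<le> (dual_interp_norm \<iota> \<theta> \<phi> * duality_const) * norm (\<iota> x)"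
    using interp_norm_nonneg[OF \<phi>] duality_const(1) by (intro mult_right_mono) (auto simp: mult_le_cancel_left1)
  finally show ?thesis
    using True by (simp add: interp_norm_def mult.commute)
next
  case False
  then have "\<theta> < 1" using \<theta> by simp
  have 0: "0 \<le> duality_const" using duality_const(1) by simp
  show ?thesis
  proof (rule le_interp_normI[OF embedding_in_interp_space[OF \<theta>] \<theta>(1) \<open>\<theta> < 1\<close>])
    show "0 \<le> dual_interp_norm \<iota> \<theta> \<phi> * duality_const"
      using 0 interp_norm_nonneg[OF \<phi>] by simp
    fix G assume G: "G \<in> calderon_space \<iota> id" and G\<theta>: "G (complex_of_real \<theta>) = \<iota> x"
    let ?NG = "calderon_norm \<iota> id G"
    have NG: "0 \<le> ?NG" by (rule calderon_norm_nonneg[OF G])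
    have "cmod (pairing \<phi> x) \<le> dual_interp_norm \<iota> \<theta> \<phi> * (duality_const * ?NG)"
    proof (rule le_interp_normI[OF \<phi> \<theta>(1) \<open>\<theta> < 1\<close>])
      fix F assume F: "F \<in> calderon_space id (dual_op \<iota>)" and F\<theta>: "F (complex_of_real \<theta>) = \<phi>"
      let ?NF = "calderon_norm id (dual_op \<iota>) F"
      have NF: "0 \<le> ?NF" by (rule calderon_norm_nonneg[OF F])
      have reg: "cmod (pairing \<phi> (regularize n (\<iota> x))) \<le> ?NF * (duality_const * ?NG)" for n
      proof -
        interpret reg: bounded_linear "regularize n"
          by (rule bounded_linear_regularize)
        define H where "H z = regularize n (G (cnj z))" for z
        define h where "h z = pairing (F z) (H z)" for z
        have "cmod (h (complex_of_real \<theta>)) \<le> ?NF * (duality_const * ?NG)"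
        proof (rule strip_maximum_principle[of h])
          have "continuous_on {z. 0 \<le> Re z \<and> Re z \<le> 1} (\<lambda>z. G (cnj z))"
            by (rule continuous_on_compose2[of "{z. 0 \<le> Re z \<and> Re z \<le> 1}" G "{z. 0 \<le> Re z \<and> Re z \<le> 1}" cnj])
               (use G in \<open>auto simp: calderon_space_def intro!: continuous_intros\<close>)
          then show "continuous_on {z. 0 \<le> Re z \<and> Re z \<le> 1} h"
            unfolding h_def H_def using F
            by (auto simp: calderon_space_def intro!: pairing.continuous_on reg.continuous_on)
          show "h holomorphic_on {z. 0 < Re z \<and> Re z < 1}"
            unfolding h_def
          proof (rule dual_curve_holomorphic[OF F])
            fix z :: complex assume z: "0 < Re z" "Re z < 1"
            then have "0 < Re (cnj z) \<and> Re (cnj z) < 1" by simp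
            then obtain D where D: "((\<lambda>h. inverse h *\<^sub>C (G (cnj z + h) - G (cnj z))) \<longlongrightarrow> D) (at 0)"
              using G unfolding calderon_space_def by blast
            have "filterlim cnj (at 0) (at 0)"
              unfolding filterlim_at using tendsto_cnj[OF tendsto_ident_at, of 0 UNIV]
              by (auto simp: eventually_at_filter)
            from filterlim_compose[OF D this]
            have "((\<lambda>h. regularize n (inverse (cnj h) *\<^sub>C (G (cnj z + cnj h) - G (cnj z)))) \<longlongrightarrow> regularize n D) (at 0)"
              by (rule reg.tendsto)
            then show "\<exists>D'. ((\<lambda>h. inverse (cnj h) *\<^sub>C (H (z + h) - H z)) \<longlongrightarrow> D') (at 0)"
              by (auto simp: H_def regularize_scaleC reg.diff)
          qed
          obtain b b' where b: "\<And>z. 0 \<le> Re z \<Longrightarrow> Re z \<le> 1 \<Longrightarrow> norm (F z) \<le> b"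
            and b': "\<And>z. 0 \<le> Re z \<Longrightarrow> Re z \<le> 1 \<Longrightarrow> norm (G z) \<le> b'"
            using F G unfolding calderon_space_def bounded_iff by auto
          obtain k where k: "0 \<le> k" "\<And>y. norm (regularize n y) \<le> norm y * k"
            using reg.nonneg_bounded by auto
          have "cmod (h z) \<le> b * (b' * k)" if z: "0 \<le> Re z" "Re z \<le> 1" for z
          proof -
            have "norm (H z) \<le> norm (G (cnj z)) * k"
              unfolding H_def by (rule k(2))
            also have "\<dots> \<le> b' * k"
              using b'[of "cnj z"] z k(1) by (intro mult_right_mono) auto
            finally have "norm (F z) * norm (H z) \<le> b * (b' * k)"
              using b[OF z] order_trans[OF norm_ge_zero b[OF z]] by (intro mult_mono) auto
            then show ?thesis
              unfolding h_def using pairing_norm_le order_trans by blast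
          qed
          then show "bounded (h ` {z. 0 \<le> Re z \<and> Re z \<le> 1})"
            unfolding bounded_iff by blast
          show "cmod (h (Complex 0 t)) \<le> ?NF * (duality_const * ?NG)" for t
          proof -
            define g where "g = inv \<iota> (G (Complex 0 (- t)))"
            have "G (Complex 0 (- t)) = \<iota> g"
              using G unfolding g_def calderon_space_def by (auto simp: f_inv_into_f)
            then have "H (Complex 0 t) = regularize n (\<iota> g)"
              by (simp add: H_def complex_cnj)
            then have "norm (H (Complex 0 t)) \<le> M\<^sub>0 * c\<^sub>1 / c\<^sub>0 * norm g"
              by (simp only: norm_regularize_embedding)
            also have "\<dots> \<le> duality_const * ?NG"
              using calderon_norm_ge(1)[OF G, of "- t"] duality_const 0 NG unfolding g_def
              by (intro mult_mono) auto
            finally have "norm (F (Complex 0 t)) * norm (H (Complex 0 t)) \<le> ?NF * (duality_const * ?NG)"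
              using calderon_norm_ge(1)[OF F, of t] NF by (intro mult_mono) auto
            then show ?thesis
              unfolding h_def using pairing_norm_le order_trans by blast
          qed
          show "cmod (h (Complex 1 t)) \<le> ?NF * (duality_const * ?NG)" for t
          proof -
            define f where "f = inv (dual_op \<iota>) (F (Complex 1 t))"
            have "F (Complex 1 t) = dual_op \<iota> f"
              using F unfolding f_def calderon_space_def by (auto simp: f_inv_into_f)
            then have "h (Complex 1 t) = cinner f (\<iota> (H (Complex 1 t)))"
              by (simp add: h_def pairing_dual_op[OF embedding(1)])
            then have "cmod (h (Complex 1 t)) \<le> norm f * norm (\<iota> (H (Complex 1 t)))"
              by (simp add: cinner_norm_le)
            also have "norm (\<iota> (H (Complex 1 t))) \<le> M\<^sub>0 * norm (G (Complex 1 (- t)))"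
              using norm_embedding_regularize by (simp add: H_def complex_cnj)
            also have "\<dots> \<le> duality_const * ?NG"
              using calderon_norm_ge(2)[OF G, of "- t"] duality_const 0 by (intro mult_mono) auto
            also have "norm f * (duality_const * ?NG) \<le> ?NF * (duality_const * ?NG)"
              using calderon_norm_ge(2)[OF F, of t] 0 NG unfolding f_def
              by (intro mult_right_mono) auto
            finally show ?thesis
              by (simp add: mult_left_mono)
          qed
        qed (use \<theta> in auto)
        then show ?thesis
          by (simp add: h_def H_def F\<theta> G\<theta>)
      qed
      have "(\<lambda>n. cmod (pairing \<phi> (regularize n (\<iota> x)))) \<longlonglongrightarrow> cmod (pairing \<phi> x)"
        by (intro tendsto_norm pairing.tendsto tendsto_const regularize_embedding_tendsto)
      then show "cmod (pairing \<phi> x) \<le> ?NF * (duality_const * ?NG)"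
        using reg by (intro LIMSEQ_le_const2) auto
    qed (use 0 NG in auto)
    then show "cmod (pairing \<phi> x) \<le> ?NG * (dual_interp_norm \<iota> \<theta> \<phi> * duality_const)"
      by (simp add: mult_ac)
  qed
qed

lemma interp_norm_zero:
  assumes "0 < \<theta>" "\<theta> \<le> 1"
  shows "interp_norm \<iota> id \<theta> 0 = 0"
proof (cases "\<theta> = 1")
  case False
  have inv0: "inv \<iota> 0 = 0"
    by (rule inv_f_eq[OF embedding(2) emb.zero])
  have "(\<lambda>_. 0) \<in> calderon_space \<iota> id"
    using emb.zero by (auto simp: calderon_space_def scaleC.zero_right image_constant_conv intro: tendsto_const rangeI[of \<iota> 0, simplified])
  moreover have "calderon_norm \<iota> id (\<lambda>_. 0) = 0"
    by (simp add: calderon_norm_def inv0)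
  ultimately have "Inf {calderon_norm \<iota> id f |f. f \<in> calderon_space \<iota> id \<and> f (complex_of_real \<theta>) = 0} \<le> 0"
    by (intro cInf_lower) (force intro!: bdd_belowI[of _ 0] intro: calderon_norm_nonneg)+
  then have "interp_norm \<iota> id \<theta> 0 \<le> 0"
    using False assms by (simp add: interp_norm_def)
  moreover have "0 \<le> interp_norm \<iota> id \<theta> 0"
    using interp_norm_nonneg[OF embedding_in_interp_space[OF assms, of 0]] by (simp add: emb.zero)
  ultimately show ?thesis by simp
qed (simp add: interp_norm_def)

text \<open>The duality inequality makes the limit that defines the extended pairing independent of the
  approximating sequence, and on \<open>X\<close> a constant sequence is admissible.\<close>

lemma interp_pairing_embedding:
  assumes \<phi>: "\<phi> \<in> dual_interp_space \<iota> \<theta>" and \<theta>: "0 < \<theta>" "\<theta> \<le> 1"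
  shows "interp_pairing \<iota> \<theta> \<phi> (\<iota> x) = pairing \<phi> x"
  unfolding interp_pairing_def
proof (rule the_equality)
  show "\<exists>s. (\<lambda>n. interp_norm \<iota> id \<theta> (\<iota> (s n) - \<iota> x)) \<longlonglongrightarrow> 0 \<and> (\<lambda>n. pairing \<phi> (s n)) \<longlonglongrightarrow> pairing \<phi> x"
    by (intro exI[of _ "\<lambda>_. x"]) (simp add: interp_norm_zero[OF \<theta>])
  fix c assume "\<exists>s. (\<lambda>n. interp_norm \<iota> id \<theta> (\<iota> (s n) - \<iota> x)) \<longlonglongrightarrow> 0 \<and> (\<lambda>n. pairing \<phi> (s n)) \<longlonglongrightarrow> c"
  then obtain s where s: "(\<lambda>n. interp_norm \<iota> id \<theta> (\<iota> (s n) - \<iota> x)) \<longlonglongrightarrow> 0" "(\<lambda>n. pairing \<phi> (s n)) \<longlonglongrightarrow> c"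
    by blast
  let ?C = "dual_interp_norm \<iota> \<theta> \<phi> * duality_const"
  have "(\<lambda>n. interp_norm \<iota> id \<theta> (\<iota> (s n) - \<iota> x) * ?C) \<longlonglongrightarrow> 0 * ?C"
    by (intro tendsto_intros s)
  then have "(\<lambda>n. interp_norm \<iota> id \<theta> (\<iota> (s n) - \<iota> x) * ?C) \<longlonglongrightarrow> 0"
    by simp
  moreover have "cmod (pairing \<phi> (s n) - pairing \<phi> x) \<le> interp_norm \<iota> id \<theta> (\<iota> (s n) - \<iota> x) * ?C" for n
    using cmod_pairing_le_interp_duality[OF \<phi> \<theta>, of "s n - x"] by (simp add: pairing.diff_right emb.diff)
  then have "\<forall>\<^sub>F n in sequentially. norm (pairing \<phi> (s n) - pairing \<phi> x)
      \<le> interp_norm \<iota> id \<theta> (\<iota> (s n) - \<iota> x) * ?C"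
    by simp
  ultimately have "(\<lambda>n. pairing \<phi> (s n) - pairing \<phi> x) \<longlonglongrightarrow> 0"
    by (rule Lim_null_comparison[rotated])
  then have "(\<lambda>n. pairing \<phi> (s n)) \<longlonglongrightarrow> pairing \<phi> x"
    by (rule LIM_zero_cancel)
  with s(2) show "c = pairing \<phi> x"
    by (rule LIMSEQ_unique)
qed

end

section \<open>Resolvents of the extended operators\<close>

context sectorial_operator
begin

text \<open>The equation \<open>(z - B) v = \<phi>\<close> for the extended operator says that \<open>(v, (cnj z - B) w) = \<langle>\<phi>, w\<rangle>\<close>
  for all \<open>w\<close> in \<open>X\<close>.  Since \<open>cnj z - B\<close> maps \<open>X\<close> onto \<open>Y\<close>, this prescribes the inner products of
  \<open>v\<close> with all elements of \<open>Y\<close>, and the Riesz representation solves it.\<close>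

lemma cinner_resolvent_dual:
  assumes z: "z \<in> closed_sector \<omega>"
  shows "cinner (resolvent_dual \<iota> (dual_op B) z \<phi>) y = pairing \<phi> (Res (cnj z) y)"
proof -
  have cz: "cnj z \<in> closed_sector \<omega>"
    by (rule cnj_closed_sector[OF z])
  define G where "G v = z *\<^sub>C dual_op \<iota> v - dual_op B v" for v
  have G: "pairing (G v) w = cinner v (shift (cnj z) w)" for v w
    by (simp add: G_def pairing.diff_left pairing_scaleC_left pairing_dual_op embedding bounded_B
        shift_def cinner.diff_right cinner_scaleC_right)
  have "inj G"
  proof (rule injI)
    fix v v' assume "G v = G v'"
    then have "cinner v (shift (cnj z) w) = cinner v' (shift (cnj z) w)" for w
      by (metis G)
    then have "cinner v y = cinner v' y" for y
      by (metis shift_Res[OF cz])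
    then show "v = v'"
      by (rule cinner_eqI)
  qed
  have "bounded_linear (\<lambda>y. pairing \<phi> (Res (cnj z) y))"
    by (rule bounded_linear_compose[OF pairing.bounded_linear_right bounded_linear_Res[OF cz]])
  then obtain v where v: "\<And>y. cinner v y = pairing \<phi> (Res (cnj z) y)"
    using riesz_antilinear[of "\<lambda>y. pairing \<phi> (Res (cnj z) y)"]
    by (auto simp: Res_scaleC[OF cz] pairing_scaleC_right)
  have "G v = \<phi>"
    by (rule antidual_eqI) (simp add: G v Res_shift[OF cz])
  then have "inv G \<phi> = v"
    by (rule inv_f_eq[OF \<open>inj G\<close>])
  then have "resolvent_dual \<iota> (dual_op B) z \<phi> = v"
    by (simp add: resolvent_dual_def G_def[abs_def])
  then show ?thesis
    by (simp add: v)
qed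

definition resolvent_const :: real where
  "resolvent_const = (1 + M\<^sub>0) / c\<^sub>0 + M\<^sub>0"

lemma resolvent_const_pos: "0 < resolvent_const"
  using constants by (auto simp: resolvent_const_def intro!: add_pos_pos divide_pos_pos)

context
  fixes z assumes z: "z \<in> closed_sector \<omega>"
begin

text \<open>By duality the estimate is one for \<open>x = R(cnj z, B) y\<close>, for which \<open>\<parallel>x\<parallel>\<close> and \<open>(1 + |z|) \<parallel>\<iota> x\<parallel>\<close> are
  bounded by the norm of \<open>y\<close>; hence the weight \<open>a = 1 + |z|\<close> in the interpolation inequality.\<close>

lemma norm_resolvent_dual_interp:
  assumes \<phi>: "\<phi> \<in> dual_interp_space \<iota> \<theta>" and \<theta>: "0 < \<theta>" "\<theta> \<le> 1"
  shows "norm (resolvent_dual \<iota> (dual_op B) z \<phi>)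
    \<le> (1 + cmod z) powr (- \<theta>) * (dual_interp_norm \<iota> \<theta> \<phi> * resolvent_const)"
proof (rule norm_le_cinnerI)
  note cz = cnj_closed_sector[OF z]
  have N: "0 \<le> dual_interp_norm \<iota> \<theta> \<phi>"
    by (rule interp_norm_nonneg[OF \<phi>])
  fix y
  let ?x = "Res (cnj z) y"
  have pos: "0 < 1 + cmod z"
    by (rule add_pos_nonneg) auto
  have "(1 + cmod z) powr \<theta> * cmod (pairing \<phi> ?x)
      \<le> dual_interp_norm \<iota> \<theta> \<phi> * max (norm ?x) ((1 + cmod z) * norm (\<iota> ?x))"
    by (rule cmod_pairing_le_interp[OF \<phi> \<theta> pos])
  also have "\<dots> \<le> dual_interp_norm \<iota> \<theta> \<phi> * (resolvent_const * norm y)"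
  proof (intro mult_left_mono N max.boundedI)
    have "norm ?x \<le> (1 + M\<^sub>0) / c\<^sub>0 * norm y"
      by (rule norm_Res[OF cz])
    also have "\<dots> \<le> resolvent_const * norm y"
      using constants by (intro mult_right_mono) (auto simp: resolvent_const_def)
    finally show "norm ?x \<le> resolvent_const * norm y" .
    have "(1 + cmod z) * norm (\<iota> ?x) \<le> (1 + cmod z) * (M\<^sub>0 / (1 + cmod (cnj z)) * norm y)"
      using pos by (intro mult_left_mono norm_embedding_Res cz) auto
    also have "\<dots> = M\<^sub>0 * norm y"
      using pos by simp
    also have "\<dots> \<le> resolvent_const * norm y"
      using constants by (intro mult_right_mono) (auto simp: resolvent_const_def)
    finally show "(1 + cmod z) * norm (\<iota> ?x) \<le> resolvent_const * norm y" .
  qed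
  finally have "(1 + cmod z) powr \<theta> * cmod (pairing \<phi> ?x)
      \<le> dual_interp_norm \<iota> \<theta> \<phi> * (resolvent_const * norm y)" .
  then show "cmod (cinner (resolvent_dual \<iota> (dual_op B) z \<phi>) y)
      \<le> (1 + cmod z) powr (- \<theta>) * (dual_interp_norm \<iota> \<theta> \<phi> * resolvent_const) * norm y"
    using pos unfolding cinner_resolvent_dual[OF z] by (simp add: powr_minus field_simps)
qed (use resolvent_const_pos interp_norm_nonneg[OF \<phi>] in simp)

end

lemma continuous_on_resolvent_dual:
  "continuous_on (closed_sector \<omega>) (\<lambda>z. resolvent_dual \<iota> (dual_op B) z \<phi>)"
proof (rule lipschitz_on_continuous_on[OF lipschitz_onI])
  let ?L = "norm \<phi> * ((1 + M\<^sub>0) / c\<^sub>0 * M\<^sub>0)"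
  show "0 \<le> ?L"
    using constants by simp
  fix z w assume z: "z \<in> closed_sector \<omega>" and w: "w \<in> closed_sector \<omega>"
  show "dist (resolvent_dual \<iota> (dual_op B) z \<phi>) (resolvent_dual \<iota> (dual_op B) w \<phi>) \<le> ?L * dist z w"
    unfolding dist_norm[of "resolvent_dual \<iota> (dual_op B) z \<phi>"]
  proof (rule norm_le_cinnerI)
    fix y
    have "cmod (pairing \<phi> (Res (cnj z) y - Res (cnj w) y)) \<le> norm \<phi> * norm (Res (cnj z) y - Res (cnj w) y)"
      by (rule pairing_norm_le)
    also have "\<dots> \<le> norm \<phi> * ((1 + M\<^sub>0) / c\<^sub>0 * M\<^sub>0 * dist (cnj z) (cnj w) * norm y)"
      using dist_Res_le[OF cnj_closed_sector[OF z] cnj_closed_sector[OF w], of y]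
      by (intro mult_left_mono) (auto simp: dist_norm)
    also have "dist (cnj z) (cnj w) = dist z w"
      by (simp add: dist_norm flip: complex_cnj_diff)
    finally show "cmod (cinner (resolvent_dual \<iota> (dual_op B) z \<phi> - resolvent_dual \<iota> (dual_op B) w \<phi>) y)
        \<le> ?L * dist z w * norm y"
      by (simp add: cinner.diff_left cinner_resolvent_dual z w pairing.diff_right mult_ac)
  qed (use constants in auto)
qed

end

section \<open>Laplace integrals along rays\<close>

text \<open>Euler's integral for the Gamma function, rescaled.\<close>

lemma has_bochner_integral_powr_exp:
  fixes a b :: real
  assumes "0 < a" "0 < b"
  shows "has_bochner_integral lborel (\<lambda>r. indicator {0<..} r *\<^sub>R (r powr (b - 1) * exp (- (a * r))))
    (Gamma b * a powr (- b))"
proof -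
  have "has_bochner_integral lborel (\<lambda>r. indicator {0..} r * r powr (b - 1) / exp r) (Gamma b)"
    using Gamma_conv_nn_integral_real[OF \<open>0 < b\<close>] Gamma_real_pos[OF \<open>0 < b\<close>]
    by (intro has_bochner_integral_nn_integral) (auto intro!: AE_I2)
  from this[THEN iffD1[OF lborel_has_bochner_integral_real_affine_iff, rotated], of a 0]
  have "has_bochner_integral lborel (\<lambda>r. indicator {0..} (a * r) * (a * r) powr (b - 1) / exp (a * r))
      (Gamma b / a)"
    using \<open>0 < a\<close> by (simp add: divide_inverse mult.commute)
  from has_bochner_integral_mult_right[OF this, of "a powr (1 - b)"]
  have "has_bochner_integral lborel
      (\<lambda>r. a powr (1 - b) * (indicator {0..} (a * r) * (a * r) powr (b - 1) / exp (a * r)))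
      (a powr (1 - b) * (Gamma b / a))"
    by simp
  moreover have "a powr (1 - b) * (indicator {0..} (a * r) * (a * r) powr (b - 1) / exp (a * r))
      = indicator {0<..} r *\<^sub>R (r powr (b - 1) * exp (- (a * r)))" for r
  proof (cases "0 < r")
    case True
    have "a powr (1 - b) * (a * r) powr (b - 1) = r powr (b - 1)"
      using True \<open>0 < a\<close> by (simp add: powr_mult flip: powr_add)
    then show ?thesis
      using True \<open>0 < a\<close> by (simp add: exp_minus field_simps)
  next
    case False
    then show ?thesis
      using \<open>0 < a\<close> by (cases "r = 0") (auto simp: zero_le_mult_iff indicator_def)
  qed
  moreover have "a powr (1 - b) * (Gamma b / a) = Gamma b * a powr (- b)"
    using \<open>0 < a\<close> by (simp add: powr_diff powr_minus field_simps)
  ultimately show ?thesis by simp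
qed

text \<open>The factor \<open>e\<^bsup>t z\<^esup> dz/dr\<close> on the ray \<open>z = r e\<^bsup>i\<gamma>\<^esup>\<close>.\<close>

definition ray_kernel :: "real \<Rightarrow> real \<Rightarrow> real \<Rightarrow> complex" where
  "ray_kernel \<gamma> t r = cis \<gamma> * exp (complex_of_real t * rcis r \<gamma>)"

text \<open>The Borel measure, in place of its completion, gives access to the product measure on which joint
  measurability in \<open>t\<close> and \<open>r\<close> is stated.\<close>

definition ray_integral ::
  "real \<Rightarrow> real \<Rightarrow> (real \<Rightarrow> 'v::{complex_hilbert, second_countable_topology}) \<Rightarrow> 'v" where
  "ray_integral \<gamma> t f = (LINT r|lborel. indicator {0<..} r *\<^sub>R (ray_kernel \<gamma> t r *\<^sub>C f r))"

lemma continuous_on_rcis: "continuous_on S (\<lambda>r. rcis r \<gamma>)"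
  unfolding rcis_def by (intro continuous_intros)

lemma continuous_on_ray_kernel: "continuous_on S (\<lambda>p. ray_kernel \<gamma> (fst p) (snd p))"
  unfolding ray_kernel_def rcis_def by (intro continuous_intros)

lemma continuous_on_ray_kernel_snd: "continuous_on S (\<lambda>r. ray_kernel \<gamma> t r)"
  unfolding ray_kernel_def by (intro continuous_intros continuous_on_rcis)

lemma cmod_ray_kernel: "cmod (ray_kernel \<gamma> t r) = exp (- (- cos \<gamma> * t * r))"
  by (simp add: ray_kernel_def norm_mult rcis_def mult_ac)

lemma cnj_ray_kernel: "cnj (ray_kernel \<gamma> t r) = ray_kernel (- \<gamma>) t r"
proof -
  have "cnj (rcis r \<gamma>) = rcis r (- \<gamma>)"
    by (simp add: rcis_def cis_cnj)
  then show ?thesis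
    by (simp add: ray_kernel_def cis_cnj exp_cnj)
qed

lemma borel_measurable_ray_integrand:
  fixes f :: "real \<Rightarrow> 'v::complex_normed_vector"
  assumes "continuous_on {0<..} f"
  shows "(\<lambda>r. indicator {0<..} r *\<^sub>R (ray_kernel \<gamma> t r *\<^sub>C f r)) \<in> borel_measurable borel"
proof (rule borel_measurable_continuous_on_indicator)
  show "continuous_on {0<..} (\<lambda>r. ray_kernel \<gamma> t r *\<^sub>C f r)"
    by (intro scaleC.continuous_on continuous_on_ray_kernel_snd assms)
qed simp

lemma
  fixes f :: "real \<Rightarrow> 'v::{complex_hilbert, second_countable_topology}"
  assumes f: "continuous_on {0<..} f" and le: "\<And>r. 0 < r \<Longrightarrow> norm (f r) \<le> C * r powr (b - 1)"
    and "0 < b" "0 < t" "cos \<gamma> < 0"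
  shows integrable_ray: "integrable lborel (\<lambda>r. indicator {0<..} r *\<^sub>R (ray_kernel \<gamma> t r *\<^sub>C f r))"
    and norm_ray_integral_le: "norm (ray_integral \<gamma> t f) \<le> C * (Gamma b * (- cos \<gamma> * t) powr (- b))"
proof -
  define g where "g r = C * (indicator {0<..} r *\<^sub>R (r powr (b - 1) * exp (- (- cos \<gamma> * t * r))))" for r
  have a: "0 < - cos \<gamma> * t"
    using assms by (simp add: mult_neg_pos)
  have g: "has_bochner_integral lborel g (C * (Gamma b * (- cos \<gamma> * t) powr (- b)))"
    unfolding g_def by (intro has_bochner_integral_mult_right has_bochner_integral_powr_exp a \<open>0 < b\<close>)
  have le: "norm (indicator {0<..} r *\<^sub>R (ray_kernel \<gamma> t r *\<^sub>C f r)) \<le> g r" for r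
  proof (cases "0 < r")
    case True
    then have "norm (ray_kernel \<gamma> t r *\<^sub>C f r) \<le> exp (- (- cos \<gamma> * t * r)) * (C * r powr (b - 1))"
      unfolding norm_scaleC cmod_ray_kernel by (intro mult_left_mono le) auto
    then show ?thesis
      using True by (simp add: g_def mult_ac)
  qed (simp add: g_def)
  show int: "integrable lborel (\<lambda>r. indicator {0<..} r *\<^sub>R (ray_kernel \<gamma> t r *\<^sub>C f r))"
  proof (rule Bochner_Integration.integrable_bound)
    show "integrable lborel g"
      using g by (simp add: has_bochner_integral_iff)
    show "AE r in lborel. norm (indicator {0<..} r *\<^sub>R (ray_kernel \<gamma> t r *\<^sub>C f r)) \<le> norm (g r)"
      using le by (intro AE_I2) (simp add: order_trans[OF _ abs_ge_self])
  qed (use borel_measurable_ray_integrand[OF f] in simp)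
  have "norm (ray_integral \<gamma> t f) \<le> (LINT r|lborel. g r)"
    unfolding ray_integral_def
    using int g le by (intro Bochner_Integration.integral_norm_bound_integral) (auto simp: has_bochner_integral_iff)
  then show "norm (ray_integral \<gamma> t f) \<le> C * (Gamma b * (- cos \<gamma> * t) powr (- b))"
    using g by (simp add: has_bochner_integral_integral_eq)
qed

lemma borel_measurable_ray_integral:
  fixes f :: "real \<Rightarrow> 'v::{complex_hilbert, second_countable_topology}"
  assumes f: "continuous_on {0<..} f"
  shows "(\<lambda>t. ray_integral \<gamma> t f) \<in> borel_measurable borel"
proof -
  have "(\<lambda>r. indicator {0<..} r *\<^sub>R f r) \<in> borel_measurable borel"
    by (intro borel_measurable_continuous_on_indicator f) auto
  then have f': "(\<lambda>p::real \<times> real. indicator {0<..} (snd p) *\<^sub>R f (snd p)) \<in> borel_measurable borel"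
    by (rule measurable_compose[rotated]) (auto intro!: borel_measurable_continuous_onI continuous_intros)
  have k: "(\<lambda>p::real \<times> real. ray_kernel \<gamma> (fst p) (snd p)) \<in> borel_measurable borel"
    by (intro borel_measurable_continuous_onI continuous_on_ray_kernel)
  have "(\<lambda>p::real \<times> real. ray_kernel \<gamma> (fst p) (snd p) *\<^sub>C (indicator {0<..} (snd p) *\<^sub>R f (snd p)))
      \<in> borel_measurable borel"
    by (rule borel_measurable_continuous_Pair[OF k f', where H = scaleC])
       (intro scaleC.continuous_on continuous_intros)
  then have "(\<lambda>p. case p of (t, r) \<Rightarrow> indicator {0<..} r *\<^sub>R (ray_kernel \<gamma> t r *\<^sub>C f r))
      \<in> borel_measurable borel"
    by (simp add: split_beta scaleC.scaleR_right)
  moreover have "sets (borel \<Otimes>\<^sub>M lborel) = sets (borel :: (real \<times> real) measure)"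
    by (metis borel_prod sets_lborel sets_pair_measure_cong)
  ultimately have "(\<lambda>p. case p of (t, r) \<Rightarrow> indicator {0<..} r *\<^sub>R (ray_kernel \<gamma> t r *\<^sub>C f r))
      \<in> borel_measurable (borel \<Otimes>\<^sub>M lborel)"
    using measurable_cong_sets by blast
  then show ?thesis
    unfolding ray_integral_def by (rule lborel.borel_measurable_lebesgue_integral)
qed

lemma contour_dz_eq_ray_integral:
  fixes G :: "complex \<Rightarrow> 'v::{complex_hilbert, second_countable_topology}"
  assumes "continuous_on {0<..} (\<lambda>r. G (rcis r \<omega>))" "continuous_on {0<..} (\<lambda>r. G (rcis r (- \<omega>)))"
  shows "contour_dz \<omega> (\<lambda>z. exp (complex_of_real t * z) *\<^sub>C G z)
    = ray_integral \<omega> t (\<lambda>r. G (rcis r \<omega>)) - ray_integral (- \<omega>) t (\<lambda>r. G (rcis r (- \<omega>)))"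
proof -
  have "(LINT r:{0<..}|lebesgue. cis \<gamma> *\<^sub>C exp (complex_of_real t * rcis r \<gamma>) *\<^sub>C G (rcis r \<gamma>))
      = ray_integral \<gamma> t (\<lambda>r. G (rcis r \<gamma>))"
    if "continuous_on {0<..} (\<lambda>r. G (rcis r \<gamma>))" for \<gamma>
    using integral_completion[of _ lborel] borel_measurable_ray_integrand[OF that, of \<gamma> t]
    by (simp add: ray_integral_def set_lebesgue_integral_def ray_kernel_def scaleC_scaleC)
  then show ?thesis
    using assms by (simp add: contour_dz_def)
qed

lemma ray_integral_cong:
  "(\<And>r. 0 < r \<Longrightarrow> f r = g r) \<Longrightarrow> ray_integral \<gamma> t f = ray_integral \<gamma> t g"
  unfolding ray_integral_def by (intro Bochner_Integration.integral_cong refl) (auto simp: indicator_def)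

lemma contour_cnj_dz_eq_contour_dz:
  assumes "\<And>r. 0 < r \<Longrightarrow> F (rcis r \<omega>) = H (rcis r (- \<omega>))"
    and "\<And>r. 0 < r \<Longrightarrow> F (rcis r (- \<omega>)) = H (rcis r \<omega>)"
  shows "contour_cnj_dz \<omega> F = - contour_dz \<omega> H"
proof -
  have "(LINT r:{0<..}|lebesgue. cnj (cis \<omega>) *\<^sub>C F (rcis r \<omega>))
      = (LINT r:{0<..}|lebesgue. cis (- \<omega>) *\<^sub>C H (rcis r (- \<omega>)))"
    unfolding set_lebesgue_integral_def
    by (intro Bochner_Integration.integral_cong refl) (auto simp: indicator_def assms cis_cnj)
  moreover have "(LINT r:{0<..}|lebesgue. cnj (cis (- \<omega>)) *\<^sub>C F (rcis r (- \<omega>)))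
      = (LINT r:{0<..}|lebesgue. cis \<omega> *\<^sub>C H (rcis r \<omega>))"
    unfolding set_lebesgue_integral_def
    by (intro Bochner_Integration.integral_cong refl) (auto simp: indicator_def assms cis_cnj)
  ultimately show ?thesis
    by (simp add: contour_cnj_dz_def contour_dz_def)
qed

section \<open>The solution operators\<close>

locale fractional_operator =
  sectorial_operator \<iota> B \<omega> c\<^sub>0 c\<^sub>1 M\<^sub>0
  for \<iota> B :: "'x::{complex_hilbert, second_countable_topology} \<Rightarrow> 'y::{complex_hilbert, second_countable_topology}"
    and \<omega> c\<^sub>0 c\<^sub>1 M\<^sub>0 +
  fixes \<alpha> :: real
  assumes angle: "pi / 2 < \<omega>" "\<omega> < pi"
    and order: "0 < \<alpha>" "\<alpha> \<le> 1"
begin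

lemma cos_angle: "cos \<omega> < 0"
  using cos_monotone_0_pi[of "pi / 2" \<omega>] angle by simp

text \<open>The rays avoid the branch cut of the logarithm because \<open>\<omega> < \<pi>\<close>.\<close>

lemma ray_powr:
  assumes "0 < r" "\<bar>\<gamma>\<bar> = \<omega>"
  shows "rcis r \<gamma> powr complex_of_real \<alpha> = rcis (r powr \<alpha>) (\<alpha> * \<gamma>)"
proof -
  have "Ln (rcis r \<gamma>) = Complex (ln r) \<gamma>"
    using assms angle by (intro Ln_unique) (auto simp: exp_eq_polar rcis_def)
  moreover have "rcis r \<gamma> \<noteq> 0"
    using assms by simp
  ultimately have "rcis r \<gamma> powr complex_of_real \<alpha> = exp (complex_of_real \<alpha> * Complex (ln r) \<gamma>)"
    by (simp add: powr_def)
  also have "\<dots> = rcis (r powr \<alpha>) (\<alpha> * \<gamma>)"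
    using assms by (simp add: exp_eq_polar rcis_def powr_def exp_of_real)
  finally show ?thesis .
qed

lemma ray_powr_in_closed_sector:
  assumes "0 < r" "\<bar>\<gamma>\<bar> = \<omega>"
  shows "rcis r \<gamma> powr complex_of_real \<alpha> \<in> closed_sector \<omega>"
proof -
  have "\<bar>\<alpha> * \<gamma>\<bar> \<le> 1 * \<omega>"
    using assms order by (simp add: abs_mult mult_left_le_one_le)
  then show ?thesis
    using assms unfolding ray_powr[OF assms] closed_sector_def
    by (intro CollectI exI[of _ "r powr \<alpha>"] exI[of _ "\<alpha> * \<gamma>"]) auto
qed

lemma cnj_ray_powr:
  assumes "0 < r" "\<bar>\<gamma>\<bar> = \<omega>"
  shows "cnj (rcis r \<gamma> powr complex_of_real \<alpha>) = rcis r (- \<gamma>) powr complex_of_real \<alpha>"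
proof -
  have neg: "rcis r (- \<gamma>) powr complex_of_real \<alpha> = rcis (r powr \<alpha>) (- (\<alpha> * \<gamma>))"
    using ray_powr[of r "- \<gamma>"] assms by simp
  show ?thesis
    unfolding neg ray_powr[OF assms] by (simp add: rcis_def cis_cnj)
qed

lemma continuous_on_ray_powr:
  assumes "\<bar>\<gamma>\<bar> = \<omega>"
  shows "continuous_on {0<..} (\<lambda>r. rcis r \<gamma> powr complex_of_real \<alpha>)"
proof -
  have "continuous_on {0<..} (\<lambda>r. rcis (r powr \<alpha>) (\<alpha> * \<gamma>))"
    unfolding rcis_def by (intro continuous_intros) auto
  then show ?thesis
    by (rule continuous_on_eq) (simp add: ray_powr assms)
qed

abbreviation ray_resolvent :: "real \<Rightarrow> 'x antidual \<Rightarrow> real \<Rightarrow> 'y" where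
  "ray_resolvent \<gamma> \<phi> r \<equiv> resolvent_dual \<iota> (dual_op B) (rcis r \<gamma> powr complex_of_real \<alpha>) \<phi>"

abbreviation ray_Res :: "real \<Rightarrow> 'y \<Rightarrow> real \<Rightarrow> 'x" where
  "ray_Res \<gamma> y r \<equiv> Res (rcis r \<gamma> powr complex_of_real \<alpha>) y"

lemma continuous_on_ray_resolvent:
  "\<bar>\<gamma>\<bar> = \<omega> \<Longrightarrow> continuous_on {0<..} (ray_resolvent \<gamma> \<phi>)"
  by (rule continuous_on_compose2[OF continuous_on_resolvent_dual continuous_on_ray_powr])
     (use ray_powr_in_closed_sector in blast)+

lemma continuous_on_ray_Res:
  "\<bar>\<gamma>\<bar> = \<omega> \<Longrightarrow> continuous_on {0<..} (ray_Res \<gamma> y)"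
  by (rule continuous_on_compose2[OF continuous_on_Res continuous_on_ray_powr])
     (use ray_powr_in_closed_sector in blast)+

lemma E_op_eq_ray_integral:
  "E_op \<iota> B \<omega> \<alpha> t \<phi> = (1 / (2 * complex_of_real pi * \<i>)) *\<^sub>C
    (ray_integral \<omega> t (ray_resolvent \<omega> \<phi>) - ray_integral (- \<omega>) t (ray_resolvent (- \<omega>) \<phi>))"
  unfolding E_op_def using constants
  by (subst contour_dz_eq_ray_integral[where G = "\<lambda>z. resolvent_dual \<iota> (dual_op B) (z powr complex_of_real \<alpha>) \<phi>"])
     (auto intro!: continuous_on_ray_resolvent)

lemma borel_measurable_E_op: "(\<lambda>t. E_op \<iota> B \<omega> \<alpha> t \<phi>) \<in> borel_measurable borel"
proof -
  have "(\<lambda>t. ray_integral \<gamma> t (ray_resolvent \<gamma> \<phi>)) \<in> borel_measurable borel" if "\<bar>\<gamma>\<bar> = \<omega>" for \<gamma>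
    by (intro borel_measurable_ray_integral continuous_on_ray_resolvent that)
  then have "(\<lambda>t. ray_integral \<omega> t (ray_resolvent \<omega> \<phi>) - ray_integral (- \<omega>) t (ray_resolvent (- \<omega>) \<phi>))
      \<in> borel_measurable borel"
    using constants by (intro borel_measurable_diff) auto
  then show ?thesis
    unfolding E_op_eq_ray_integral
    by (rule measurable_compose)
       (intro borel_measurable_continuous_onI linear_continuous_on scaleC.bounded_linear_right)
qed

text \<open>Lowering the exponent to \<open>\<beta> / \<alpha>\<close> and dropping the summand \<open>1\<close> leaves a pure power of \<open>r\<close>, whose
  Laplace integral is explicit as long as \<open>\<beta> < 1\<close>.\<close>

lemma norm_ray_resolvent_le:
  assumes \<phi>: "\<phi> \<in> dual_interp_space \<iota> \<theta>" and \<theta>: "0 < \<theta>" "\<theta> \<le> 1"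
    and \<beta>: "0 \<le> \<beta>" "\<beta> \<le> \<alpha> * \<theta>" and r: "0 < r" "\<bar>\<gamma>\<bar> = \<omega>"
  shows "norm (ray_resolvent \<gamma> \<phi> r) \<le> dual_interp_norm \<iota> \<theta> \<phi> * resolvent_const * r powr (- \<beta>)"
proof -
  let ?z = "rcis r \<gamma> powr complex_of_real \<alpha>"
  have cmod: "cmod ?z = r powr \<alpha>"
    using r by (simp add: ray_powr)
  have "(1 + cmod ?z) powr (- \<theta>) \<le> (1 + r powr \<alpha>) powr (- (\<beta> / \<alpha>))"
    unfolding cmod using \<beta> order by (intro powr_mono) (auto simp: field_simps)
  also have "\<dots> \<le> (r powr \<alpha>) powr (- (\<beta> / \<alpha>))"
    using r \<beta> order by (intro powr_mono2') auto
  also have "\<dots> = r powr (- \<beta>)"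
    using order by (simp add: powr_powr)
  finally have le: "(1 + cmod ?z) powr (- \<theta>) \<le> r powr (- \<beta>)" .
  have "norm (ray_resolvent \<gamma> \<phi> r) \<le> (1 + cmod ?z) powr (- \<theta>) * (dual_interp_norm \<iota> \<theta> \<phi> * resolvent_const)"
    by (rule norm_resolvent_dual_interp[OF ray_powr_in_closed_sector[OF r] \<phi> \<theta>])
  also have "\<dots> \<le> r powr (- \<beta>) * (dual_interp_norm \<iota> \<theta> \<phi> * resolvent_const)"
    using interp_norm_nonneg[OF \<phi>] resolvent_const_pos
    by (intro mult_right_mono le) auto
  finally show ?thesis
    by (simp add: mult_ac)
qed

lemma norm_E_op_le:
  assumes \<phi>: "\<phi> \<in> dual_interp_space \<iota> \<theta>" and \<theta>: "0 < \<theta>" "\<theta> \<le> 1"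
    and \<beta>: "0 \<le> \<beta>" "\<beta> \<le> \<alpha> * \<theta>" "\<beta> < 1" and t: "0 < t"
  shows "norm (E_op \<iota> B \<omega> \<alpha> t \<phi>) \<le>
    resolvent_const * Gamma (1 - \<beta>) * (- cos \<omega>) powr (\<beta> - 1) * t powr (\<beta> - 1) * dual_interp_norm \<iota> \<theta> \<phi>"
proof -
  define n where "n = dual_interp_norm \<iota> \<theta> \<phi>"
  let ?N = "n * resolvent_const * (Gamma (1 - \<beta>) * (- cos \<omega> * t) powr (- (1 - \<beta>)))"
  have ray: "norm (ray_integral \<gamma> t (ray_resolvent \<gamma> \<phi>)) \<le> ?N" if \<gamma>: "\<bar>\<gamma>\<bar> = \<omega>" for \<gamma>
  proof -
    have cos: "cos \<gamma> = cos \<omega>"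
      using \<gamma> by (metis cos_abs_real)
    show ?thesis
      unfolding cos[symmetric]
      using norm_ray_resolvent_le[OF \<phi> \<theta> \<beta>(1,2) _ \<gamma>] \<beta> t cos_angle cos
      unfolding n_def
      by (intro norm_ray_integral_le continuous_on_ray_resolvent \<gamma>) auto
  qed
  have N: "0 \<le> ?N"
    using order_trans[OF norm_ge_zero ray[of \<omega>]] constants by simp
  have c: "cmod (1 / (2 * complex_of_real pi * \<i>)) \<le> 1 / 2"
    using pi_ge_two by (simp add: norm_divide norm_mult field_simps)
  have "norm (E_op \<iota> B \<omega> \<alpha> t \<phi>) \<le> 1 / 2 * (?N + ?N)"
    unfolding E_op_eq_ray_integral norm_scaleC
    using ray[of \<omega>] ray[of "- \<omega>"] constants c
    by (intro mult_mono order_trans[OF norm_triangle_ineq4 add_mono]) auto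
  also have "\<dots> = ?N"
    by simp
  also have "(- cos \<omega> * t) powr (- (1 - \<beta>)) = (- cos \<omega>) powr (\<beta> - 1) * t powr (\<beta> - 1)"
    using t cos_angle by (subst powr_mult) auto
  finally show ?thesis
    unfolding n_def[symmetric] by (simp add: mult_ac)
qed

text \<open>The contour integral of \<open>E_op\<close>, with the resolvents of \<open>B\<close> itself, as an integral in \<open>X\<close>.\<close>

definition smooth_op :: "real \<Rightarrow> 'y \<Rightarrow> 'x" where
  "smooth_op t y = (1 / (2 * complex_of_real pi * \<i>)) *\<^sub>C
    (ray_integral \<omega> t (ray_Res \<omega> y) - ray_integral (- \<omega>) t (ray_Res (- \<omega>) y))"

lemma cos_ray: "\<bar>\<gamma>\<bar> = \<omega> \<Longrightarrow> cos \<gamma> < 0"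
  using cos_angle by (metis cos_abs_real)

lemma integrable_ray_Res:
  assumes "0 < t" and \<gamma>: "\<bar>\<gamma>\<bar> = \<omega>"
  shows "integrable lborel (\<lambda>r. indicator {0<..} r *\<^sub>R (ray_kernel \<gamma> t r *\<^sub>C ray_Res \<gamma> y r))"
proof (rule integrable_ray[where b = 1])
  show "norm (ray_Res \<gamma> y r) \<le> ((1 + M\<^sub>0) / c\<^sub>0 * norm y) * r powr (1 - 1)" if "0 < r" for r
    using norm_Res[OF ray_powr_in_closed_sector[OF that \<gamma>], of y] that by simp
qed (use assms cos_ray continuous_on_ray_Res in auto)

lemma integrable_ray_resolvent:
  assumes "0 < t" and \<gamma>: "\<bar>\<gamma>\<bar> = \<omega>"
  shows "integrable lborel (\<lambda>r. indicator {0<..} r *\<^sub>R (ray_kernel \<gamma> t r *\<^sub>C ray_resolvent \<gamma> \<phi> r))"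
proof (rule integrable_ray[where b = 1])
  show "norm (ray_resolvent \<gamma> \<phi> r) \<le> (norm \<phi> * ((1 + M\<^sub>0) / c\<^sub>0)) * r powr (1 - 1)" if "0 < r" for r
  proof (rule norm_le_cinnerI)
    note z = ray_powr_in_closed_sector[OF that \<gamma>]
    fix y
    have "cmod (cinner (ray_resolvent \<gamma> \<phi> r) y) \<le> norm \<phi> * norm (Res (cnj (rcis r \<gamma> powr complex_of_real \<alpha>)) y)"
      unfolding cinner_resolvent_dual[OF z] by (rule pairing_norm_le)
    also have "\<dots> \<le> norm \<phi> * ((1 + M\<^sub>0) / c\<^sub>0 * norm y)"
      by (intro mult_left_mono norm_Res cnj_closed_sector z) simp
    finally show "cmod (cinner (ray_resolvent \<gamma> \<phi> r) y)
        \<le> norm \<phi> * ((1 + M\<^sub>0) / c\<^sub>0) * r powr (1 - 1) * norm y"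
      using that by (simp add: mult.assoc)
  qed (use constants in simp)
qed (use assms cos_ray continuous_on_ray_resolvent in auto)

text \<open>The adjoint of a resolvent is the resolvent at the conjugate point, and conjugation maps one ray of
  the contour to the other.\<close>

lemma cinner_ray_integral:
  assumes "0 < t" and \<gamma>: "\<bar>\<gamma>\<bar> = \<omega>"
  shows "cinner (ray_integral \<gamma> t (ray_resolvent \<gamma> \<phi>)) y
    = pairing \<phi> (ray_integral (- \<gamma>) t (ray_Res (- \<gamma>) y))"
proof -
  have "cinner (ray_integral \<gamma> t (ray_resolvent \<gamma> \<phi>)) y
      = (LINT r|lborel. cinner (indicator {0<..} r *\<^sub>R (ray_kernel \<gamma> t r *\<^sub>C ray_resolvent \<gamma> \<phi> r)) y)"
    unfolding ray_integral_def
    by (rule integral_bounded_linear[OF cinner.bounded_linear_left integrable_ray_resolvent[OF assms], symmetric])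
  also have "\<dots> = (LINT r|lborel. pairing \<phi> (indicator {0<..} r *\<^sub>R (ray_kernel (- \<gamma>) t r *\<^sub>C ray_Res (- \<gamma>) y r)))"
  proof (intro Bochner_Integration.integral_cong refl)
    fix r :: real
    show "cinner (indicator {0<..} r *\<^sub>R (ray_kernel \<gamma> t r *\<^sub>C ray_resolvent \<gamma> \<phi> r)) y
        = pairing \<phi> (indicator {0<..} r *\<^sub>R (ray_kernel (- \<gamma>) t r *\<^sub>C ray_Res (- \<gamma>) y r))"
    proof (cases "0 < r")
      case True
      then show ?thesis
        using cnj_ray_kernel[of "- \<gamma>" t r]
        by (simp add: cinner_scaleC_left pairing_scaleC_right
            cinner_resolvent_dual[OF ray_powr_in_closed_sector[OF True \<gamma>]] cnj_ray_powr[OF True \<gamma>])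
    qed (simp add: cinner.zero_left pairing.zero_right)
  qed
  also have "\<dots> = pairing \<phi> (ray_integral (- \<gamma>) t (ray_Res (- \<gamma>) y))"
    unfolding ray_integral_def
    by (rule integral_bounded_linear[OF pairing.bounded_linear_right integrable_ray_Res]) (use assms in auto)
  finally show ?thesis .
qed

lemma cinner_E_op:
  assumes "0 < t"
  shows "cinner (E_op \<iota> B \<omega> \<alpha> t \<phi>) y = pairing \<phi> (smooth_op t y)"
proof -
  have \<omega>: "\<bar>\<omega>\<bar> = \<omega>" "\<bar>- \<omega>\<bar> = \<omega>"
    using constants by auto
  have "cinner (E_op \<iota> B \<omega> \<alpha> t \<phi>) y = 1 / (2 * complex_of_real pi * \<i>) *
      (pairing \<phi> (ray_integral (- \<omega>) t (ray_Res (- \<omega>) y)) - pairing \<phi> (ray_integral \<omega> t (ray_Res \<omega> y)))"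
    unfolding E_op_eq_ray_integral cinner_scaleC_left cinner.diff_left
    using cinner_ray_integral[OF assms \<omega>(1)] cinner_ray_integral[OF assms \<omega>(2)] by simp
  also have "\<dots> = pairing \<phi> (smooth_op t y)"
    unfolding smooth_op_def pairing_scaleC_right pairing.diff_right by (simp add: field_simps)
  finally show ?thesis .
qed

lemma E_op_add: "0 < t \<Longrightarrow> E_op \<iota> B \<omega> \<alpha> t (\<phi> + \<psi>) = E_op \<iota> B \<omega> \<alpha> t \<phi> + E_op \<iota> B \<omega> \<alpha> t \<psi>"
  by (rule cinner_eqI) (simp add: cinner_E_op cinner_add_left pairing.add_left)

lemma E_op_scaleC: "0 < t \<Longrightarrow> E_op \<iota> B \<omega> \<alpha> t (c *\<^sub>C \<phi>) = c *\<^sub>C E_op \<iota> B \<omega> \<alpha> t \<phi>"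
  by (rule cinner_eqI) (simp add: cinner_E_op cinner_scaleC_left pairing_scaleC_left)

text \<open>Conjugation exchanges the rays of the contour and so reverses it, which cancels the sign in the
  definition of \<open>E_star\<close>.\<close>

lemma E_star_eq_E_op: "E_star \<iota> B \<omega> \<alpha> t \<phi> = E_op \<iota> B \<omega> \<alpha> t \<phi>"
proof -
  let ?H = "\<lambda>z. exp (complex_of_real t * z) *\<^sub>C resolvent_dual \<iota> (dual_op B) (z powr complex_of_real \<alpha>) \<phi>"
  have cnj: "cnj (rcis r \<gamma>) = rcis r (- \<gamma>)" for r \<gamma>
    by (simp add: rcis_def cis_cnj)
  have "contour_cnj_dz \<omega> (\<lambda>z. exp (complex_of_real t * cnj z) *\<^sub>C
      resolvent_dual \<iota> (dual_op B) (cnj (z powr complex_of_real \<alpha>)) \<phi>) = - contour_dz \<omega> ?H"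
    using constants
    by (intro contour_cnj_dz_eq_contour_dz) (simp_all add: cnj cnj_ray_powr)
  then show ?thesis
    by (simp add: E_star_def E_op_def scaleC.minus_left scaleC.minus_right)
qed

end

locale fractional_pair =
  sectorial_pair \<iota> A Astar \<omega>\<^sub>0 c\<^sub>0 c\<^sub>1 M\<^sub>0
  for \<iota> :: "'x::{complex_hilbert, second_countable_topology} \<Rightarrow> 'y::{complex_hilbert, second_countable_topology}"
    and A Astar \<omega>\<^sub>0 c\<^sub>0 c\<^sub>1 M\<^sub>0 +
  fixes \<alpha> :: real
  assumes order: "0 < \<alpha>" "\<alpha> \<le> 1"
begin

sublocale A: fractional_operator \<iota> A \<omega>\<^sub>0 c\<^sub>0 c\<^sub>1 M\<^sub>0 \<alpha>
  using embedding bounded_A constants resolvent_set_A resolvent_A norm_A order pi_gt_zero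
  by unfold_locales auto

sublocale S: fractional_operator \<iota> Astar \<omega>\<^sub>0 c\<^sub>0 c\<^sub>1 M\<^sub>0 \<alpha>
  using embedding bounded_Astar constants resolvent_set_Astar resolvent_Astar norm_Astar order pi_gt_zero
  by unfold_locales auto

lemma resolvent_dual_A_embedding:
  assumes z: "z \<in> closed_sector \<omega>\<^sub>0"
  shows "resolvent_dual \<iota> (dual_op A) z (dual_op \<iota> y) = \<iota> (S.Res z y)"
proof (rule cinner_eqI)
  fix w
  note cz = cnj_closed_sector[OF z]
  let ?x = "A.Res (cnj z) w" and ?v = "S.Res z y"
  have "cinner (resolvent_dual \<iota> (dual_op A) z (dual_op \<iota> y)) w = cinner y (\<iota> ?x)"
    by (simp add: A.cinner_resolvent_dual[OF z] pairing_dual_op[OF embedding(1)])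
  also have "\<dots> = cinner (S.shift z ?v) (\<iota> ?x)"
    by (simp add: S.shift_Res[OF z])
  also have "\<dots> = cinner (\<iota> ?v) (A.shift (cnj z) ?x)"
  proof -
    have "cinner (Astar ?v) (\<iota> ?x) = cinner (\<iota> ?v) (A ?x)"
      by (metis adjoint cinner_commute)
    then show ?thesis
      by (simp add: S.shift_def A.shift_def cinner.diff_left cinner.diff_right cinner_scaleC_left
          cinner_scaleC_right)
  qed
  also have "\<dots> = cinner (\<iota> ?v) w"
    by (simp add: A.shift_Res[OF cz])
  finally show "cinner (resolvent_dual \<iota> (dual_op A) z (dual_op \<iota> y)) w = cinner (\<iota> ?v) w" .
qed

text \<open>On \<open>Y\<close> the resolvent of the extended operator \<open>dual_op A\<close> is that of \<open>Astar\<close>, with values in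
  \<open>X\<close>, and the contour integral converges in the norm of \<open>X\<close>.\<close>

lemma E_star_embedding:
  assumes "0 < t"
  shows "E_star \<iota> A \<omega>\<^sub>0 \<alpha> t (dual_op \<iota> y) = \<iota> (S.smooth_op t y)"
proof -
  have ray: "ray_integral \<gamma> t (A.ray_resolvent \<gamma> (dual_op \<iota> y)) = \<iota> (ray_integral \<gamma> t (S.ray_Res \<gamma> y))"
    if \<gamma>: "\<bar>\<gamma>\<bar> = \<omega>\<^sub>0" for \<gamma>
  proof -
    have "ray_integral \<gamma> t (A.ray_resolvent \<gamma> (dual_op \<iota> y)) = ray_integral \<gamma> t (\<lambda>r. \<iota> (S.ray_Res \<gamma> y r))"
      by (intro ray_integral_cong resolvent_dual_A_embedding A.ray_powr_in_closed_sector \<gamma>)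
    also have "\<dots> = (LINT r|lborel. \<iota> (indicator {0<..} r *\<^sub>R (ray_kernel \<gamma> t r *\<^sub>C S.ray_Res \<gamma> y r)))"
      by (simp add: ray_integral_def A.emb.scaleR bounded_clinear_scaleC[OF embedding(1)])
    also have "\<dots> = \<iota> (ray_integral \<gamma> t (S.ray_Res \<gamma> y))"
      unfolding ray_integral_def
      by (rule integral_bounded_linear[OF A.emb.bounded_linear_axioms S.integrable_ray_Res[OF assms \<gamma>]])
    finally show ?thesis .
  qed
  have "\<bar>\<omega>\<^sub>0\<bar> = \<omega>\<^sub>0" "\<bar>- \<omega>\<^sub>0\<bar> = \<omega>\<^sub>0"
    using S.constants by auto
  from ray[OF this(1)] ray[OF this(2)] show ?thesis
    by (simp add: A.E_star_eq_E_op A.E_op_eq_ray_integral S.smooth_op_def A.emb.diff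
        bounded_clinear_scaleC[OF embedding(1)])
qed

end

section \<open>The optimal control problem\<close>

text \<open>After the reflection \<open>s \<mapsto> T - s\<close> the integrand is bounded by a multiple of the Gamma integrand.\<close>

lemma integrable_shifted_powr:
  fixes \<beta> T :: real
  assumes "0 < \<beta>" "\<beta> \<le> 1"
  shows "integrable (time_measure T) (\<lambda>s. (T - s) powr (\<beta> - 1))"
proof -
  define f where "f r = indicator {0<..<T} r *\<^sub>R r powr (\<beta> - 1)" for r
  have "integrable lborel f"
  proof (rule Bochner_Integration.integrable_bound)
    show "integrable lborel (\<lambda>r. exp T * (indicator {0<..} r *\<^sub>R (r powr (\<beta> - 1) * exp (- (1 * r)))))"
      using has_bochner_integral_powr_exp[of 1 \<beta>] \<open>0 < \<beta>\<close> by (simp add: has_bochner_integral_iff)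
    show "f \<in> borel_measurable lborel"
      unfolding f_def by measurable
    show "AE r in lborel. norm (f r) \<le> norm (exp T * (indicator {0<..} r *\<^sub>R (r powr (\<beta> - 1) * exp (- (1 * r)))))"
    proof (rule AE_I2)
      fix r :: real
      show "norm (f r) \<le> norm (exp T * (indicator {0<..} r *\<^sub>R (r powr (\<beta> - 1) * exp (- (1 * r)))))"
      proof (cases "0 < r \<and> r < T")
        case True
        then have "1 * r powr (\<beta> - 1) \<le> exp (T - r) * r powr (\<beta> - 1)"
          by (intro mult_right_mono) auto
        then show ?thesis
          using True by (simp add: f_def exp_diff exp_minus field_simps)
      qed (auto simp: f_def indicator_def)
    qed
  qed
  then have "integrable lborel (\<lambda>s. f (T + (- 1) * s))"
    by (subst lborel_integrable_real_affine_iff) auto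
  then have int: "integrable lebesgue (\<lambda>s. f (T + (- 1) * s))"
    by (subst integrable_completion) auto
  have "f (T + (- 1) * s) = indicator {0<..<T} s *\<^sub>R (T - s) powr (\<beta> - 1)" for s
    by (auto simp: f_def indicator_def)
  with int show ?thesis
    by (simp add: integrable_restrict_space)
qed

lemma cinner_eq_inner: "cinner x y = complex_of_real (inner x y) + \<i> * complex_of_real (inner x (\<i> *\<^sub>C y))"
  by (simp add: complex_eq_iff inner_Re_cinner cinner_scaleC_right)

lemma integrable_cinner_L2:
  assumes "u \<in> L2_space T" "v \<in> L2_space T"
  shows "integrable (time_measure T) (\<lambda>t. cinner (u t) (v t))"
proof -
  have "strongly_measurable (time_measure T) (\<lambda>t. \<i> *\<^sub>C v t)"
    using assms(2)
    by (intro strongly_measurable_compose2[where h = "\<lambda>x y. \<i> *\<^sub>C x" and v = v])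
       (auto simp: L2_space_def intro!: scaleC.continuous_on continuous_intros)
  then have "(\<lambda>t. \<i> *\<^sub>C v t) \<in> L2_space T"
    using assms(2) by (simp add: L2_space_def norm_scaleC)
  then show ?thesis
    unfolding cinner_eq_inner using assms
    by (intro Bochner_Integration.integrable_add integrable_mult_right integrable_of_real integrable_inner_L2)
qed

text \<open>The data of the theorem, for which the kernel \<open>K\<close> of the abstract control problem is built.\<close>

locale parabolic_control =
  fractional_pair \<iota> A Astar \<omega>\<^sub>0 c\<^sub>0 c\<^sub>1 M\<^sub>0 \<alpha>
  for \<iota> :: "'x::{complex_hilbert, second_countable_topology} \<Rightarrow> 'y::{complex_hilbert, second_countable_topology}"
    and A Astar \<omega>\<^sub>0 c\<^sub>0 c\<^sub>1 M\<^sub>0 \<alpha> +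
  fixes \<theta>\<^sub>0 T \<nu> :: real and R :: "'z::complex_hilbert \<Rightarrow> 'x antidual" and U :: "(real \<Rightarrow> 'z) set" and y\<^sub>d :: 'y
  assumes theta: "0 < \<theta>\<^sub>0" "\<theta>\<^sub>0 \<le> 1"
    and control_op: "bounded_control_op \<iota> \<theta>\<^sub>0 R"
    and admissible: "admissible_set T U"
    and weight: "0 < \<nu>"
begin

definition K :: "real \<Rightarrow> 'z \<Rightarrow> 'y" where
  "K t w = E_op \<iota> Astar \<omega>\<^sub>0 \<alpha> (T - t) (R w)"

lemma R_in_interp_space: "R w \<in> dual_interp_space \<iota> \<theta>\<^sub>0"
  using control_op by (simp add: bounded_control_op_def)

lemma K_add: "t < T \<Longrightarrow> K t (w + w') = K t w + K t w'"
  using control_op by (simp add: K_def bounded_control_op_def S.E_op_add)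

lemma K_scaleC: "t < T \<Longrightarrow> K t (c *\<^sub>C w) = c *\<^sub>C K t w"
  using control_op by (simp add: K_def bounded_control_op_def S.E_op_scaleC)

text \<open>The cap keeps the exponent below \<open>1\<close>, as the convergence of the Laplace integral at \<open>r = 0\<close>
  requires; any other cap in the open unit interval would serve as well.\<close>

definition \<beta> :: real where
  "\<beta> = min (\<alpha> * \<theta>\<^sub>0) (1 / 2)"

lemma beta: "0 < \<beta>" "\<beta> \<le> \<alpha> * \<theta>\<^sub>0" "\<beta> < 1"
  using order theta by (auto simp: \<beta>_def)

lemma norm_K_bound: "\<exists>C. \<forall>t<T. \<forall>w. norm (K t w) \<le> C * (T - t) powr (\<beta> - 1) * norm w"
proof -
  obtain c where c: "\<And>w. dual_interp_norm \<iota> \<theta>\<^sub>0 (R w) \<le> c * norm w"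
    using control_op unfolding bounded_control_op_def by blast
  let ?C = "S.resolvent_const * Gamma (1 - \<beta>) * (- cos \<omega>\<^sub>0) powr (\<beta> - 1)"
  have "0 \<le> S.resolvent_const"
    using S.resolvent_const_pos by simp
  moreover have "0 < Gamma (1 - \<beta>)"
    using beta by (intro Gamma_real_pos) simp
  ultimately have C: "0 \<le> ?C"
    by simp
  have "norm (K t w) \<le> ?C * c * (T - t) powr (\<beta> - 1) * norm w" if "t < T" for t w
  proof -
    have "norm (K t w) \<le> ?C * (T - t) powr (\<beta> - 1) * dual_interp_norm \<iota> \<theta>\<^sub>0 (R w)"
      unfolding K_def using beta that
      by (intro S.norm_E_op_le[OF R_in_interp_space theta]) auto
    also have "\<dots> \<le> ?C * (T - t) powr (\<beta> - 1) * (c * norm w)"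
      using C by (intro mult_left_mono c) auto
    finally show ?thesis
      by (simp add: mult_ac)
  qed
  then show ?thesis by blast
qed

lemma bounded_linear_K:
  assumes "t < T"
  shows "bounded_linear (K t)"
proof -
  obtain C where "\<And>w. norm (K t w) \<le> C * (T - t) powr (\<beta> - 1) * norm w"
    using norm_K_bound assms by blast
  then show ?thesis
    using assms
    by (intro bounded_linear_intro[where K = "C * (T - t) powr (\<beta> - 1)"])
       (auto simp: K_add K_scaleC scaleR_scaleC mult.commute)
qed

definition k :: "real \<Rightarrow> real" where
  "k t = (SOME C. \<forall>t<T. \<forall>w. norm (K t w) \<le> C * (T - t) powr (\<beta> - 1) * norm w) * (T - t) powr (\<beta> - 1)"

lemma norm_K_le: "t < T \<Longrightarrow> norm (K t w) \<le> k t * norm w"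
  using someI_ex[OF norm_K_bound] unfolding k_def by blast

lemma measurable_K: "(\<lambda>t. K t w) \<in> borel_measurable (time_measure T)"
proof -
  have "(\<lambda>t. K t w) \<in> borel_measurable borel"
    unfolding K_def by (rule measurable_compose[OF _ S.borel_measurable_E_op]) measurable
  then show ?thesis
    by (intro measurable_restrict_space1 measurable_completion) simp
qed

sublocale control: control_problem T \<nu> U K k y\<^sub>d
proof (rule control_problem.intro)
  show "integrable (time_measure T) k"
    unfolding k_def using beta by (intro integrable_mult_right integrable_shifted_powr) auto
  show "linear (K t)" if "t < T" for t
    by (rule bounded_linear.linear[OF bounded_linear_K[OF that]])
qed (auto intro: admissible weight norm_K_le measurable_K)

lemma S_op_eq: "S_op \<iota> Astar \<omega>\<^sub>0 \<alpha> (\<lambda>t. R (u t)) T = control.S u"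
  by (simp add: S_op_def control.S_def K_def set_lebesgue_integral_def integral_restrict_space)

lemma cost_eq: "cost \<iota> Astar \<omega>\<^sub>0 \<alpha> T R y\<^sub>d \<nu> = control.J"
  by (rule ext) (simp add: cost_def control.J_def S_op_eq)

text \<open>The adjoint state takes values in \<open>X\<close> before the final time, so the dual pairing in the
  definition of the adjoint control operator is that of \<open>X\<close>, where the adjointness of the solution
  operators applies.\<close>

lemma cinner_control_adjoint:
  assumes t: "t < T"
  shows "cinner (control_adjoint \<iota> \<theta>\<^sub>0 R (S_star_delta \<iota> A \<omega>\<^sub>0 \<alpha> T (dual_op \<iota> y) t)) w = cinner y (K t w)"
proof -
  have eq: "cnj (interp_pairing \<iota> \<theta>\<^sub>0 (R w) (S_star_delta \<iota> A \<omega>\<^sub>0 \<alpha> T (dual_op \<iota> y) t)) = cinner y (K t w)" for w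
  proof -
    have "interp_pairing \<iota> \<theta>\<^sub>0 (R w) (S_star_delta \<iota> A \<omega>\<^sub>0 \<alpha> T (dual_op \<iota> y) t)
        = pairing (R w) (S.smooth_op (T - t) y)"
      using t by (simp add: S_star_delta_def E_star_embedding S.interp_pairing_embedding[OF R_in_interp_space theta])
    also have "\<dots> = cinner (K t w) y"
      using t by (simp add: K_def S.cinner_E_op)
    finally show ?thesis
      by (simp flip: cinner_commute)
  qed
  have "\<exists>!z. \<forall>w. cinner z w = cinner y (K t w)"
  proof (rule riesz_antilinear)
    show "bounded_linear (\<lambda>w. cinner y (K t w))"
      by (rule bounded_linear_compose[OF cinner.bounded_linear_right bounded_linear_K[OF t]])
  qed (simp add: K_scaleC t cinner_scaleC_right)
  from theI'[OF this] show ?thesis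
    unfolding control_adjoint_def eq by blast
qed

lemma first_order_condition:
  assumes u: "minimizer control.J U u" and v: "v \<in> U"
    and p: "p = S_star_delta \<iota> A \<omega>\<^sub>0 \<alpha> T (dual_op \<iota> (control.S u - y\<^sub>d))"
  shows "integrable (time_measure T) (\<lambda>t. cinner (control_adjoint \<iota> \<theta>\<^sub>0 R (p t) + \<nu> *\<^sub>R u t) (v t - u t))"
    and "0 \<le> Re (LINT t|time_measure T. cinner (control_adjoint \<iota> \<theta>\<^sub>0 R (p t) + \<nu> *\<^sub>R u t) (v t - u t))"
proof -
  let ?M = "time_measure T" and ?y = "control.S u - y\<^sub>d"
  define g where "g t = cinner (control_adjoint \<iota> \<theta>\<^sub>0 R (p t) + \<nu> *\<^sub>R u t) (v t - u t)" for t
  define h where "h t = cinner ?y (K t (v t) - K t (u t)) + of_real \<nu> * cinner (u t) (v t - u t)" for t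
  have "u \<in> U"
    using u by (simp add: minimizer_def)
  have gh: "g t = h t" if "t \<in> space ?M" for t
  proof -
    have "t < T" using that by simp
    then show ?thesis
      using bounded_linear.linear[OF bounded_linear_K, THEN linear_diff, of t]
      by (simp add: g_def h_def p cinner_control_adjoint cinner_add_left cinner_scaleR_left)
  qed
  have K: "integrable ?M (\<lambda>t. K t (v t) - K t (u t))"
    by (intro Bochner_Integration.integrable_diff control.integrable_K_compose v \<open>u \<in> U\<close>)
  have uv: "integrable ?M (\<lambda>t. cinner (u t) (v t - u t))"
    by (intro integrable_cinner_L2 L2_space_diff control.admissible_L2 v \<open>u \<in> U\<close>)
  have yK: "integrable ?M (\<lambda>t. cinner ?y (K t (v t) - K t (u t)))"
    by (rule integrable_bounded_linear[OF cinner.bounded_linear_right K])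
  have "integrable ?M h"
    unfolding h_def by (intro Bochner_Integration.integrable_add integrable_mult_right yK uv)
  then have "integrable ?M g"
    using gh by (subst Bochner_Integration.integrable_cong[of _ _ _ h]) auto
  then show "integrable ?M (\<lambda>t. cinner (control_adjoint \<iota> \<theta>\<^sub>0 R (p t) + \<nu> *\<^sub>R u t) (v t - u t))"
    unfolding g_def[abs_def] .
  have "(LINT t|?M. g t) = (LINT t|?M. h t)"
    using gh by (intro Bochner_Integration.integral_cong) auto
  also have "\<dots> = cinner ?y (LINT t|?M. K t (v t) - K t (u t)) + of_real \<nu> * (LINT t|?M. cinner (u t) (v t - u t))"
    unfolding h_def using yK uv integral_bounded_linear[OF cinner.bounded_linear_right K] by simp
  also have "(LINT t|?M. K t (v t) - K t (u t)) = control.S v - control.S u"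
    unfolding control.S_def using control.integrable_K_compose[OF v] control.integrable_K_compose[OF \<open>u \<in> U\<close>] by simp
  finally have "Re (LINT t|?M. g t) = inner ?y (control.S v - control.S u)
      + \<nu> * Re (LINT t|?M. cinner (u t) (v t - u t))"
    by (simp add: inner_Re_cinner)
  also have "Re (LINT t|?M. cinner (u t) (v t - u t)) = (LINT t|?M. inner (u t) (v t - u t))"
    using integral_bounded_linear[OF bounded_linear_Re uv] by (simp add: inner_Re_cinner)
  also have "inner ?y (control.S v - control.S u) + \<nu> * (LINT t|?M. inner (u t) (v t - u t)) = control.slope u v"
    by (simp add: control.slope_def)
  finally show "0 \<le> Re (LINT t|?M. cinner (control_adjoint \<iota> \<theta>\<^sub>0 R (p t) + \<nu> *\<^sub>R u t) (v t - u t))"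
    using control.slope_nonneg[OF u v] by (simp add: g_def)
qed

end

theorem theorem2p1:
  fixes \<iota> :: "'x::{complex_hilbert, second_countable_topology} \<Rightarrow>
      'y::{complex_hilbert, second_countable_topology}"
    and A Astar :: "'x \<Rightarrow> 'y"
    and R :: "'z::complex_hilbert \<Rightarrow> 'x antidual"
    and U\<^sub>a\<^sub>d :: "(real \<Rightarrow> 'z) set"
    and y\<^sub>d :: 'y
    and \<omega>\<^sub>0 c\<^sub>0 c\<^sub>1 M\<^sub>0 \<alpha> T \<theta>\<^sub>0 \<nu> :: real
  assumes "sectorial_pair \<iota> A Astar \<omega>\<^sub>0 c\<^sub>0 c\<^sub>1 M\<^sub>0"
    and "0 < \<alpha>" "\<alpha> \<le> 1" "0 < T" "0 < \<theta>\<^sub>0" "\<theta>\<^sub>0 \<le> 1"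
    and "bounded_control_op \<iota> \<theta>\<^sub>0 R"
    and "admissible_set T U\<^sub>a\<^sub>d"
    and "0 < \<nu>"
  shows "let J = cost \<iota> Astar \<omega>\<^sub>0 \<alpha> T R y\<^sub>d \<nu> in
    (\<exists>u. minimizer J U\<^sub>a\<^sub>d u) \<and>
    (\<forall>u u'. minimizer J U\<^sub>a\<^sub>d u \<and> minimizer J U\<^sub>a\<^sub>d u' \<longrightarrow>
       (AE t in lebesgue_on {0<..<T}. u t = u' t)) \<and>
    (\<forall>u y p. minimizer J U\<^sub>a\<^sub>d u \<and>
       y = S_op \<iota> Astar \<omega>\<^sub>0 \<alpha> (\<lambda>t. R (u t)) \<and>
       p = S_star_delta \<iota> A \<omega>\<^sub>0 \<alpha> T (dual_op \<iota> (y T - y\<^sub>d)) \<longrightarrow>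
       (\<forall>v\<in>U\<^sub>a\<^sub>d.
          integrable (lebesgue_on {0<..<T})
            (\<lambda>t. cinner (control_adjoint \<iota> \<theta>\<^sub>0 R (p t) + \<nu> *\<^sub>R u t) (v t - u t)) \<and>
          0 \<le> Re (LINT t|lebesgue_on {0<..<T}.
            cinner (control_adjoint \<iota> \<theta>\<^sub>0 R (p t) + \<nu> *\<^sub>R u t) (v t - u t))))"
proof -
  interpret pair: sectorial_pair \<iota> A Astar \<omega>\<^sub>0 c\<^sub>0 c\<^sub>1 M\<^sub>0
    by fact
  interpret parabolic_control \<iota> A Astar \<omega>\<^sub>0 c\<^sub>0 c\<^sub>1 M\<^sub>0 \<alpha> \<theta>\<^sub>0 T \<nu> R U\<^sub>a\<^sub>d y\<^sub>d
    by unfold_locales (fact assms)+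
  show ?thesis
    unfolding Let_def cost_eq
  proof (intro conjI allI impI ballI; (elim conjE)?)
    show "\<exists>u. minimizer control.J U\<^sub>a\<^sub>d u"
      by (rule control.minimizer_exists)
  next
    fix u u' assume "minimizer control.J U\<^sub>a\<^sub>d u" "minimizer control.J U\<^sub>a\<^sub>d u'"
    then show "AE t in time_measure T. u t = u' t"
      by (rule control.minimizer_unique)
  next
    fix u y p v
    assume u: "minimizer control.J U\<^sub>a\<^sub>d u" and v: "v \<in> U\<^sub>a\<^sub>d"
      and y: "y = S_op \<iota> Astar \<omega>\<^sub>0 \<alpha> (\<lambda>t. R (u t))"
      and p: "p = S_star_delta \<iota> A \<omega>\<^sub>0 \<alpha> T (dual_op \<iota> (y T - y\<^sub>d))"
    have p': "p = S_star_delta \<iota> A \<omega>\<^sub>0 \<alpha> T (dual_op \<iota> (control.S u - y\<^sub>d))"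
      by (simp add: p y S_op_eq)
    show "integrable (time_measure T) (\<lambda>t. cinner (control_adjoint \<iota> \<theta>\<^sub>0 R (p t) + \<nu> *\<^sub>R u t) (v t - u t))"
      and "0 \<le> Re (LINT t|time_measure T. cinner (control_adjoint \<iota> \<theta>\<^sub>0 R (p t) + \<nu> *\<^sub>R u t) (v t - u t))"
      by (rule first_order_condition[OF u v p'])+
  qed
qed

end
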